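(* Let $X$ be toric Fano of complex dimension $n$, let $P\subset M_{\mathbb R}$ be the polytope associated to $(X,-K_X)$, let $H\subset\mathrm{Aut}\,P$ be a subgroup, and let $G(H)=H\ltimes(S^1)^n\subset\mathrm{Aut}\,X$. Then for every $k\in\mathbb N$, $$\mathrm{glct}_{k,G(H)}=\alpha_{k,G(H)}.$$
   Context: $\mathbb N=\{1,2,\dots\}$. $N\cong\mathbb Z^n$ is a lattice, $M=\mathrm{Hom}(N,\mathbb Z)$, $M_{\mathbb R}=M\otimes\mathbb R$. "Toric Fano" means a smooth projective toric variety $X=X(\Delta)$ with $-K_X$ ample, where the rays of the fan $\Delta$ in $N\otimes\mathbb R$ have primitive generators $v_1,\dots,v_d\in N$. $P=\{y\in M_{\mathbb R}:\langle y,-v_i\rangle\le1,\ i=1,\dots,d\}$. $\mathrm{Aut}\,P$ is the (finite) group of $\sigma\in GL(M)$ with $\sigma(P)=P$. Each $\sigma$ acts on $X$ by the toric automorphism extending the group automorphism $t\mapsto t\circ\sigma^{-1}$ of the open torus $(\mathbb C^* )^n=\mathrm{Hom}(M,\mathbb C^* )$. $G(H)=H\ltimes(S^1)^n$ is the compact group generated by $H$ and the maximal compact subgroup $(S^1)^n$ of $(\mathbb C^* )^n$. For a nonzero complex subspace $V\subset H^0(X,-kK_X)$ with basis $\{\nu_j\}$, $$\mathrm{lct}|V|=\sup\Big\{c>0:\ \big(\textstyle\sum_j|\nu_j(z)|^2\big)^{-c}\text{ is locally integrable on }X\Big\}$$ (in local trivializations; independent of the basis). For a compact subgroup $G\subset\mathrm{Aut}\,X$,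 acting naturally on $H^0(X,-kK_X)$, $$\mathrm{glct}_{k,G}=k\inf\{\mathrm{lct}|V|:\ 0\ne V\subset H^0(X,-kK_X)\ \text{a } G\text{-invariant complex subspace}\}.$$ Fix a continuous $G$-invariant Hermitian metric $h$ on $-kK_X$ and a continuous (positive) volume form $\mu$ on $X$. Let $\mathcal H_k^G$ be the set of $G$-invariant functions $\varphi=\frac1k\log\sum_i|s_i|_h^2$ with $\{s_i\}$ a basis of $H^0(X,-kK_X)$. Then $$\alpha_{k,G}=\sup\Big\{c>0:\ \sup_{\varphi\in\mathcal H_k^G}\int_Xe^{-c(\varphi-\sup\varphi)}d\mu<\infty\Big\},$$ which does not depend on the choice of $h$ and $\mu$. *)

theory Defs
  imports "HOL-Analysis.Analysis" "HOL-Library.Function_Algebras" "HOL-Algebra.Group"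
begin

section \<open>Fans\<close>

text \<open>
  Both the lattice \<open>N\<close> and its dual \<open>M\<close> are \<open>int ^ 'n\<close> (with \<open>n = CARD('n)\<close>), paired by the
  standard dot product; \<open>N\<^sub>\<real>\<close> and \<open>M\<^sub>\<real>\<close> are \<open>real ^ 'n\<close>.
\<close>

definition pairing :: "int ^ 'n \<Rightarrow> int ^ 'n \<Rightarrow> int"
  where "pairing u v = (\<Sum>i\<in>UNIV. u $ i * v $ i)"

definition real_vec :: "int ^ 'n \<Rightarrow> real ^ 'n"
  where "real_vec v = (\<chi> i. of_int (v $ i))"

definition real_mat :: "int ^ 'n ^ 'm \<Rightarrow> real ^ 'n ^ 'm"
  where "real_mat A = (\<chi> i j. of_int (A $ i $ j))"

definition rational_polyhedral_cone :: "(real ^ 'n) set \<Rightarrow> bool"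
  where "rational_polyhedral_cone \<sigma> \<longleftrightarrow>
    (\<exists>S :: (int ^ 'n) set. finite S \<and> \<sigma> = convex_cone hull (real_vec ` S))"

definition strongly_convex :: "(real ^ 'n) set \<Rightarrow> bool"
  where "strongly_convex \<sigma> \<longleftrightarrow> \<sigma> \<inter> uminus ` \<sigma> = {0}"

text \<open>The library's \<open>face_of\<close> also counts the empty set as a face.\<close>

definition fan :: "(real ^ 'n) set set \<Rightarrow> bool"
  where "fan \<Delta> \<longleftrightarrow>
    finite \<Delta> \<and> \<Delta> \<noteq> {} \<and>
    (\<forall>\<sigma>\<in>\<Delta>. rational_polyhedral_cone \<sigma> \<and> strongly_convex \<sigma>) \<and>
    (\<forall>\<sigma>\<in>\<Delta>. \<forall>\<tau>. \<tau> face_of \<sigma> \<and> \<tau> \<noteq> {} \<longrightarrow> \<tau> \<in> \<Delta>) \<and>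
    (\<forall>\<sigma>\<in>\<Delta>. \<forall>\<tau>\<in>\<Delta>. \<sigma> \<inter> \<tau> face_of \<sigma> \<and> \<sigma> \<inter> \<tau> face_of \<tau>)"

definition complete_fan :: "(real ^ 'n) set set \<Rightarrow> bool"
  where "complete_fan \<Delta> \<longleftrightarrow> fan \<Delta> \<and> \<Union>\<Delta> = UNIV"

text \<open>The rows of an integer matrix that is invertible over the integers form a basis of \<open>N\<close>.\<close>

definition smooth_cone :: "(real ^ 'n) set \<Rightarrow> bool"
  where "smooth_cone \<sigma> \<longleftrightarrow>
    (\<exists>(B :: int ^ 'n ^ 'n) I. invertible B \<and> \<sigma> = convex_cone hull ((\<lambda>i. real_vec (B $ i)) ` I))"

definition smooth_fan :: "(real ^ 'n) set set \<Rightarrow> bool"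
  where "smooth_fan \<Delta> \<longleftrightarrow> fan \<Delta> \<and> (\<forall>\<sigma>\<in>\<Delta>. smooth_cone \<sigma>)"

definition primitive :: "int ^ 'n \<Rightarrow> bool"
  where "primitive v \<longleftrightarrow> Gcd (range (($) v)) = 1"

definition ray_generators :: "(real ^ 'n) set set \<Rightarrow> (int ^ 'n) set"
  where "ray_generators \<Delta> = {v. primitive v \<and> convex_cone hull {real_vec v} \<in> \<Delta>}"

definition anticanonical_polytope :: "(real ^ 'n) set set \<Rightarrow> (real ^ 'n) set"
  where "anticanonical_polytope \<Delta> = {y. \<forall>v\<in>ray_generators \<Delta>. y \<bullet> (- real_vec v) \<le> 1}"

definition Aut_polytope :: "(real ^ 'n) set \<Rightarrow> (int ^ 'n ^ 'n) monoid"
  where "Aut_polytope P =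
    \<lparr>carrier = {A. invertible A \<and> (*v) (real_mat A) ` P = P}, mult = (**), one = mat 1\<rparr>"


section \<open>The toric manifold\<close>

text \<open>
  For a smooth complete fan the maximal cones are \<open>n\<close>-dimensional and generated by a basis of
  \<open>N\<close>, and the variety \<open>X(\<Delta>)\<close> is glued from the corresponding affine charts \<open>\<complex>\<^sup>n\<close>. Charts are indexed
  by ordered bases: the rows of \<open>B\<close> are the generators of a maximal cone in some order.
\<close>

definition charts :: "(real ^ 'n) set set \<Rightarrow> (int ^ 'n ^ 'n) set"
  where "charts \<Delta> = {B. invertible B \<and> convex_cone hull (range (\<lambda>i. real_vec (B $ i))) \<in> \<Delta>}"

text \<open>
  A point \<open>x\<close> of \<open>X(\<Delta>)\<close> is represented by the partial function on \<open>M\<close> sending \<open>u\<close> to the value at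
  \<open>x\<close> of the character \<open>\<chi>\<^sup>u\<close>, whenever this rational function is regular at \<open>x\<close>. In the
  coordinates of the chart \<open>B\<close> (dual to the rows of \<open>B\<close>) one has \<open>\<chi>\<^sup>u(z) = \<Prod>\<^sub>i z\<^sub>i ^ \<langle>u, B\<^sub>i\<rangle>\<close>.
  If \<open>\<tau>\<close> is the cone spanned by the \<open>B\<^sub>i\<close> with \<open>z\<^sub>i = 0\<close>, i.e. the one indexing the torus orbit of the
  point, then the domain is \<open>\<tau>\<^sup>\<or> \<inter> M\<close>. Hence points of two charts \<open>\<sigma>\<close> and \<open>\<sigma>'\<close> are represented by the
  same function iff they are identified by the usual gluing along the chart of \<open>\<sigma> \<inter> \<sigma>'\<close>.
\<close>

type_synonym 'n toric_point = "int ^ 'n \<Rightarrow> complex option"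

definition chart_point :: "int ^ 'n ^ 'n \<Rightarrow> complex ^ 'n \<Rightarrow> 'n toric_point"
  where "chart_point B z =
    (\<lambda>u. if \<forall>i. z $ i = 0 \<longrightarrow> 0 \<le> pairing u (B $ i)
         then Some (\<Prod>i\<in>UNIV. z $ i powi pairing u (B $ i))
         else None)"

definition toric_variety :: "(real ^ 'n) set set \<Rightarrow> 'n toric_point set"
  where "toric_variety \<Delta> = (\<Union>B\<in>charts \<Delta>. range (chart_point B))"

definition chart_coords :: "int ^ 'n ^ 'n \<Rightarrow> 'n toric_point \<Rightarrow> complex ^ 'n"
  where "chart_coords B = inv_into UNIV (chart_point B)"

definition jacobian :: "(complex ^ 'n \<Rightarrow> complex ^ 'n) \<Rightarrow> complex ^ 'n \<Rightarrow> complex"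
  where "jacobian F z =
    det (\<chi> i j. deriv (\<lambda>w. F (\<chi> l. if l = j then w else z $ l) $ i) (z $ j))"

definition local_jacobian ::
    "int ^ 'n ^ 'n \<Rightarrow> int ^ 'n ^ 'n \<Rightarrow> ('n toric_point \<Rightarrow> 'n toric_point) \<Rightarrow> complex ^ 'n \<Rightarrow> complex"
  where "local_jacobian B B' g = jacobian (chart_coords B' \<circ> g \<circ> chart_point B)"


section \<open>Sections of multiples of the anticanonical bundle\<close>

text \<open>
  A section of \<open>-kK\<^sub>X\<close> is given by its coefficients \<open>s B\<close> with respect to the local frames
  \<open>(\<partial>\<^sub>1 \<and> \<dots> \<and> \<partial>\<^sub>n)\<^sup>k\<close> of \<open>(\<Lambda>\<^sup>n T X)\<^sup>k\<close> on the charts \<open>B\<close> (and by \<open>0\<close> for matrices which are not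
  charts). \<open>pushes_to \<Delta> k g s s'\<close> says that \<open>s'\<close> is the pushforward of \<open>s\<close> under the automorphism
  \<open>g\<close>; for \<open>g = id\<close> and \<open>s' = s\<close> it is the compatibility of \<open>s\<close> with the changes of charts.
\<close>

type_synonym 'n local_coeffs = "int ^ 'n ^ 'n \<Rightarrow> complex ^ 'n \<Rightarrow> complex"

definition pushes_to ::
    "(real ^ 'n) set set \<Rightarrow> nat \<Rightarrow> ('n toric_point \<Rightarrow> 'n toric_point) \<Rightarrow>
      'n local_coeffs \<Rightarrow> 'n local_coeffs \<Rightarrow> bool"
  where "pushes_to \<Delta> k g s s' \<longleftrightarrow>
    (\<forall>B\<in>charts \<Delta>. \<forall>B'\<in>charts \<Delta>. \<forall>z w. g (chart_point B z) = chart_point B' w \<longrightarrow>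
      s' B' w = local_jacobian B B' g z ^ k * s B z)"

definition regular_function :: "(complex ^ 'n \<Rightarrow> complex) \<Rightarrow> bool"
  where "regular_function f \<longleftrightarrow>
    (\<exists>(E :: (nat ^ 'n) set) c. finite E \<and> f = (\<lambda>z. \<Sum>a\<in>E. c a * (\<Prod>i\<in>UNIV. z $ i ^ a $ i)))"

definition H0 :: "(real ^ 'n) set set \<Rightarrow> nat \<Rightarrow> 'n local_coeffs set"
  where "H0 \<Delta> k =
    {s. (\<forall>B\<in>charts \<Delta>. regular_function (s B)) \<and> (\<forall>B. B \<notin> charts \<Delta> \<longrightarrow> s B = (\<lambda>z. 0)) \<and>
        pushes_to \<Delta> k id s s}"

definition scale_coeffs :: "complex \<Rightarrow> 'n local_coeffs \<Rightarrow> 'n local_coeffs"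
  where "scale_coeffs c s = (\<lambda>B z. c * s B z)"

global_interpretation coeffs: vector_space "scale_coeffs :: complex \<Rightarrow> 'n local_coeffs \<Rightarrow> _"
  by unfold_locales (auto simp: scale_coeffs_def fun_eq_iff algebra_simps)

definition basis_of :: "'n local_coeffs set \<Rightarrow> 'n local_coeffs set \<Rightarrow> bool"
  where "basis_of S V \<longleftrightarrow> finite S \<and> coeffs.independent S \<and> coeffs.span S = V"

text \<open>
  \<open>-mK\<^sub>X\<close> is very ample: the map \<open>x \<mapsto> [s \<mapsto> s(x)]\<close> from \<open>X\<close> to the projective space of
  \<open>H\<^sup>0(X, -mK\<^sub>X)\<^sup>*\<close> is well-defined, injective and has injective differential. (As \<open>X\<close> is compact,
  it is then a closed embedding.) Two functionals are the same point of the projective space iff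
  they are proportional, and the differential kills a tangent vector \<open>\<xi>\<close> iff the derivative of the
  functional in direction \<open>\<xi>\<close> is a multiple of the functional itself.
\<close>

definition very_ample_anticanonical :: "(real ^ 'n) set set \<Rightarrow> nat \<Rightarrow> bool"
  where "very_ample_anticanonical \<Delta> m \<longleftrightarrow>
    (\<forall>B\<in>charts \<Delta>. \<forall>z. \<exists>s\<in>H0 \<Delta> m. s B z \<noteq> 0) \<and>
    (\<forall>B\<in>charts \<Delta>. \<forall>B'\<in>charts \<Delta>. \<forall>z w c.
       (\<forall>s\<in>H0 \<Delta> m. s B' w = c * s B z) \<longrightarrow> chart_point B' w = chart_point B z) \<and>
    (\<forall>B\<in>charts \<Delta>. \<forall>z \<xi> c.
       (\<forall>s\<in>H0 \<Delta> m. deriv (\<lambda>t. s B (z + t *s \<xi>)) 0 = c * s B z) \<longrightarrow> \<xi> = 0)"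

definition ample_anticanonical :: "(real ^ 'n) set set \<Rightarrow> bool"
  where "ample_anticanonical \<Delta> \<longleftrightarrow> (\<exists>m\<ge>1. very_ample_anticanonical \<Delta> m)"

text \<open>\<open>X(\<Delta>)\<close> is nonsingular iff \<open>\<Delta>\<close> is smooth, and compact iff \<open>\<Delta>\<close> is complete; projectivity is then
  part of the ampleness of \<open>-K\<^sub>X\<close>.\<close>

definition toric_fano :: "(real ^ 'n) set set \<Rightarrow> bool"
  where "toric_fano \<Delta> \<longleftrightarrow> smooth_fan \<Delta> \<and> complete_fan \<Delta> \<and> ample_anticanonical \<Delta>"


section \<open>The group \<open>G(H)\<close>\<close>

text \<open>
  \<open>toric_act A t\<close> is the composition of the automorphism of \<open>X\<close> extending \<open>x \<mapsto> x \<circ> A\<^sup>-\<^sup>1\<close> on the open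
  torus \<open>Hom(M, \<complex>\<^sup>*)\<close>, followed by the translation by the torus element \<open>t\<close>.
\<close>

definition toric_act ::
    "int ^ 'n ^ 'n \<Rightarrow> complex ^ 'n \<Rightarrow> 'n toric_point \<Rightarrow> 'n toric_point"
  where "toric_act A t x =
    (\<lambda>u. map_option (\<lambda>a. (\<Prod>i\<in>UNIV. t $ i powi u $ i) * a) (x (matrix_inv A *v u)))"

definition compact_torus :: "(complex ^ 'n) set"
  where "compact_torus = {t. \<forall>i. cmod (t $ i) = 1}"

definition toric_group :: "(int ^ 'n ^ 'n) set \<Rightarrow> ('n toric_point \<Rightarrow> 'n toric_point) set"
  where "toric_group H = {toric_act A t | A t. A \<in> H \<and> t \<in> compact_torus}"


section \<open>Global log canonical thresholds\<close>

text \<open>In \<open>ennreal\<close> one has \<open>inverse 0 = \<infinity>\<close>, the correct value of the integrand on the base locus.\<close>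

definition locally_integrable_power ::
    "(real ^ 'n) set set \<Rightarrow> 'n local_coeffs set \<Rightarrow> real \<Rightarrow> bool"
  where "locally_integrable_power \<Delta> S c \<longleftrightarrow>
    (\<forall>B\<in>charts \<Delta>. \<forall>z. \<exists>U. open U \<and> z \<in> U \<and>
      (\<integral>\<^sup>+w\<in>U. inverse (ennreal ((\<Sum>s\<in>S. (cmod (s B w))\<^sup>2) powr c)) \<partial>lborel) < \<infinity>)"

definition lct :: "(real ^ 'n) set set \<Rightarrow> 'n local_coeffs set \<Rightarrow> ereal"
  where "lct \<Delta> V =
    Sup (ereal ` {c. c > 0 \<and> (\<exists>S. basis_of S V \<and> locally_integrable_power \<Delta> S c)})"

definition invariant_subspace ::
    "(real ^ 'n) set set \<Rightarrow> nat \<Rightarrow> ('n toric_point \<Rightarrow> 'n toric_point) set \<Rightarrow>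
      'n local_coeffs set \<Rightarrow> bool"
  where "invariant_subspace \<Delta> k G V \<longleftrightarrow>
    V \<subseteq> H0 \<Delta> k \<and> coeffs.subspace V \<and> (\<forall>g\<in>G. \<forall>s\<in>V. \<exists>s'\<in>V. pushes_to \<Delta> k g s s')"

definition glct ::
    "(real ^ 'n) set set \<Rightarrow> nat \<Rightarrow> ('n toric_point \<Rightarrow> 'n toric_point) set \<Rightarrow> ereal"
  where "glct \<Delta> k G = ereal (real k) * (INF V\<in>{V. invariant_subspace \<Delta> k G V \<and> V \<noteq> {0}}. lct \<Delta> V)"


section \<open>Alpha invariants\<close>

text \<open>
  A Hermitian metric \<open>h\<close> on \<open>-kK\<^sub>X\<close> is given by the squared norms \<open>h B\<close> of the local frames;
  \<open>isometry_coeffs \<Delta> k g h\<close> says that \<open>g\<close> preserves it (for \<open>g = id\<close>: that the local data are compatible).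
\<close>

type_synonym 'n local_metric = "int ^ 'n ^ 'n \<Rightarrow> complex ^ 'n \<Rightarrow> real"

definition isometry_coeffs ::
    "(real ^ 'n) set set \<Rightarrow> nat \<Rightarrow> ('n toric_point \<Rightarrow> 'n toric_point) \<Rightarrow> 'n local_metric \<Rightarrow> bool"
  where "isometry_coeffs \<Delta> k g h \<longleftrightarrow>
    (\<forall>B\<in>charts \<Delta>. \<forall>B'\<in>charts \<Delta>. \<forall>z w. g (chart_point B z) = chart_point B' w \<longrightarrow>
      h B z = (cmod (local_jacobian B B' g z ^ k))\<^sup>2 * h B' w)"

definition continuous_hermitian_metric :: "(real ^ 'n) set set \<Rightarrow> nat \<Rightarrow> 'n local_metric \<Rightarrow> bool"
  where "continuous_hermitian_metric \<Delta> k h \<longleftrightarrow>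
    (\<forall>B\<in>charts \<Delta>. continuous_on UNIV (h B) \<and> (\<forall>z. h B z > 0)) \<and> isometry_coeffs \<Delta> k id h"

definition invariant_metric ::
    "(real ^ 'n) set set \<Rightarrow> nat \<Rightarrow> ('n toric_point \<Rightarrow> 'n toric_point) set \<Rightarrow> 'n local_metric \<Rightarrow> bool"
  where "invariant_metric \<Delta> k G h \<longleftrightarrow> (\<forall>g\<in>G. isometry_coeffs \<Delta> k g h)"

text \<open>Since the chart domains are finitely many open sets covering \<open>X\<close>, the sets below are the Borel sets of \<open>X\<close>.\<close>

definition borel_sets :: "(real ^ 'n) set set \<Rightarrow> 'n toric_point set set"
  where "borel_sets \<Delta> =
    {A. A \<subseteq> toric_variety \<Delta> \<and> (\<forall>B\<in>charts \<Delta>. chart_point B -` A \<in> sets borel)}"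

definition continuous_volume_form :: "(real ^ 'n) set set \<Rightarrow> 'n toric_point measure \<Rightarrow> bool"
  where "continuous_volume_form \<Delta> \<mu> \<longleftrightarrow>
    space \<mu> = toric_variety \<Delta> \<and> sets \<mu> = borel_sets \<Delta> \<and>
    (\<exists>\<rho> :: int ^ 'n ^ 'n \<Rightarrow> complex ^ 'n \<Rightarrow> real. \<forall>B\<in>charts \<Delta>.
       continuous_on UNIV (\<rho> B) \<and> (\<forall>z. \<rho> B z > 0) \<and>
       (\<forall>E\<in>sets borel. emeasure \<mu> (chart_point B ` E) = (\<integral>\<^sup>+z\<in>E. ennreal (\<rho> B z) \<partial>lborel)))"

text \<open>By compatibility with the changes of charts, the value does not depend on the chosen chart.\<close>

definition norm_sq ::
    "(real ^ 'n) set set \<Rightarrow> 'n local_metric \<Rightarrow> 'n local_coeffs \<Rightarrow> 'n toric_point \<Rightarrow> real"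
  where "norm_sq \<Delta> h s x =
    (let B = (SOME B. B \<in> charts \<Delta> \<and> x \<in> range (chart_point B)); z = chart_coords B x
     in (cmod (s B z))\<^sup>2 * h B z)"

text \<open>On a toric Fano manifold \<open>-kK\<^sub>X\<close> is globally generated, so that \<open>ln\<close> is only applied to
  positive reals at points of \<open>X\<close>.\<close>

definition bergman_potentials ::
    "(real ^ 'n) set set \<Rightarrow> nat \<Rightarrow> ('n toric_point \<Rightarrow> 'n toric_point) set \<Rightarrow> 'n local_metric \<Rightarrow>
      ('n toric_point \<Rightarrow> real) set"
  where "bergman_potentials \<Delta> k G h =
    {\<phi>. (\<exists>S. basis_of S (H0 \<Delta> k) \<and> \<phi> = (\<lambda>x. 1 / real k * ln (\<Sum>s\<in>S. norm_sq \<Delta> h s x))) \<and>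
         (\<forall>g\<in>G. \<forall>x\<in>toric_variety \<Delta>. \<phi> (g x) = \<phi> x)}"

definition alpha ::
    "(real ^ 'n) set set \<Rightarrow> nat \<Rightarrow> ('n toric_point \<Rightarrow> 'n toric_point) set \<Rightarrow> 'n local_metric \<Rightarrow>
      'n toric_point measure \<Rightarrow> ereal"
  where "alpha \<Delta> k G h \<mu> =
    Sup (ereal ` {c. c > 0 \<and>
      (SUP \<phi>\<in>bergman_potentials \<Delta> k G h.
         \<integral>\<^sup>+x. ennreal (exp (- c * (\<phi> x - (SUP y\<in>toric_variety \<Delta>. \<phi> y)))) \<partial>\<mu>) < \<infinity>})"

end

theory Submission
  imports Defs
begin

text \<open>
  Both thresholds measure the integrability of negative powers of sums \<open>\<Sum>\<^sub>s |s|\<^sup>2\<close> of squared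
  absolute values of sections of \<open>-kK\<^sub>X\<close>, and the compact torus inside \<open>G(H)\<close> reduces them to sums
  over monomials. The sections are spanned by the monomial sections \<open>s\<^sub>u\<close>, one for each lattice
  point \<open>u\<close> of \<open>kP\<close>. Averaging over torsion points of the torus shows that an invariant subspace
  is spanned by the \<open>s\<^sub>u\<close> for \<open>u\<close> in an \<open>H\<close>-stable set \<open>S\<close> (\<open>invariant_subspace_monomials\<close>), and
  that an invariant sum \<open>\<Sum>\<^sub>i |s\<^sub>i|\<^sup>2\<close> over a basis is diagonal, \<open>\<Sum>\<^sub>u a\<^sub>u |s\<^sub>u|\<^sup>2\<close> with \<open>a\<^sub>u \<ge> 0\<close>
  (\<open>invariant_form_diagonal\<close>). The \<open>a\<^sub>u\<close> which are constant on \<open>H\<close>-orbits and positive all occur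
  (\<open>diagonal_potential\<close>).

  \<^item> \<open>\<alpha> \<le> glct\<close>: for an invariant subspace with weights \<open>S\<close> take \<open>a\<^sub>u = 1\<close> on \<open>S\<close> and \<open>a\<^sub>u = \<epsilon>\<close>
    elsewhere. The integrals of the potentials are bounded uniformly in \<open>\<epsilon>\<close>, and for \<open>\<epsilon> \<rightarrow> 0\<close>
    Fatou's lemma bounds the integral of the power \<open>-c/k\<close> of \<open>\<Sum> |s\<^sub>u|\<^sup>2\<close> over \<open>S\<close>
    (\<open>alpha_le_lct\<close>).
  \<^item> \<open>glct \<le> \<alpha>\<close>: let \<open>M = a\<^sub>u\<close> be the largest coefficient and \<open>O\<close> the \<open>H\<close>-orbit of \<open>u\<close>. By
    invariance \<open>\<Sum>\<^sub>v a\<^sub>v |s\<^sub>v|\<^sup>2\<close> dominates \<open>M |s\<^sub>v|\<^sup>2\<close> for each \<open>v \<in> O\<close>, while it is at most \<open>M\<close>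
    times a constant, so \<open>exp (-c (\<phi> - sup \<phi>))\<close> is at most a constant times the power \<open>-c/k\<close> of \<open>\<Sum>
    |s\<^sub>v|\<^sup>2\<close> over \<open>O\<close> (\<open>potential_bound\<close>). The latter is integrable below the threshold of the
    invariant subspace spanned by \<open>O\<close> (\<open>orbit_integral_finite\<close>), and there are only finitely many
    orbits.

  Three geometric inputs are needed. Identities between sections, and all integrals, are checked
  on the open torus orbit, which is dense and of full measure. Compactness of \<open>X\<close> enters as the
  fact that the unit polydiscs of finitely many charts cover the open orbit
  (\<open>torus_polydisc_cover\<close>). Finally, \<open>\<Delta>\<close> is the normal fan of \<open>P\<close>, since \<open>-K\<^sub>X\<close> is ample; hence
  \<open>Aut P\<close> permutes the charts (\<open>Aut_maps_charts\<close>) and \<open>G(H)\<close> acts on all of \<open>X\<close>, and the weights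
  attached to the vertices of \<open>P\<close> give sections without common zeros (\<open>vertex_section_nonzero\<close>).
\<close>

section \<open>Laurent monomials and unimodular matrices\<close>

definition ctorus :: "(complex ^ 'n) set"
  where "ctorus = {z. \<forall>i. z $ i \<noteq> 0}"

definition chi :: "int ^ 'n \<Rightarrow> complex ^ 'n \<Rightarrow> complex"
  where "chi u x = (\<Prod>i\<in>UNIV. x $ i powi u $ i)"

lemma chi_0 [simp]: "chi 0 x = 1"
  by (simp add: chi_def)

lemma chi_one [simp]: "chi u (\<chi> i. 1) = 1"
  by (simp add: chi_def)

lemma chi_add:
  assumes "\<And>i. x $ i = 0 \<Longrightarrow> 0 \<le> u $ i \<and> 0 \<le> v $ i"
  shows "chi (u + v) x = chi u x * chi v x"
  unfolding chi_def prod.distrib[symmetric]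
proof (rule prod.cong)
  fix i
  show "x $ i powi (u + v) $ i = x $ i powi u $ i * x $ i powi v $ i"
    using assms[of i] by (cases "x $ i = 0") (auto simp: power_int_add power_int_0_left_if)
qed simp

lemma chi_minus: "chi (- u) x = inverse (chi u x)"
  by (simp add: chi_def power_int_minus prod_inversef[symmetric] comp_def)

lemma chi_diff:
  assumes "x \<in> ctorus"
  shows "chi (u - v) x = chi u x / chi v x"
  using chi_add[of x u "-v"] assms by (simp add: ctorus_def chi_minus divide_inverse)

lemma chi_nonzero: "x \<in> ctorus \<Longrightarrow> chi u x \<noteq> 0"
  by (simp add: chi_def ctorus_def)

lemma chi_mult: "chi u (\<chi> i. x $ i * y $ i) = chi u x * chi u y"
  by (simp add: chi_def power_int_mult_distrib prod.distrib)

lemma chi_axis: "chi (axis j 1) x = x $ j"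
proof -
  have "chi (axis j 1) x = (\<Prod>i\<in>UNIV. if i = j then x $ j else 1)"
    unfolding chi_def by (rule prod.cong) (auto simp: axis_def)
  thus ?thesis by simp
qed

lemma compact_torus_subset: "compact_torus \<subseteq> ctorus"
proof
  fix t :: "complex ^ 'n" assume "t \<in> compact_torus"
  hence "cmod (t $ i) = 1" for i by (simp add: compact_torus_def)
  hence "t $ i \<noteq> 0" for i by (metis norm_zero zero_neq_one)
  thus "t \<in> ctorus" by (simp add: ctorus_def)
qed

lemma norm_chi: "t \<in> compact_torus \<Longrightarrow> cmod (chi u t) = 1"
  by (simp add: chi_def compact_torus_def norm_power_int flip: prod_norm)

lemma cnj_chi: "t \<in> compact_torus \<Longrightarrow> cnj (chi u t) = chi (- u) t"
  using norm_chi[of t u]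
  by (metis chi_minus complex_div_cnj complex_inverse div_by_1 inverse_eq_divide mult_1 of_real_1 one_power2)

lemma finite_vec_set:
  assumes "finite R"
  shows "finite {t :: 'a ^ 'n. \<forall>i. t $ i \<in> R}"
proof -
  have "{t :: 'a ^ 'n. \<forall>i. t $ i \<in> R} \<subseteq> (\<lambda>f. \<chi> i. f i) ` (PiE UNIV (\<lambda>_. R))"
  proof
    fix t :: "'a ^ 'n" assume "t \<in> {t. \<forall>i. t $ i \<in> R}"
    hence "(\<lambda>i. t $ i) \<in> PiE UNIV (\<lambda>_. R)" by auto
    moreover have "t = (\<chi> i. t $ i)" by (simp add: vec_eq_iff)
    ultimately show "t \<in> (\<lambda>f. \<chi> i. f i) ` (PiE UNIV (\<lambda>_. R))" by blast
  qed
  moreover have "finite ((\<lambda>f. (\<chi> i. f i) :: 'a ^ 'n) ` (PiE UNIV (\<lambda>_. R)))"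
    using assms by (intro finite_imageI finite_PiE) auto
  ultimately show ?thesis by (rule finite_subset)
qed

definition torsion_points :: "nat \<Rightarrow> (complex ^ 'n) set"
  where "torsion_points N = {t. \<forall>i. t $ i ^ N = 1}"

lemma finite_torsion_points: "N > 0 \<Longrightarrow> finite (torsion_points N :: (complex ^ 'n) set)"
  using finite_vec_set[of "{z::complex. z ^ N = 1}", where 'n = 'n] finite_roots_unity[of N, where 'a = complex]
  by (auto simp: torsion_points_def)

lemma torsion_points_subset: "N > 0 \<Longrightarrow> torsion_points N \<subseteq> compact_torus"
  by (auto simp: torsion_points_def compact_torus_def dest: power_eq_1_iff)

text \<open>
  A nontrivial character with small exponents takes a value other than 1 at some torsion point,
  and translating by that point multiplies the sum by that value.
\<close>

lemma sum_chi_torsion_points: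
  fixes d :: "int ^ 'n"
  assumes "N > 0" and "\<And>i. \<bar>d $ i\<bar> < int N" and "d \<noteq> 0"
  shows "(\<Sum>t\<in>torsion_points N. chi d t) = 0"
proof -
  obtain j where j: "d $ j \<noteq> 0" using assms(3) by (auto simp: vec_eq_iff)
  define \<zeta> where "\<zeta> = cis (2 * pi / real N)"
  have \<zeta>N: "\<zeta> ^ N = 1" using assms(1) by (simp add: \<zeta>_def cis_power_int flip: power_int_of_nat)
  have \<zeta>d: "\<zeta> powi d $ j \<noteq> 1"
  proof
    assume "\<zeta> powi d $ j = 1"
    hence "cis (of_int (d $ j) * (2 * pi / real N)) = 1" by (simp add: \<zeta>_def cis_power_int)
    hence "cos (of_int (d $ j) * (2 * pi / real N)) = 1" by (metis Re_complex_of_real cis.sel(1) of_real_1)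
    then obtain m :: int where "of_int (d $ j) * (2 * pi / real N) = of_int m * 2 * pi"
      using cos_one_2pi_int by blast
    hence "of_int (d $ j) = (of_int m * of_nat N :: real)" using assms(1) by (simp add: field_simps)
    hence m: "d $ j = m * int N" by (metis of_int_eq_iff of_int_mult of_int_of_nat_eq)
    with j have "\<bar>m\<bar> \<ge> 1" by auto
    hence "\<bar>m\<bar> * int N \<ge> 1 * int N" by (intro mult_right_mono) auto
    thus False using assms(2)[of j] m by (simp add: abs_mult)
  qed
  define s :: "complex ^ 'n" where "s = (\<chi> i. if i = j then \<zeta> else 1)"
  have s: "chi d s = \<zeta> powi d $ j"
  proof -
    have "chi d s = (\<Prod>i\<in>UNIV. if i = j then \<zeta> powi d $ j else 1)"
      unfolding chi_def by (rule prod.cong) (auto simp: s_def)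
    thus ?thesis by simp
  qed
  let ?m = "\<lambda>t :: complex ^ 'n. (\<chi> i. s $ i * t $ i)"
  let ?m' = "\<lambda>t :: complex ^ 'n. (\<chi> i. inverse (s $ i) * t $ i)"
  have snz: "s $ i \<noteq> 0" for i by (simp add: s_def \<zeta>_def)
  have sN: "s $ i ^ N = 1" for i by (simp add: s_def \<zeta>N)
  have bij: "bij_betw ?m (torsion_points N) (torsion_points N)"
    by (rule bij_betwI[of _ _ _ ?m'])
      (auto simp: torsion_points_def power_mult_distrib sN snz vec_eq_iff power_inverse mult.assoc[symmetric])
  have "(\<Sum>t\<in>torsion_points N. chi d t) = (\<Sum>t\<in>torsion_points N. chi d (?m t))"
    by (rule sum.reindex_bij_betw[OF bij, symmetric])
  also have "\<dots> = \<zeta> powi d $ j * (\<Sum>t\<in>torsion_points N. chi d t)"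
    by (simp add: chi_mult s sum_distrib_left)
  finally show ?thesis using \<zeta>d by simp
qed

text \<open>
  A finite group of torsion points replaces the compact torus: once its order exceeds all
  differences of exponents in \<open>F\<close>, it separates the characters in \<open>F\<close>, and integrals over the
  torus become finite sums.
\<close>

lemma character_orthogonality:
  fixes F :: "(int ^ 'n) set"
  assumes "finite F"
  obtains G where "finite G" "G \<noteq> {}" "G \<subseteq> compact_torus"
    "\<And>m m'. m \<in> F \<Longrightarrow> m' \<in> F \<Longrightarrow>
      (\<Sum>t\<in>G. chi (m - m') t) = (if m = m' then of_nat (card G) else 0)"
proof -
  \<comment> \<open>a bound for all differences of exponents\<close>
  define N where "N = nat (\<Sum>m\<in>F. \<Sum>m'\<in>F. \<Sum>i\<in>UNIV. \<bar>m $ i - m' $ i\<bar>) + 1"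
  have bnd: "\<bar>(m - m') $ i\<bar> < int N" if "m \<in> F" "m' \<in> F" for m m' i
  proof -
    have "\<bar>m $ i - m' $ i\<bar> \<le> (\<Sum>i\<in>UNIV. \<bar>m $ i - m' $ i\<bar>)"
      by (rule member_le_sum) auto
    also have "\<dots> \<le> (\<Sum>m'\<in>F. \<Sum>i\<in>UNIV. \<bar>m $ i - m' $ i\<bar>)"
      using that assms by (intro member_le_sum[of m' F "\<lambda>m'. (\<Sum>i\<in>UNIV. \<bar>m $ i - m' $ i\<bar>)"]) (auto intro:
          sum_nonneg)
    also have "\<dots> \<le> (\<Sum>m\<in>F. \<Sum>m'\<in>F. \<Sum>i\<in>UNIV. \<bar>m $ i - m' $ i\<bar>)"
      using that assms by (intro member_le_sum[of m F "\<lambda>m. \<Sum>m'\<in>F. (\<Sum>i\<in>UNIV. \<bar>m $ i - m' $ i\<bar>)"]) (auto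
          intro: sum_nonneg)
    finally have "\<bar>m $ i - m' $ i\<bar> < int N" unfolding N_def by linarith
    thus ?thesis by simp
  qed
  let ?G = "torsion_points N :: (complex ^ 'n) set"
  have "N > 0" by (simp add: N_def)
  moreover have "(\<chi> i. 1) \<in> ?G" by (simp add: torsion_points_def)
  moreover have "(\<Sum>t\<in>?G. chi (m - m') t) = (if m = m' then of_nat (card ?G) else 0)"
    if "m \<in> F" "m' \<in> F" for m m'
    using sum_chi_torsion_points[of N "m - m'"] bnd[OF that] \<open>N > 0\<close> by auto
  ultimately show ?thesis
    using finite_torsion_points[of N, where 'n = 'n] torsion_points_subset[of N]
    by (intro that[of ?G]) blast+
qed

text \<open>
  The two consequences of orthogonality used below: coefficient extraction, which splits invariant
  subspaces into weight spaces, and Parseval's identity, which diagonalizes invariant forms.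
\<close>

lemma laurent_coefficient_average:
  assumes "finite F"
  obtains G where "finite G" "G \<noteq> {}" "G \<subseteq> compact_torus"
    "\<And>c m. m \<in> F \<Longrightarrow> (\<Sum>t\<in>G. chi (- m) t * (\<Sum>l\<in>F. c l * chi l t)) = of_nat (card G) * c m"
    "\<And>c. (\<Sum>t\<in>G. (cmod (\<Sum>l\<in>F. c l * chi l t))\<^sup>2) = real (card G) * (\<Sum>l\<in>F. (cmod (c l))\<^sup>2)"
proof -
  obtain G where G: "finite G" "G \<noteq> {}" "G \<subseteq> compact_torus"
    "\<And>m m'. m \<in> F \<Longrightarrow> m' \<in> F \<Longrightarrow>
      (\<Sum>t\<in>G. chi (m - m') t) = (if m = m' then of_nat (card G) else 0)"
    using character_orthogonality[OF assms] by metis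
  have prd: "chi (- m) t * chi l t = chi (l - m) t" if "t \<in> G" for t m l
    using that G(3) compact_torus_subset chi_diff[of t l m] by (auto simp: chi_minus divide_inverse)
  have 1: "(\<Sum>t\<in>G. chi (- m) t * (\<Sum>l\<in>F. c l * chi l t)) = of_nat (card G) * c m" if "m \<in> F" for c m
  proof -
    have "(\<Sum>t\<in>G. chi (- m) t * (\<Sum>l\<in>F. c l * chi l t)) = (\<Sum>t\<in>G. \<Sum>l\<in>F. c l * chi (l - m) t)"
      by (intro sum.cong refl) (simp add: sum_distrib_left mult.left_commute prd)
    also have "\<dots> = (\<Sum>l\<in>F. c l * (\<Sum>t\<in>G. chi (l - m) t))"
      by (subst sum.swap) (simp add: sum_distrib_left)
    also have "\<dots> = (\<Sum>l\<in>F. if l = m then c m * of_nat (card G) else 0)"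
      using that by (intro sum.cong refl) (simp add: G(4))
    finally show ?thesis using that assms by simp
  qed
  have 2: "(\<Sum>t\<in>G. (cmod (\<Sum>l\<in>F. c l * chi l t))\<^sup>2) = real (card G) * (\<Sum>l\<in>F. (cmod (c l))\<^sup>2)" for c
  proof -
    have "complex_of_real (\<Sum>t\<in>G. (cmod (\<Sum>l\<in>F. c l * chi l t))\<^sup>2) =
      (\<Sum>t\<in>G. (\<Sum>l\<in>F. c l * chi l t) * (\<Sum>m\<in>F. cnj (c m) * chi (- m) t))"
    proof -
      have "complex_of_real ((cmod (\<Sum>l\<in>F. c l * chi l t))\<^sup>2) =
         (\<Sum>l\<in>F. c l * chi l t) * (\<Sum>m\<in>F. cnj (c m) * chi (- m) t)" if "t \<in> G" for t
        using that G(3) by (subst complex_norm_square) (auto simp: cnj_chi subset_iff)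
      thus ?thesis by simp
    qed
    also have "\<dots> = (\<Sum>m\<in>F. cnj (c m) * (\<Sum>t\<in>G. chi (- m) t * (\<Sum>l\<in>F. c l * chi l t)))"
      by (simp add: sum_distrib_left mult_ac) (rule sum.swap)
    also have "\<dots> = (\<Sum>m\<in>F. of_nat (card G) * complex_of_real ((cmod (c m))\<^sup>2))"
      by (intro sum.cong refl) (simp add: 1 complex_norm_square mult_ac del: of_real_power)
    also have "\<dots> = complex_of_real (real (card G) * (\<Sum>l\<in>F. (cmod (c l))\<^sup>2))"
      by (simp add: sum_distrib_left)
    finally show ?thesis using of_real_eq_iff by blast
  qed
  show ?thesis by (rule that[OF G(1-3) 1 2])
qed

lemma laurent_coefficients_unique:
  assumes "finite F" and "\<And>t. t \<in> compact_torus \<Longrightarrow> (\<Sum>l\<in>F. c l * chi l t) = 0" and "m \<in> F"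
  shows "c m = 0"
proof -
  obtain G where G: "finite G" "G \<noteq> {}" "G \<subseteq> compact_torus"
    "\<And>c m. m \<in> F \<Longrightarrow> (\<Sum>t\<in>G. chi (- m) t * (\<Sum>l\<in>F. c l * chi l t)) = of_nat (card G) * c m"
    by (rule laurent_coefficient_average[OF assms(1)]) blast
  have "(\<Sum>t\<in>G. chi (- m) t * (\<Sum>l\<in>F. c l * chi l t)) = 0"
    using assms(2) G(3) by (intro sum.neutral) auto
  thus ?thesis using G assms(3) by auto
qed

lemma matrix_inv_unimodular:
  fixes A :: "'a :: semiring_1 ^ 'n ^ 'n"
  assumes "invertible A"
  shows "A ** matrix_inv A = mat 1" "matrix_inv A ** A = mat 1"
  using assms unfolding invertible_def matrix_inv_def by (metis (mono_tags, lifting) someI_ex)+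

lemma invertible_matrix_inv:
  fixes A :: "'a :: semiring_1 ^ 'n ^ 'n"
  shows "invertible A \<Longrightarrow> invertible (matrix_inv A)"
  using matrix_inv_unimodular[of A] by (auto simp: invertible_def)

lemma matrix_inv_unique:
  fixes A :: "'a :: semiring_1 ^ 'n ^ 'n"
  assumes "A ** C = mat 1" "C ** A = mat 1"
  shows "matrix_inv A = C"
proof -
  have "invertible A" using assms by (auto simp: invertible_def)
  from matrix_inv_unimodular[OF this] assms show ?thesis
    by (metis matrix_mul_assoc matrix_mul_lid matrix_mul_rid)
qed

lemma det_unimodular:
  fixes A :: "int ^ 'n ^ 'n"
  assumes "invertible A"
  shows "det A = 1 \<or> det A = -1"
proof -
  have "det A * det (matrix_inv A) = 1"
    using matrix_inv_unimodular(1)[OF assms] by (metis det_I det_mul)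
  thus ?thesis using zmult_eq_1_iff by blast
qed

lemma pairing_mult: "pairing u (B $ i) = (B *v u) $ i"
  by (simp add: pairing_def matrix_vector_mult_def mult.commute)

lemma matrix_inv_cancel_vector:
  fixes A :: "'a :: comm_semiring_1 ^ 'n ^ 'n"
  assumes "invertible A"
  shows "A *v (matrix_inv A *v u) = u" "matrix_inv A *v (A *v u) = u"
  using matrix_inv_unimodular[OF assms] by (simp_all add: matrix_vector_mul_assoc)

definition monomial_map :: "int ^ 'n ^ 'n \<Rightarrow> complex ^ 'n \<Rightarrow> complex ^ 'n"
  where "monomial_map K z = (\<chi> j. chi (column j K) z)"

lemma prod_powi:
  fixes f :: "'b \<Rightarrow> complex"
  shows "(\<Prod>i\<in>S. f i) powi n = (\<Prod>i\<in>S. f i powi n)"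
  by (induction S rule: infinite_finite_induct) (auto simp: power_int_mult_distrib)

text \<open>
  The hypothesis keeps exponents from cancelling at vanishing coordinates, where \<open>0 powi n\<close> is \<open>0\<close>
  for every \<open>n \<noteq> 0\<close>, also for negative \<open>n\<close>.
\<close>

lemma chi_monomial_map:
  assumes "\<And>i j. z $ i = 0 \<Longrightarrow> 0 \<le> K $ i $ j * a $ j"
  shows "chi a (monomial_map K z) = chi (K *v a) z"
proof -
  have "chi a (monomial_map K z) = (\<Prod>j\<in>UNIV. \<Prod>i\<in>UNIV. z $ i powi (K $ i $ j * a $ j))"
    by (simp add: chi_def monomial_map_def column_def power_int_mult prod_powi)
  also have "\<dots> = (\<Prod>i\<in>UNIV. \<Prod>j\<in>UNIV. z $ i powi (K $ i $ j * a $ j))"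
    by (rule prod.swap)
  also have "\<dots> = (\<Prod>i\<in>UNIV. z $ i powi (K *v a) $ i)"
  proof (rule prod.cong)
    fix i
    have *: "(\<Prod>j\<in>S. z $ i powi (f j)) = z $ i powi (\<Sum>j\<in>S. f j)" 
      if "finite S" "z $ i = 0 \<Longrightarrow> \<forall>j\<in>S. f j \<ge> 0" for f :: "'n \<Rightarrow> int" and S
      using that
    proof (induction S rule: finite_induct)
      case (insert x S)
      hence "z $ i = 0 \<Longrightarrow> f x \<ge> 0" "z $ i = 0 \<Longrightarrow> sum f S \<ge> 0" by (auto intro: sum_nonneg)
      with insert show ?case
        by (cases "z $ i = 0") (auto simp: power_int_add power_int_0_left_if add_nonneg_eq_0_iff)
    qed simp
    show "(\<Prod>j\<in>UNIV. z $ i powi (K $ i $ j * a $ j)) = z $ i powi (K *v a) $ i"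
      using assms by (simp add: * matrix_vector_mult_def)
  qed simp
  finally show ?thesis by (simp add: chi_def)
qed

section \<open>Gluing of charts\<close>

lemma matrix_vector_mult_axis:
  fixes A :: "'a :: comm_semiring_1 ^ 'n ^ 'm"
  shows "A *v axis j 1 = column j A"
proof -
  have "(\<Sum>l\<in>UNIV. A $ i $ l * axis j 1 $ l) = (\<Sum>l\<in>UNIV. if l = j then A $ i $ j else 0)" for i
    by (intro sum.cong refl) (auto simp: axis_def)
  thus ?thesis by (simp add: matrix_vector_mult_def column_def vec_eq_iff)
qed

lemma axis_component: "axis j x $ i = (if i = j then x else 0)"
  by (simp add: axis_def)

lemma chart_point_eq_chi:
  "chart_point B z = (\<lambda>u. if \<forall>i. z $ i = 0 \<longrightarrow> 0 \<le> (B *v u) $ i then Some (chi (B *v u) z) else None)"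
  by (simp add: chart_point_def pairing_mult chi_def fun_eq_iff)

lemma toric_act_chart_point:
  "toric_act A t (chart_point B z) =
    (\<lambda>u. if \<forall>i. z $ i = 0 \<longrightarrow> 0 \<le> (B *v (matrix_inv A *v u)) $ i
         then Some (chi u t * chi (B *v (matrix_inv A *v u)) z) else None)"
  by (auto simp: toric_act_def chart_point_eq_chi chi_def)

lemma chart_point_dual_basis:
  assumes "invertible B"
  shows "chart_point B z (matrix_inv B *v axis j 1) = Some (z $ j)"
  by (simp add: chart_point_eq_chi matrix_inv_cancel_vector[OF assms] chi_axis) (simp add: axis_def)

lemma inj_chart_point:
  assumes "invertible B"
  shows "inj (chart_point B)"
  by (rule injI) (metis assms chart_point_dual_basis option.inject vec_eq_iff)

lemma chart_coords_chart_point [simp]: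
  "invertible B \<Longrightarrow> chart_coords B (chart_point B z) = z"
  by (simp add: chart_coords_def inj_chart_point)

text \<open>
  If the exponents of a character in the coordinates of the chart \<open>B'\<close> are \<open>a\<close>, then its pullback
  under the action of \<open>A\<close> has the exponents \<open>transition_matrix A B B' *v a\<close> in the chart \<open>B\<close>.
\<close>

definition transition_matrix :: "int ^ 'n ^ 'n \<Rightarrow> int ^ 'n ^ 'n \<Rightarrow> int ^ 'n ^ 'n \<Rightarrow> int ^ 'n ^ 'n"
  where "transition_matrix A B B' = B ** matrix_inv A ** matrix_inv B'"

definition chart_action ::
    "int ^ 'n ^ 'n \<Rightarrow> complex ^ 'n \<Rightarrow> int ^ 'n ^ 'n \<Rightarrow> int ^ 'n ^ 'n \<Rightarrow> complex ^ 'n \<Rightarrow> complex ^ 'n"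
  where "chart_action A t B B' z =
    (\<chi> j. monomial_map (matrix_inv B') t $ j * monomial_map (transition_matrix A B B') z $ j)"

lemma invertible_transition_matrix:
  "invertible A \<Longrightarrow> invertible B \<Longrightarrow> invertible B' \<Longrightarrow> invertible (transition_matrix A B B')"
  by (simp add: transition_matrix_def invertible_mult invertible_matrix_inv)

lemma chi_chart_action:
  assumes "invertible B'" "t \<in> ctorus"
    and "\<And>i j. z $ i = 0 \<Longrightarrow> 0 \<le> transition_matrix A B B' $ i $ j * (B' *v u) $ j"
  shows "chi (B' *v u) (chart_action A t B B' z) = chi u t * chi (B *v (matrix_inv A *v u)) z"
proof -
  have "chi (B' *v u) (chart_action A t B B' z) = chi u t * chi (transition_matrix A B B' *v (B' *v u)) z"
  proof -
    have "chi (B' *v u) (monomial_map (matrix_inv B') t) = chi (matrix_inv B' *v (B' *v u)) t"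
      by (rule chi_monomial_map) (use assms(2) in \<open>simp add: ctorus_def\<close>)
    moreover have "chi (B' *v u) (monomial_map (transition_matrix A B B') z) =
        chi (transition_matrix A B B' *v (B' *v u)) z"
      by (rule chi_monomial_map) (rule assms(3))
    ultimately show ?thesis
      unfolding chart_action_def chi_mult by (simp add: matrix_inv_cancel_vector[OF assms(1)])
  qed
  thus ?thesis
    by (simp add: transition_matrix_def matrix_inv_cancel_vector[OF assms(1)] flip: matrix_vector_mul_assoc)
qed

text \<open>
  A point and its image determine the cones of the torus orbits through them, as duals of the
  domains of these partial functions. Equality of the domains says that the transition matrix \<open>K\<close>
  maps one dual cone onto the other, so \<open>K\<close> and its inverse \<open>L\<close> have nonnegative entries in the
  rows of the vanishing coordinates and restrict there to a bijection between the two sets of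
  vanishing coordinates. Hence the action is given by monomials without poles, not only at the
  given point but at all points with fewer vanishing coordinates; these form a neighbourhood, as
  needed for derivatives.
\<close>

lemma glued_charts:
  fixes A B B' :: "int ^ 'n ^ 'n"
  assumes inv: "invertible A" "invertible B" "invertible B'" and t: "t \<in> ctorus"
    and glue: "toric_act A t (chart_point B z) = chart_point B' w"
  shows "w = chart_action A t B B' z"
    and "\<And>i j. z $ i = 0 \<Longrightarrow> 0 \<le> transition_matrix A B B' $ i $ j"
    and "\<And>z'. (\<And>i. z' $ i = 0 \<Longrightarrow> z $ i = 0) \<Longrightarrow>
      toric_act A t (chart_point B z') = chart_point B' (chart_action A t B B' z')"
proof -
  define K where "K = transition_matrix A B B'"
  have KB: "B *v (matrix_inv A *v u) = K *v (B' *v u)" for u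
    by (simp add: K_def transition_matrix_def matrix_inv_cancel_vector[OF inv(3)] flip: matrix_vector_mul_assoc)
  have Bcol: "B *v (matrix_inv A *v (matrix_inv B' *v a)) = K *v a" for a
    by (simp add: KB matrix_inv_cancel_vector[OF inv(3)])
  have dom: "(\<forall>i. z $ i = 0 \<longrightarrow> 0 \<le> (K *v a) $ i) \<longleftrightarrow> (\<forall>j. w $ j = 0 \<longrightarrow> 0 \<le> a $ j)" for a
  proof -
    have "(toric_act A t (chart_point B z)) (matrix_inv B' *v a) = None \<longleftrightarrow>
          chart_point B' w (matrix_inv B' *v a) = None"
      by (simp add: glue)
    thus ?thesis
      unfolding toric_act_chart_point unfolding chart_point_eq_chi Bcol matrix_inv_cancel_vector[OF inv(3)]
      by (simp split: if_split_asm) blast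
  qed
  have Knonneg: "0 \<le> K $ i $ j" if "z $ i = 0" for i j
    using dom[of "axis j 1"] that by (auto simp: matrix_vector_mult_axis column_def axis_component)
  have Kzero: "K $ i $ j = 0" if "z $ i = 0" "w $ j \<noteq> 0" for i j
  proof -
    have neg: "K *v (- axis j 1) = - column j K"
      by (simp flip: matrix_vector_mult_axis add: matrix_vector_mult_def vec_eq_iff sum_negf)
    have "\<forall>l. w $ l = 0 \<longrightarrow> 0 \<le> (- axis j 1 :: int ^ 'n) $ l" using that by (auto simp: axis_def)
    with dom[of "- axis j 1"] that(1) have "0 \<le> - (K $ i $ j)" by (simp add: neg column_def)
    with Knonneg[OF that(1), of j] show ?thesis by simp
  qed
  have Kinv: "invertible K" using inv by (simp add: K_def invertible_transition_matrix)
  define L where "L = matrix_inv K"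
  have dom': "(\<forall>i. z $ i = 0 \<longrightarrow> 0 \<le> b $ i) \<longleftrightarrow> (\<forall>j. w $ j = 0 \<longrightarrow> 0 \<le> (L *v b) $ j)" for b
    using dom[of "L *v b"] by (simp add: L_def matrix_inv_cancel_vector[OF Kinv])
  have Lnonneg: "0 \<le> L $ j $ i" if "w $ j = 0" for i j
  proof -
    have "\<forall>l. z $ l = 0 \<longrightarrow> 0 \<le> (axis i 1 :: int ^ 'n) $ l" by (simp add: axis_component)
    with dom'[of "axis i 1"] that show ?thesis by (simp add: matrix_vector_mult_axis column_def)
  qed
  show w: "w = chart_action A t B B' z"
  proof (rule vec_eq_iff[THEN iffD2], rule)
    fix j
    have *: "\<forall>i. z $ i = 0 \<longrightarrow> 0 \<le> (K *v axis j 1) $ i"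
      using Knonneg by (simp add: matrix_vector_mult_axis column_def)
    have "Some (w $ j) = toric_act A t (chart_point B z) (matrix_inv B' *v axis j 1)"
      by (simp add: glue chart_point_dual_basis[OF inv(3)])
    also have "\<dots> = Some (chi (matrix_inv B' *v axis j 1) t * chi (K *v axis j 1) z)"
      using * by (simp add: toric_act_chart_point Bcol)
    finally show "w $ j = chart_action A t B B' z $ j"
      by (simp add: chart_action_def monomial_map_def K_def matrix_vector_mult_axis)
  qed
  show "\<And>i j. z $ i = 0 \<Longrightarrow> 0 \<le> transition_matrix A B B' $ i $ j"
    using Knonneg by (simp add: K_def)
  fix z' :: "complex ^ 'n" assume sub: "\<And>i. z' $ i = 0 \<Longrightarrow> z $ i = 0"
  define w' where "w' = chart_action A t B B' z'"
  have w'0: "w' $ j = 0 \<longleftrightarrow> (\<exists>i. z' $ i = 0 \<and> K $ i $ j \<noteq> 0)" for j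
    using chi_nonzero[OF t, of "column j (matrix_inv B')"]
    by (auto simp: w'_def chart_action_def monomial_map_def chi_def[of _ z'] K_def column_def)
  have 1: "(\<forall>i. z' $ i = 0 \<longrightarrow> 0 \<le> (K *v a) $ i) \<longleftrightarrow> (\<forall>j. w' $ j = 0 \<longrightarrow> 0 \<le> a $ j)" (is "?l \<longleftrightarrow> ?r")
    and 2: "(\<forall>j. w' $ j = 0 \<longrightarrow> 0 \<le> a $ j) \<Longrightarrow> z' $ i = 0 \<Longrightarrow> 0 \<le> K $ i $ l * a $ l" for a i l
  proof -
    have *: "0 \<le> K $ i $ j * a $ j" if "?r" "z' $ i = 0" for i j
    proof (cases "K $ i $ j = 0")
      case False
      with that have "0 \<le> a $ j" using w'0 by blast
      thus ?thesis using Knonneg[of i j] sub that by simp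
    qed simp
    thus "?r \<Longrightarrow> z' $ i = 0 \<Longrightarrow> 0 \<le> K $ i $ l * a $ l" .
    show "?l \<longleftrightarrow> ?r"
    proof
      assume ?r
      thus ?l using * by (auto simp: matrix_vector_mult_def intro!: sum_nonneg)
    next
      assume l: ?l
      show ?r
      proof (intro allI impI)
        fix j assume "w' $ j = 0"
        then obtain i0 where i0: "z' $ i0 = 0" "K $ i0 $ j \<noteq> 0" using w'0 by blast
        hence zi0: "z $ i0 = 0" using sub by blast
        hence wj: "w $ j = 0" using Kzero i0 by blast
        \<comment> \<open>the nonnegative terms of \<open>\<Sum>\<^sub>m K\<^sub>i\<^sub>0\<^sub>m L\<^sub>m\<^sub>l = 0\<close> vanish, so the row \<open>j\<close> of \<open>L\<close> is
            concentrated at \<open>i0\<close>\<close>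
        have Ll: "L $ j $ l = 0" if "l \<noteq> i0" for l
        proof -
          have nn: "\<forall>m\<in>UNIV. 0 \<le> K $ i0 $ m * L $ m $ l"
            by (metis Knonneg Kzero Lnonneg mult_nonneg_nonneg mult_zero_left order_refl zi0)
          have "(K ** L) $ i0 $ l = 0"
            using that matrix_inv_unimodular(1)[OF Kinv] by (simp add: L_def mat_def)
          hence "(\<Sum>m\<in>UNIV. K $ i0 $ m * L $ m $ l) = 0" by (simp add: matrix_matrix_mult_def)
          hence "K $ i0 $ j * L $ j $ l = 0"
            using nn sum_nonneg_eq_0_iff[of UNIV "\<lambda>m. K $ i0 $ m * L $ m $ l"] by auto
          thus ?thesis using i0 by simp
        qed
        have "a $ j = (L *v (K *v a)) $ j"
          by (simp add: L_def matrix_inv_cancel_vector[OF Kinv])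
        also have "\<dots> = (\<Sum>l\<in>UNIV. L $ j $ l * (K *v a) $ l)"
          by (simp add: matrix_vector_mult_def[of L])
        also have "\<dots> = (\<Sum>l\<in>UNIV. if l = i0 then L $ j $ i0 * (K *v a) $ i0 else 0)"
          by (rule sum.cong) (simp_all add: Ll)
        also have "\<dots> = L $ j $ i0 * (K *v a) $ i0" by simp
        also have "\<dots> \<ge> 0" using l i0 Lnonneg[OF wj] by simp
        finally show "0 \<le> a $ j" .
      qed
    qed
  qed
  show "toric_act A t (chart_point B z') = chart_point B' (chart_action A t B B' z')"
  proof
    fix u
    have "chi (B' *v u) w' = chi u t * chi (K *v (B' *v u)) z'"
      if "\<forall>j. w' $ j = 0 \<longrightarrow> 0 \<le> (B' *v u) $ j"
      unfolding w'_def using 2[OF that]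
      by (subst chi_chart_action[OF inv(3) t]) (auto simp: K_def KB)
    thus "toric_act A t (chart_point B z') u = chart_point B' (chart_action A t B B' z') u"
      using 1[of "B' *v u"] unfolding toric_act_chart_point KB unfolding chart_point_eq_chi w'_def
      by (auto simp: KB)
  qed
qed

section \<open>Jacobians of toric automorphisms\<close>

lemma isCont_chi:
  assumes "\<And>i. z $ i = 0 \<Longrightarrow> 0 \<le> u $ i"
  shows "isCont (chi u) z"
proof -
  have "isCont (\<lambda>z. \<Prod>i\<in>UNIV. z $ i powi u $ i) z"
    unfolding isCont_def
    by (intro tendsto_prod tendsto_power_int' tendsto_vec_nth tendsto_ident_at) (use assms in blast)
  thus ?thesis by (simp add: chi_def[abs_def])
qed

lemma isCont_vec_lambdaI: "(\<And>i. isCont (\<lambda>x. f x $ i) z) \<Longrightarrow> isCont f z"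
  unfolding isCont_def by (rule vec_tendstoI)

lemma isCont_chart_action:
  assumes "\<And>i j. z $ i = 0 \<Longrightarrow> 0 \<le> transition_matrix A B B' $ i $ j"
  shows "isCont (chart_action A t B B') z"
  unfolding chart_action_def monomial_map_def
  by (rule isCont_vec_lambdaI) (simp, intro continuous_intros isCont_chi, simp add: column_def assms)

text \<open>
  The torus is dense: vanishing coordinates are perturbed to \<open>1 / (m + 1)\<close>.
\<close>

lemma eq_on_ctorus_isCont:
  fixes f g :: "complex ^ 'n \<Rightarrow> 'b :: t2_space"
  assumes "isCont f z" "isCont g z" and eq: "\<And>z'. z' \<in> ctorus \<Longrightarrow> f z' = g z'"
  shows "f z = g z"
proof -
  define p :: "nat \<Rightarrow> complex ^ 'n"
    where "p m = (\<chi> i. if z $ i = 0 then of_real (inverse (real (Suc m))) else z $ i)" for m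
  have "p \<longlonglongrightarrow> z"
  proof (rule vec_tendstoI)
    fix i
    have "(\<lambda>m. complex_of_real (inverse (real (Suc m)))) \<longlonglongrightarrow> of_real 0"
      by (intro tendsto_of_real LIMSEQ_inverse_real_of_nat)
    thus "(\<lambda>m. p m $ i) \<longlonglongrightarrow> z $ i"
      by (cases "z $ i = 0") (simp_all add: p_def)
  qed
  moreover have "p m \<in> ctorus" for m
    by (simp add: p_def ctorus_def)
      (metis of_nat_Suc of_nat_neq_0 of_real_of_nat_eq)
  ultimately have "(\<lambda>m. f (p m)) = (\<lambda>m. g (p m))" using eq by blast
  moreover have "(\<lambda>m. f (p m)) \<longlonglongrightarrow> f z" "(\<lambda>m. g (p m)) \<longlonglongrightarrow> g z"
    using assms(1,2) \<open>p \<longlonglongrightarrow> z\<close> by (auto intro: isCont_tendsto_compose)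
  ultimately show ?thesis by (metis LIMSEQ_unique)
qed

lemma det_scale_rows_columns:
  fixes M :: "int ^ 'n ^ 'n" and r c :: "'n \<Rightarrow> complex"
  shows "det (\<chi> i j. r i * of_int (M $ i $ j) * c j) = (\<Prod>i\<in>UNIV. r i) * of_int (det M) * (\<Prod>j\<in>UNIV. c j)"
proof -
  have "(\<Prod>i\<in>UNIV. c (p i)) = (\<Prod>j\<in>UNIV. c j)" if "p permutes UNIV" for p
    using prod.permute[OF that, of c] by (simp add: comp_def)
  thus ?thesis
    by (simp add: det_def prod.distrib sum_distrib_left sum_distrib_right mult_ac)
qed

text \<open>
  The Jacobian of the monomial map \<open>chart_action\<close>. When an exponent is \<open>0\<close>, the factor \<open>of_int 0\<close>
  makes the value of the power with exponent \<open>-1\<close> irrelevant.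
\<close>

definition action_jacobian ::
    "int ^ 'n ^ 'n \<Rightarrow> complex ^ 'n \<Rightarrow> int ^ 'n ^ 'n \<Rightarrow> int ^ 'n ^ 'n \<Rightarrow> complex ^ 'n \<Rightarrow> complex"
  where "action_jacobian A t B B' z = det (\<chi> i j.
    monomial_map (matrix_inv B') t $ i * (of_int (transition_matrix A B B' $ j $ i) *
      z $ j powi (transition_matrix A B B' $ j $ i - 1) *
      (\<Prod>l\<in>UNIV - {j}. z $ l powi transition_matrix A B B' $ l $ i)))"

lemma isCont_action_jacobian:
  assumes "\<And>i j. z $ i = 0 \<Longrightarrow> 0 \<le> transition_matrix A B B' $ i $ j"
  shows "isCont (action_jacobian A t B B') z"
proof -
  have "isCont (\<lambda>z. of_int (transition_matrix A B B' $ j $ i) *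
      z $ j powi (transition_matrix A B B' $ j $ i - 1)) z" for i j
  proof (cases "transition_matrix A B B' $ j $ i = 0")
    case False
    hence "z $ j \<noteq> 0 \<or> 0 \<le> transition_matrix A B B' $ j $ i - 1" using assms[of j i] by force
    thus ?thesis unfolding isCont_def
      by (intro tendsto_intros tendsto_power_int') auto
  qed simp
  moreover have "isCont (\<lambda>z. \<Prod>l\<in>UNIV - {j}. z $ l powi transition_matrix A B B' $ l $ i) z" for i j
    unfolding isCont_def
    by (intro tendsto_prod tendsto_power_int' tendsto_vec_nth tendsto_ident_at) (use assms in blast)
  ultimately have entry: "isCont (\<lambda>z. monomial_map (matrix_inv B') t $ i * (of_int (transition_matrix A
      B B' $ j $ i) *
      z $ j powi (transition_matrix A B B' $ j $ i - 1) *
      (\<Prod>l\<in>UNIV - {j}. z $ l powi transition_matrix A B B' $ l $ i))) z" for i j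
    by (rule continuous_mult[OF continuous_const continuous_mult])
  show ?thesis
    unfolding action_jacobian_def det_def vec_lambda_beta
    by (rule continuous_sum, rule continuous_mult[OF continuous_const], rule continuous_prod, rule entry)
qed

text \<open>
  In logarithmic coordinates a monomial map is linear, with determinant \<open>det K\<close>.
\<close>

lemma action_jacobian_ctorus:
  assumes "z \<in> ctorus"
  shows "action_jacobian A t B B' z * (\<Prod>j\<in>UNIV. z $ j) =
    of_int (det (transition_matrix A B B')) * (\<Prod>j\<in>UNIV. chart_action A t B B' z $ j)"
proof -
  define K where "K = transition_matrix A B B'"
  have nz: "z $ j \<noteq> 0" for j using assms by (simp add: ctorus_def)
  have "z $ j powi (K $ j $ i - 1) * (\<Prod>l\<in>UNIV - {j}. z $ l powi K $ l $ i) =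
    monomial_map K z $ i * inverse (z $ j)" for i j
    using nz by (simp add: monomial_map_def chi_def column_def power_int_diff
      prod.remove[of UNIV j "\<lambda>l. z $ l powi K $ l $ i"] divide_inverse)
  hence "action_jacobian A t B B' z = det (\<chi> i j. chart_action A t B B' z $ i *
     of_int (transpose K $ i $ j) * inverse (z $ j))"
    unfolding action_jacobian_def K_def[symmetric]
    by (intro arg_cong[where f = det]) (simp add: vec_eq_iff transpose_def chart_action_def K_def mult_ac)
  also have "\<dots> = (\<Prod>i\<in>UNIV. chart_action A t B B' z $ i) * of_int (det K) * (\<Prod>j\<in>UNIV. inverse (z $ j))"
    by (subst det_scale_rows_columns) simp
  finally show ?thesis
    using nz by (simp add: prod_inversef[unfolded comp_def] K_def)
qed

text \<open>
  Coordinates are varied one at a time: a nonvanishing coordinate stays nonzero nearby, so the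
  varied points remain in the region where \<open>glued_charts\<close> gives the action by monomials.
\<close>

lemma local_jacobian_toric_act:
  fixes A B B' :: "int ^ 'n ^ 'n"
  assumes inv: "invertible A" "invertible B" "invertible B'" and t: "t \<in> ctorus"
    and glue: "toric_act A t (chart_point B z) = chart_point B' w"
  shows "local_jacobian B B' (toric_act A t) z = action_jacobian A t B B' z"
proof -
  define K where "K = transition_matrix A B B'"
  define m where "m = monomial_map (matrix_inv B') t"
  have "deriv (\<lambda>x. (chart_coords B' \<circ> toric_act A t \<circ> chart_point B) (\<chi> l. if l = j then x else z $ l) $
      i) (z $ j)
     = m $ i * (of_int (K $ j $ i) * z $ j powi (K $ j $ i - 1) * (\<Prod>l\<in>UNIV - {j}. z $ l powi K $ l $ i))"
    for i j
  proof -
    have agree: "(chart_coords B' \<circ> toric_act A t \<circ> chart_point B) (\<chi> l. if l = j then x else z $ l) $ i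
       = m $ i * (x powi K $ j $ i * (\<Prod>l\<in>UNIV - {j}. z $ l powi K $ l $ i))"
      if "z $ j \<noteq> 0 \<Longrightarrow> x \<noteq> 0" for x
    proof -
      let ?z = "\<chi> l. if l = j then x else z $ l"
      have sub: "?z $ l = 0 \<Longrightarrow> z $ l = 0" for l using that by (auto split: if_splits)
      have "(chart_coords B' \<circ> toric_act A t \<circ> chart_point B) ?z = chart_action A t B B' ?z"
        using glued_charts(3)[OF inv t glue, of ?z] sub inv(3) by (simp del: vec_lambda_beta)
      moreover have "(\<Prod>l\<in>UNIV. ?z $ l powi K $ l $ i) = x powi K $ j $ i * (\<Prod>l\<in>UNIV - {j}. z $ l powi K
          $ l $ i)"
        by (subst prod.remove[of UNIV j]) (auto intro!: prod.cong)
      ultimately show ?thesis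
        by (simp add: chart_action_def monomial_map_def chi_def[of _ ?z] column_def K_def m_def)
    qed
    have ev: "eventually (\<lambda>x. z $ j \<noteq> 0 \<longrightarrow> x \<noteq> 0) (nhds (z $ j))"
      by (cases "z $ j = 0") (auto intro: t1_space_nhds)
    have "deriv (\<lambda>x. (chart_coords B' \<circ> toric_act A t \<circ> chart_point B) (\<chi> l. if l = j then x else z $ l)
        $ i) (z $ j)
      = deriv (\<lambda>x. m $ i * (x powi K $ j $ i * (\<Prod>l\<in>UNIV - {j}. z $ l powi K $ l $ i))) (z $ j)"
      by (rule deriv_cong_ev[OF eventually_mono[OF ev]]) (use agree in auto)
    also have "\<dots> = m $ i * (of_int (K $ j $ i) * z $ j powi (K $ j $ i - 1) * (\<Prod>l\<in>UNIV - {j}. z $ l powi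
        K $ l $ i))"
      using glued_charts(2)[OF inv t glue, of j i]
      by (intro DERIV_imp_deriv) (auto intro!: derivative_eq_intros simp: K_def mult_ac)
    finally show ?thesis .
  qed
  thus ?thesis
    by (simp add: local_jacobian_def jacobian_def action_jacobian_def K_def m_def)
qed

section \<open>Sections as Laurent polynomials on the open orbit\<close>

text \<open>
  The lattice points of \<open>kP\<close> (\<open>weights_iff_polytope\<close>), described by the exponents of the
  corresponding monomials in the charts, which have to be nonnegative.
\<close>

definition weights :: "(real ^ 'n) set set \<Rightarrow> nat \<Rightarrow> (int ^ 'n) set"
  where "weights \<Delta> k = {u. \<forall>B\<in>charts \<Delta>. \<forall>i. 0 \<le> (B *v u) $ i + int k}"

text \<open>
  The section \<open>\<chi>\<^sup>u (x\<^sub>1\<partial>\<^sub>1 \<and> \<dots> \<and> x\<^sub>n\<partial>\<^sub>n)\<^sup>k\<close>. The factor \<open>det B\<close> is the sign by which the frame of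
  the chart differs from that of the torus.
\<close>

definition monomial_section :: "(real ^ 'n) set set \<Rightarrow> nat \<Rightarrow> int ^ 'n \<Rightarrow> 'n local_coeffs"
  where "monomial_section \<Delta> k u = (\<lambda>B z. if B \<in> charts \<Delta>
    then of_int (det B) ^ k * (\<Prod>i\<in>UNIV. z $ i ^ nat ((B *v u) $ i + int k)) else 0)"

definition combination :: "(real ^ 'n) set set \<Rightarrow> nat \<Rightarrow> (int ^ 'n \<Rightarrow> complex) \<Rightarrow> 'n local_coeffs"
  where "combination \<Delta> k c = (\<lambda>B z. \<Sum>u\<in>weights \<Delta> k. c u * monomial_section \<Delta> k u B z)"

definition torus_point :: "complex ^ 'n \<Rightarrow> 'n toric_point"
  where "torus_point x = (\<lambda>u. Some (chi u x))"

definition torus_coords :: "int ^ 'n ^ 'n \<Rightarrow> complex ^ 'n \<Rightarrow> complex ^ 'n"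
  where "torus_coords B = monomial_map (matrix_inv B)"

definition torus_act :: "int ^ 'n ^ 'n \<Rightarrow> complex ^ 'n \<Rightarrow> complex ^ 'n \<Rightarrow> complex ^ 'n"
  where "torus_act A t x = (\<chi> i. t $ i * monomial_map (matrix_inv A) x $ i)"

text \<open>
  The coefficient of a section with respect to the \<open>k\<close>-th power of the torus invariant frame
  \<open>x\<^sub>1\<partial>\<^sub>1 \<and> \<dots> \<and> x\<^sub>n\<partial>\<^sub>n\<close> of \<open>-K\<^sub>X\<close>, as a function of the point of the open orbit. The sign \<open>det B\<close>
  accounts for the order of the coordinates of the chart \<open>B\<close>.
\<close>

definition torus_function :: "nat \<Rightarrow> 'n local_coeffs \<Rightarrow> int ^ 'n ^ 'n \<Rightarrow> complex ^ 'n \<Rightarrow> complex"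
  where "torus_function k s B x =
    of_int (det B) ^ k * s B (torus_coords B x) / (\<Prod>i\<in>UNIV. torus_coords B x $ i) ^ k"

lemma charts_invertible: "B \<in> charts \<Delta> \<Longrightarrow> invertible B"
  by (simp add: charts_def)

lemma monomial_map_ctorus: "x \<in> ctorus \<Longrightarrow> monomial_map K x \<in> ctorus"
  using chi_nonzero by (auto simp: ctorus_def monomial_map_def)

lemma torus_coords_ctorus: "x \<in> ctorus \<Longrightarrow> torus_coords B x \<in> ctorus"
  by (simp add: torus_coords_def monomial_map_ctorus)

lemma torus_act_ctorus: "t \<in> ctorus \<Longrightarrow> x \<in> ctorus \<Longrightarrow> torus_act A t x \<in> ctorus"
  using monomial_map_ctorus[of x "matrix_inv A"] by (simp add: torus_act_def ctorus_def)

lemma chi_monomial_map_ctorus: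
  "x \<in> ctorus \<Longrightarrow> chi a (monomial_map K x) = chi (K *v a) x"
  by (rule chi_monomial_map) (simp add: ctorus_def)

lemma chi_torus_coords:
  assumes "invertible B" "x \<in> ctorus"
  shows "chi (B *v u) (torus_coords B x) = chi u x"
  using assms by (simp add: torus_coords_def chi_monomial_map_ctorus matrix_inv_cancel_vector)

lemma chi_torus_act:
  "x \<in> ctorus \<Longrightarrow> chi u (torus_act A t x) = chi u t * chi (matrix_inv A *v u) x"
  by (simp add: torus_act_def chi_mult chi_monomial_map_ctorus)

lemma chart_point_torus_coords:
  assumes "invertible B" "x \<in> ctorus"
  shows "chart_point B (torus_coords B x) = torus_point x"
  using torus_coords_ctorus[OF assms(2), of B] chi_torus_coords[OF assms]
  by (simp add: chart_point_eq_chi torus_point_def ctorus_def fun_eq_iff)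

lemma toric_act_torus_point:
  "x \<in> ctorus \<Longrightarrow> toric_act A t (torus_point x) = torus_point (torus_act A t x)"
  by (simp add: toric_act_def torus_point_def chi_torus_act fun_eq_iff) (simp add: chi_def)

lemma torus_coords_surj:
  assumes "invertible B" "z \<in> ctorus"
  obtains x where "x \<in> ctorus" "z = torus_coords B x"
proof
  show "monomial_map B z \<in> ctorus" using assms by (simp add: monomial_map_ctorus)
  show "z = torus_coords B (monomial_map B z)"
    using assms by (simp add: torus_coords_def monomial_map_def[of "matrix_inv B"]
        chi_monomial_map_ctorus vec_eq_iff
       matrix_inv_cancel_vector chi_axis flip: matrix_vector_mult_axis)
qed

lemma torus_act_surj:
  assumes "invertible A" "t \<in> ctorus" "y \<in> ctorus"
  obtains x where "x \<in> ctorus" "torus_act A t x = y"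
proof -
  have "(\<chi> i. y $ i / t $ i) \<in> ctorus" using assms by (simp add: ctorus_def)
  from torus_coords_surj[OF assms(1) this] obtain x
    where x: "x \<in> ctorus" "(\<chi> i. y $ i / t $ i) = torus_coords A x" by blast
  have "torus_act A t x = y"
    using assms(2) by (simp add: torus_act_def torus_coords_def[symmetric] x(2)[symmetric] ctorus_def
        vec_eq_iff)
  thus ?thesis using that x(1) by blast
qed

lemma det_squared:
  fixes A :: "int ^ 'n ^ 'n"
  assumes "invertible A"
  shows "of_int (det A) * of_int (det A) = (1 :: 'b :: comm_ring_1)"
  using det_unimodular[OF assms] by auto

lemma det_power_squared:
  fixes A :: "int ^ 'n ^ 'n"
  assumes "invertible A"
  shows "of_int (det A) ^ k * of_int (det A) ^ k = (1 :: 'b :: comm_ring_1)"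
  by (simp add: det_squared[OF assms] flip: power_mult_distrib)

lemma det_matrix_inv:
  fixes A :: "int ^ 'n ^ 'n"
  assumes "invertible A"
  shows "det (matrix_inv A) = det A"
proof -
  have "det A * det (matrix_inv A) = 1"
    using matrix_inv_unimodular(1)[OF assms] by (metis det_I det_mul)
  thus ?thesis using det_unimodular[OF assms] by auto
qed

lemma local_jacobian_torus:
  assumes inv: "invertible A" "invertible B" "invertible B'" and t: "t \<in> ctorus" and x: "x \<in> ctorus"
  shows "local_jacobian B B' (toric_act A t) (torus_coords B x) * (of_int (det B) * (\<Prod>i\<in>UNIV.
      torus_coords B x $ i)) =
    of_int (det A) * (of_int (det B') * (\<Prod>i\<in>UNIV. torus_coords B' (torus_act A t x) $ i))"
proof -
  have glue: "toric_act A t (chart_point B (torus_coords B x)) = chart_point B' (torus_coords B'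
      (torus_act A t x))"
    using inv t x by (simp add: chart_point_torus_coords toric_act_torus_point torus_act_ctorus)
  have "of_int (det (transition_matrix A B B')) * of_int (det B) =
     (of_int (det B) * of_int (det B) * (of_int (det A) * of_int (det B')) :: complex)"
    by (simp add: transition_matrix_def det_mul det_matrix_inv inv)
  hence "of_int (det (transition_matrix A B B')) * of_int (det B) = (of_int (det A) * of_int (det B') ::
      complex)"
    by (simp only: det_squared[OF inv(2)] mult_1)
  thus ?thesis
    using action_jacobian_ctorus[OF torus_coords_ctorus[OF x], of A t B B' B]
    by (simp add: local_jacobian_toric_act[OF inv t glue] glued_charts(1)[OF inv t glue, symmetric] mult_ac)
qed

text \<open>
  The invariant frame is preserved by the action up to the sign \<open>det A\<close>. Expressed in this frame,
  the transformation law of sections involves no Jacobians.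
\<close>

lemma torus_function_eq_iff:
  assumes inv: "invertible A" "invertible B" "invertible B'" and t: "t \<in> ctorus" and x: "x \<in> ctorus"
  shows "torus_function k s' B' (torus_act A t x) = of_int (det A) ^ k * torus_function k s B x \<longleftrightarrow>
    s' B' (torus_coords B' (torus_act A t x)) =
      local_jacobian B B' (toric_act A t) (torus_coords B x) ^ k * s B (torus_coords B x)"
proof -
  define p where "p = (\<Prod>i\<in>UNIV. torus_coords B x $ i)"
  define q where "q = (\<Prod>i\<in>UNIV. torus_coords B' (torus_act A t x) $ i)"
  define J where "J = local_jacobian B B' (toric_act A t) (torus_coords B x)"
  define \<sigma> where "\<sigma> = s B (torus_coords B x)"
  define \<sigma>' where "\<sigma>' = s' B' (torus_coords B' (torus_act A t x))"
  define \<alpha> \<beta> \<beta>' :: complex where "\<alpha> = of_int (det A) ^ k" and "\<beta> = of_int (det B) ^ k" and "\<beta>' = of_int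
      (det B') ^ k"
  have sq: "\<beta> * \<beta> = 1" "\<beta>' * \<beta>' = 1" using inv by (simp_all add: \<beta>_def \<beta>'_def det_power_squared)
  have nz: "p \<noteq> 0" "q \<noteq> 0"
    using torus_coords_ctorus[OF x, of B] torus_coords_ctorus[OF torus_act_ctorus[OF t x], of B' A]
    by (auto simp: p_def q_def ctorus_def)
  have "(J * (of_int (det B) * p)) ^ k = (of_int (det A) * (of_int (det B') * q)) ^ k"
    using local_jacobian_torus[OF inv t x] by (simp add: J_def p_def q_def)
  hence Jk: "J ^ k * (\<beta> * p ^ k) = \<alpha> * (\<beta>' * q ^ k)"
    by (simp only: power_mult_distrib \<alpha>_def \<beta>_def \<beta>'_def)
  have "\<beta>' * \<sigma>' / q ^ k = \<alpha> * (\<beta> * \<sigma> / p ^ k) \<longleftrightarrow> \<beta>' * \<sigma>' * p ^ k = \<alpha> * (\<beta> * \<sigma>) * q ^ k"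
    using nz by (simp add: field_simps)
  also have "\<dots> \<longleftrightarrow> \<beta>' * (\<beta>' * \<sigma>' * p ^ k) = \<beta>' * (\<alpha> * (\<beta> * \<sigma>) * q ^ k)"
    using sq(2) by auto
  also have "\<beta>' * (\<beta>' * \<sigma>' * p ^ k) = (\<beta>' * \<beta>') * (\<sigma>' * p ^ k)" by (simp only: mult_ac)
  also have "\<beta>' * (\<alpha> * (\<beta> * \<sigma>) * q ^ k) = \<beta> * \<sigma> * (\<alpha> * (\<beta>' * q ^ k))" by (simp only: mult_ac)
  also have "\<dots> = (\<beta> * \<beta>) * (J ^ k * \<sigma> * p ^ k)" unfolding Jk[symmetric] by (simp only: mult_ac)
  finally have "\<beta>' * \<sigma>' / q ^ k = \<alpha> * (\<beta> * \<sigma> / p ^ k) \<longleftrightarrow> \<sigma>' = J ^ k * \<sigma>"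
    using nz by (simp add: sq)
  thus ?thesis
    unfolding torus_function_def p_def q_def J_def \<sigma>_def \<sigma>'_def \<alpha>_def \<beta>_def \<beta>'_def .
qed

lemma torus_function_pushforward:
  assumes "pushes_to \<Delta> k (toric_act A t) s s'" "invertible A" "t \<in> ctorus" "x \<in> ctorus"
    "B \<in> charts \<Delta>" "B' \<in> charts \<Delta>"
  shows "torus_function k s' B' (torus_act A t x) = of_int (det A) ^ k * torus_function k s B x"
proof -
  have inv: "invertible B" "invertible B'" using assms charts_invertible by auto
  have "toric_act A t (chart_point B (torus_coords B x)) = chart_point B' (torus_coords B' (torus_act A t x))"
    using inv assms by (simp add: chart_point_torus_coords toric_act_torus_point torus_act_ctorus)
  thus ?thesis
    using assms unfolding torus_function_eq_iff[OF assms(2) inv assms(3,4)] pushes_to_def by blast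
qed

lemma prod_power_eq_chi:
  assumes "z \<in> ctorus" "\<And>i. 0 \<le> a $ i + int k"
  shows "(\<Prod>i\<in>UNIV. z $ i ^ nat (a $ i + int k)) = chi a z * (\<Prod>i\<in>UNIV. z $ i) ^ k"
proof -
  have "z $ i ^ nat (a $ i + int k) = z $ i powi a $ i * z $ i ^ k" for i
    using assms by (simp add: ctorus_def power_int_add flip: power_int_nonneg_exp)
  thus ?thesis by (simp add: prod.distrib chi_def prod_power_distrib)
qed

lemma torus_function_monomial_section:
  assumes "u \<in> weights \<Delta> k" "B \<in> charts \<Delta>" "x \<in> ctorus"
  shows "torus_function k (monomial_section \<Delta> k u) B x = chi u x"
proof -
  have inv: "invertible B" using assms charts_invertible by auto
  have tc: "torus_coords B x \<in> ctorus" using assms by (simp add: torus_coords_ctorus)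
  define p where "p = (\<Prod>i\<in>UNIV. torus_coords B x $ i)"
  have nz: "p \<noteq> 0" using tc by (simp add: ctorus_def p_def)
  have "(\<Prod>i\<in>UNIV. torus_coords B x $ i ^ nat ((B *v u) $ i + int k)) = chi u x * p ^ k"
    unfolding p_def using assms by (subst prod_power_eq_chi[OF tc]) (auto simp: weights_def
        chi_torus_coords[OF inv])
  hence "torus_function k (monomial_section \<Delta> k u) B x =
    (of_int (det B) ^ k * of_int (det B) ^ k) * chi u x"
    using nz assms by (simp add: torus_function_def monomial_section_def flip: p_def)
  thus ?thesis by (simp add: det_power_squared[OF inv])
qed

lemma torus_function_combination:
  assumes "B \<in> charts \<Delta>" "x \<in> ctorus"
  shows "torus_function k (combination \<Delta> k c) B x = (\<Sum>u\<in>weights \<Delta> k. c u * chi u x)"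
proof -
  have "torus_function k (combination \<Delta> k c) B x =
     (\<Sum>u\<in>weights \<Delta> k. c u * torus_function k (monomial_section \<Delta> k u) B x)"
    by (simp add: torus_function_def combination_def sum_distrib_left sum_distrib_right
        sum_divide_distrib mult_ac)
  thus ?thesis using assms by (simp add: torus_function_monomial_section)
qed

lemma isCont_monomial_section: "isCont (monomial_section \<Delta> k u B) z"
  unfolding monomial_section_def isCont_def
  by (cases "B \<in> charts \<Delta>") (simp_all, intro tendsto_intros)

lemma isCont_combination: "isCont (combination \<Delta> k c B) z"
  unfolding combination_def by (intro continuous_intros isCont_monomial_section)

lemma isCont_regular_function:
  assumes "regular_function f"
  shows "isCont f z"
proof -
  from assms obtain E :: "(nat ^ 'a) set" and c where
    f: "f = (\<lambda>z. \<Sum>a\<in>E. c a * (\<Prod>i\<in>UNIV. z $ i ^ a $ i))"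
    unfolding regular_function_def by blast
  show ?thesis unfolding f isCont_def by (intro tendsto_intros)
qed

text \<open>
  Both sides of the transformation law are continuous in the source point, also at the boundary of
  the torus, so that it suffices to check it on the torus.
\<close>

lemma pushes_toI:
  assumes inv: "invertible A" and t: "t \<in> ctorus"
    and cont: "\<And>B z. isCont (s B) z" "\<And>B z. isCont (s' B) z"
    and eq: "\<And>B B' x. B \<in> charts \<Delta> \<Longrightarrow> B' \<in> charts \<Delta> \<Longrightarrow> x \<in> ctorus \<Longrightarrow>
      torus_function k s' B' (torus_act A t x) = of_int (det A) ^ k * torus_function k s B x"
  shows "pushes_to \<Delta> k (toric_act A t) s s'"
  unfolding pushes_to_def
proof (intro ballI allI impI)
  fix B B' z w
  assume B: "B \<in> charts \<Delta>" "B' \<in> charts \<Delta>"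
    and glue: "toric_act A t (chart_point B z) = chart_point B' w"
  have invB: "invertible B" "invertible B'" using B charts_invertible by auto
  note gl = glued_charts[OF inv invB t glue]
  have "s' B' (chart_action A t B B' z) = action_jacobian A t B B' z ^ k * s B z"
  proof (rule eq_on_ctorus_isCont)
    show "isCont (\<lambda>z. s' B' (chart_action A t B B' z)) z"
      by (rule isCont_o2[OF isCont_chart_action[OF gl(2)] cont(2)])
    show "isCont (\<lambda>z. action_jacobian A t B B' z ^ k * s B z) z"
      by (intro continuous_intros isCont_action_jacobian gl(2) cont(1))
    fix z' :: "complex ^ 'a" assume z': "z' \<in> ctorus"
    then obtain x where x: "x \<in> ctorus" "z' = torus_coords B x" using torus_coords_surj[OF invB(1)] by blast
    have glue': "toric_act A t (chart_point B z') = chart_point B' (torus_coords B' (torus_act A t x))"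
      using invB x t by (simp add: chart_point_torus_coords toric_act_torus_point torus_act_ctorus)
    have ca: "chart_action A t B B' z' = torus_coords B' (torus_act A t x)"
      using glued_charts(1)[OF inv invB t glue'] by simp
    show "s' B' (chart_action A t B B' z') = action_jacobian A t B B' z' ^ k * s B z'"
      using torus_function_eq_iff[OF inv invB t x(1)] eq[OF B x(1)] local_jacobian_toric_act[OF inv invB
          t glue']
      unfolding ca by (simp add: x(2))
  qed
  thus "s' B' w = local_jacobian B B' (toric_act A t) z ^ k * s B z"
    by (simp add: gl(1)[symmetric] local_jacobian_toric_act[OF inv invB t glue])
qed

lemma matrix_inv_mat_1 [simp]: "matrix_inv (mat 1 :: int ^ 'n ^ 'n) = mat 1"
  by (rule matrix_inv_unique) simp_all

lemma toric_act_id: "toric_act (mat 1 :: int ^ 'n ^ 'n) (\<chi> i. 1) = id"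
  by (simp add: toric_act_def fun_eq_iff option.map_ident)

lemma ones_ctorus: "(\<chi> i. 1) \<in> ctorus"
  by (simp add: ctorus_def)

lemma torus_act_ones [simp]: "torus_act (mat 1 :: int ^ 'n ^ 'n) (\<chi> i. 1) x = x"
  by (simp add: torus_act_def monomial_map_def vec_eq_iff flip: matrix_vector_mult_axis) (simp add: chi_axis)

lemma torus_function_chart_independent:
  assumes "s \<in> H0 \<Delta> k" "x \<in> ctorus" "B \<in> charts \<Delta>" "B' \<in> charts \<Delta>"
  shows "torus_function k s B' x = torus_function k s B x"
  using torus_function_pushforward[of \<Delta> k "mat 1" "\<chi> i. 1" s s x B B'] assms
  by (simp add: toric_act_id H0_def ones_ctorus invertible_def exI[of _ "mat 1"])

lemma regular_function_monomial_section:
  assumes "B \<in> charts \<Delta>"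
  shows "regular_function (monomial_section \<Delta> k u B)"
  unfolding regular_function_def monomial_section_def
  by (rule exI[of _ "{\<chi> i. nat ((B *v u) $ i + int k)}"], rule exI[of _ "\<lambda>_. of_int (det B) ^ k"])
    (simp add: assms)

lemma regular_function_add:
  assumes "regular_function f" "regular_function g"
  shows "regular_function (\<lambda>z. f z + g z)"
proof -
  from assms(1) obtain E :: "(nat ^ 'a) set" and c where
    f: "finite E" "f = (\<lambda>z. \<Sum>a\<in>E. c a * (\<Prod>i\<in>UNIV. z $ i ^ a $ i))"
    unfolding regular_function_def by (elim exE conjE)
  from assms(2) obtain F :: "(nat ^ 'a) set" and d where
    g: "finite F" "g = (\<lambda>z. \<Sum>a\<in>F. d a * (\<Prod>i\<in>UNIV. z $ i ^ a $ i))"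
    unfolding regular_function_def by (elim exE conjE)
  have 1: "f z = (\<Sum>a\<in>E \<union> F. (if a \<in> E then c a else 0) * (\<Prod>i\<in>UNIV. z $ i ^ a $ i))" for z
    unfolding f(2) using f(1) g(1) by (intro sum.mono_neutral_cong_left) auto
  have 2: "g z = (\<Sum>a\<in>E \<union> F. (if a \<in> F then d a else 0) * (\<Prod>i\<in>UNIV. z $ i ^ a $ i))" for z
    unfolding g(2) using f(1) g(1) by (intro sum.mono_neutral_cong_left) auto
  show ?thesis
    unfolding regular_function_def 1 2 sum.distrib[symmetric] distrib_right[symmetric]
    using f(1) g(1)
    by (intro exI[of _ "E \<union> F"] exI[of _ "\<lambda>a. (if a \<in> E then c a else 0) + (if a \<in> F then d a else 0)"]) simp
qed

lemma regular_function_mult: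
  assumes "regular_function f"
  shows "regular_function (\<lambda>z. b * f z)"
proof -
  from assms obtain E :: "(nat ^ 'a) set" and c where
    f: "finite E" "f = (\<lambda>z. \<Sum>a\<in>E. c a * (\<Prod>i\<in>UNIV. z $ i ^ a $ i))"
    unfolding regular_function_def by (elim exE conjE)
  have "(\<lambda>z. b * f z) = (\<lambda>z. \<Sum>a\<in>E. (b * c a) * (\<Prod>i\<in>UNIV. z $ i ^ a $ i))"
    by (simp add: f(2) sum_distrib_left mult.assoc)
  thus ?thesis unfolding regular_function_def using f(1)
    by (intro exI[of _ E] exI[of _ "\<lambda>a. b * c a"]) auto
qed

lemma regular_function_sum:
  assumes "finite S" "\<And>u. u \<in> S \<Longrightarrow> regular_function (f u)"
  shows "regular_function (\<lambda>z. \<Sum>u\<in>S. f u z)"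
  using assms
proof (induction S rule: finite_induct)
  case empty
  show ?case unfolding regular_function_def by (rule exI[of _ "{}"]) simp
next
  case (insert u S)
  thus ?case by (simp add: regular_function_add)
qed

lemma combination_H0:
  assumes "finite (weights \<Delta> k)"
  shows "combination \<Delta> k c \<in> H0 \<Delta> k"
proof -
  have "pushes_to \<Delta> k (toric_act (mat 1) (\<chi> i. 1)) (combination \<Delta> k c) (combination \<Delta> k c)"
    by (rule pushes_toI)
      (auto simp: ones_ctorus isCont_combination torus_function_combination invertible_def exI[of _ "mat 1"])
  moreover have "regular_function (combination \<Delta> k c B)" if "B \<in> charts \<Delta>" for B
    unfolding combination_def
    by (intro regular_function_sum regular_function_mult regular_function_monomial_section assms that)
  ultimately show ?thesis
    by (auto simp: H0_def toric_act_id combination_def monomial_section_def)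
qed

lemma section_eqI:
  assumes s: "\<And>B z. isCont (s B) z" "\<And>B. B \<notin> charts \<Delta> \<Longrightarrow> s B = (\<lambda>z. 0)"
    and s': "\<And>B z. isCont (s' B) z" "\<And>B. B \<notin> charts \<Delta> \<Longrightarrow> s' B = (\<lambda>z. 0)"
    and eq: "\<And>B x. B \<in> charts \<Delta> \<Longrightarrow> x \<in> ctorus \<Longrightarrow> torus_function k s B x = torus_function k s' B x"
  shows "s = s'"
proof (intro ext)
  fix B z
  show "s B z = s' B z"
  proof (cases "B \<in> charts \<Delta>")
    case True
    have inv: "invertible B" using True charts_invertible by auto
    show ?thesis
    proof (rule eq_on_ctorus_isCont[OF s(1) s'(1)])
      fix z' :: "complex ^ 'a" assume z': "z' \<in> ctorus"
      then obtain x where x: "x \<in> ctorus" "z' = torus_coords B x" using torus_coords_surj[OF inv] by blast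
      show "s B z' = s' B z'"
        using eq[OF True x(1)] z' det_unimodular[OF inv] unfolding torus_function_def x(2)[symmetric]
        by (auto simp: ctorus_def)
    qed
  qed (use s(2) s'(2) in auto)
qed

lemma isCont_H0: "s \<in> H0 \<Delta> k \<Longrightarrow> isCont (s B) z"
  by (cases "B \<in> charts \<Delta>") (auto simp: H0_def isCont_regular_function)

lemma regular_function_torus_expansion:
  fixes f :: "complex ^ 'n \<Rightarrow> complex"
  assumes "regular_function f" "invertible B"
  obtains F c where "finite F" "\<And>u i. u \<in> F \<Longrightarrow> 0 \<le> (B *v u) $ i + int k"
    "\<And>x. x \<in> ctorus \<Longrightarrow> f (torus_coords B x) / (\<Prod>i\<in>UNIV. torus_coords B x $ i) ^ k = (\<Sum>u\<in>F. c u * chi u x)"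
proof -
  from assms obtain E :: "(nat ^ 'n) set" and c where
    f: "finite E" "f = (\<lambda>z. \<Sum>a\<in>E. c a * (\<Prod>i\<in>UNIV. z $ i ^ a $ i))"
    unfolding regular_function_def by (elim exE conjE)
  define w where "w a = matrix_inv B *v (\<chi> i. int (a $ i) - int k)" for a :: "nat ^ 'n"
  define e where "e u = (\<chi> i. nat ((B *v u) $ i + int k))" for u
  have Bw: "B *v w a = (\<chi> i. int (a $ i) - int k)" for a
    by (simp add: w_def matrix_inv_cancel_vector[OF assms(2)])
  have ew: "e (w a) = a" for a by (simp add: e_def Bw vec_eq_iff)
  have "f (torus_coords B x) / (\<Prod>i\<in>UNIV. torus_coords B x $ i) ^ k = (\<Sum>u\<in>w ` E. c (e u) * chi u x)"
    if x: "x \<in> ctorus" for x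
  proof -
    have tc: "torus_coords B x \<in> ctorus" using x by (simp add: torus_coords_ctorus)
    have "(\<Prod>i\<in>UNIV. torus_coords B x $ i ^ a $ i) = chi (w a) x * (\<Prod>i\<in>UNIV. torus_coords B x $ i) ^ k" for a
      using prod_power_eq_chi[OF tc, of "B *v w a" k] chi_torus_coords[OF assms(2) x, of "w a"] by (simp
          add: Bw)
    hence "f (torus_coords B x) / (\<Prod>i\<in>UNIV. torus_coords B x $ i) ^ k = (\<Sum>a\<in>E. c a * chi (w a) x)"
      using tc by (simp add: f(2) ctorus_def sum_divide_distrib)
    also have "\<dots> = (\<Sum>u\<in>w ` E. c (e u) * chi u x)"
      by (subst sum.reindex) (auto simp: ew intro: inj_on_inverseI[of _ e])
    finally show ?thesis .
  qed
  thus ?thesis using f(1) by (intro that[of "w ` E" "\<lambda>u. c (e u)"]) (auto simp: Bw)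
qed

text \<open>
  The polynomial in one chart, written as a Laurent polynomial on the torus: the exponent of each
  coordinate of that chart is at least \<open>-k\<close>.
\<close>

lemma H0_torus_expansion:
  assumes "s \<in> H0 \<Delta> k" "B \<in> charts \<Delta>"
  obtains F c where "finite F" "\<And>u i. u \<in> F \<Longrightarrow> 0 \<le> (B *v u) $ i + int k"
    "\<And>x. x \<in> ctorus \<Longrightarrow> torus_function k s B x = (\<Sum>u\<in>F. c u * chi u x)"
proof -
  have "regular_function (s B)" using assms by (auto simp: H0_def)
  from regular_function_torus_expansion[OF this charts_invertible[OF assms(2)], of k]
  obtain F c where F: "finite F" "\<And>u i. u \<in> F \<Longrightarrow> 0 \<le> (B *v u) $ i + int k"
    "\<And>x. x \<in> ctorus \<Longrightarrow> s B (torus_coords B x) / (\<Prod>i\<in>UNIV. torus_coords B x $ i) ^ k = (\<Sum>u\<in>F. c u * chi u x)"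
    by blast
  show ?thesis
  proof (rule that[of F "\<lambda>u. of_int (det B) ^ k * c u"])
    fix x :: "complex ^ 'a" assume "x \<in> ctorus"
    from F(3)[OF this] show "torus_function k s B x = (\<Sum>u\<in>F. (of_int (det B) ^ k * c u) * chi u x)"
      by (simp add: torus_function_def mult.assoc flip: times_divide_eq_right sum_distrib_left)
  qed (use F in auto)
qed

text \<open>
  All charts give the same Laurent polynomial on the torus. By uniqueness of its coefficients the
  bounds on exponents from all charts hold at once, so that only the lattice points of \<open>kP\<close> occur.
\<close>

lemma H0_combination:
  assumes fin: "finite (weights \<Delta> k)" and ne: "charts \<Delta> \<noteq> {}" and s: "s \<in> H0 \<Delta> k"
  obtains c where "s = combination \<Delta> k c"
proof -
  from ne obtain B where B: "B \<in> charts \<Delta>" by blast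
  from H0_torus_expansion[OF s B] obtain F c where F: "finite F"
    "\<And>x. x \<in> ctorus \<Longrightarrow> torus_function k s B x = (\<Sum>u\<in>F. c u * chi u x)" by metis
  have supp: "u \<in> weights \<Delta> k" if "u \<in> F" "c u \<noteq> 0" for u
    unfolding weights_def
  proof (intro CollectI ballI)
    fix B' assume B': "B' \<in> charts \<Delta>"
    from H0_torus_expansion[OF s B'] obtain F' c' where F': "finite F'"
      "\<And>u i. u \<in> F' \<Longrightarrow> 0 \<le> (B' *v u) $ i + int k"
      "\<And>x. x \<in> ctorus \<Longrightarrow> torus_function k s B' x = (\<Sum>u\<in>F'. c' u * chi u x)" by blast
    have "u \<in> F'"
    proof (rule ccontr)
      assume u: "u \<notin> F'"
      define d where "d u = (if u \<in> F then c u else 0) - (if u \<in> F' then c' u else 0)" for u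
      have "(\<Sum>u\<in>F \<union> F'. d u * chi u x) = 0" if "x \<in> compact_torus" for x
      proof -
        have x: "x \<in> ctorus" using that compact_torus_subset by blast
        have "(\<Sum>u\<in>F. c u * chi u x) = (\<Sum>u\<in>F'. c' u * chi u x)"
          using F(2)[OF x] F'(3)[OF x] torus_function_chart_independent[OF s x B B'] by simp
        moreover have "(\<Sum>u\<in>F. c u * chi u x) = (\<Sum>u\<in>F \<union> F'. (if u \<in> F then c u else 0) * chi u x)"
          using F(1) F'(1) by (intro sum.mono_neutral_cong_left) auto
        moreover have "(\<Sum>u\<in>F'. c' u * chi u x) = (\<Sum>u\<in>F \<union> F'. (if u \<in> F' then c' u else 0) * chi u x)"
          using F(1) F'(1) by (intro sum.mono_neutral_cong_left) auto
        ultimately show ?thesis by (simp add: d_def left_diff_distrib sum_subtractf)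
      qed
      hence "d u = 0" using F(1) F'(1) that(1) by (intro laurent_coefficients_unique[of "F \<union> F'" d u]) auto
      with u that show False by (simp add: d_def)
    qed
    thus "\<forall>i. 0 \<le> (B' *v u) $ i + int k" using F'(2) by blast
  qed
  define c0 where "c0 u = (if u \<in> F then c u else 0)" for u
  have "s = combination \<Delta> k c0"
  proof (rule section_eqI)
    fix B' x assume B': "B' \<in> charts \<Delta>" and x: "x \<in> (ctorus :: (complex ^ 'a) set)"
    have "torus_function k s B' x = (\<Sum>u\<in>F. c u * chi u x)"
      using F(2)[OF x] torus_function_chart_independent[OF s x B B'] by simp
    also have "\<dots> = (\<Sum>u\<in>{u \<in> F. c u \<noteq> 0}. c u * chi u x)"
      using F(1) by (intro sum.mono_neutral_right) auto
    also have "\<dots> = (\<Sum>u\<in>weights \<Delta> k. c0 u * chi u x)"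
      using fin supp by (intro sum.mono_neutral_cong_left) (auto simp: c0_def)
    finally show "torus_function k s B' x = torus_function k (combination \<Delta> k c0) B' x"
      by (simp add: torus_function_combination[OF B' x])
  qed (use s isCont_H0[OF s] isCont_combination in \<open>auto simp: H0_def combination_def monomial_section_def\<close>)
  thus ?thesis using that by blast
qed

lemma combination_eq_iff:
  assumes "finite (weights \<Delta> k)" "charts \<Delta> \<noteq> {}"
  shows "combination \<Delta> k c = combination \<Delta> k d \<longleftrightarrow> (\<forall>u\<in>weights \<Delta> k. c u = d u)"
proof
  assume eq: "combination \<Delta> k c = combination \<Delta> k d"
  from assms obtain B where B: "B \<in> charts \<Delta>" by blast
  show "\<forall>u\<in>weights \<Delta> k. c u = d u"
  proof
    fix u assume u: "u \<in> weights \<Delta> k"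
    have "(\<Sum>u\<in>weights \<Delta> k. (c u - d u) * chi u x) = 0" if "x \<in> compact_torus" for x
    proof -
      have x: "x \<in> ctorus" using that compact_torus_subset by blast
      show ?thesis
        using torus_function_combination[OF B x, of k c] torus_function_combination[OF B x, of k d] eq
        by (simp add: left_diff_distrib sum_subtractf)
    qed
    hence "c u - d u = 0" using laurent_coefficients_unique[OF assms(1), of "\<lambda>u. c u - d u" u] u by blast
    thus "c u = d u" by simp
  qed
qed (simp add: combination_def)

text \<open>
  The character \<open>\<chi>\<^sup>u\<close> is pushed forward to \<open>\<chi>\<^sup>A\<^sup>u\<close>, up to a factor of modulus 1 when \<open>t\<close> lies in
  the compact torus.
\<close>

lemma pushes_to_combination:
  assumes "invertible A" "t \<in> ctorus" "finite (weights \<Delta> k)" "bij_betw ((*v) A) (weights \<Delta> k) (weights \<Delta> k)"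
  shows "pushes_to \<Delta> k (toric_act A t) (combination \<Delta> k c)
    (combination \<Delta> k (\<lambda>u. of_int (det A) ^ k * chi (- u) t * c (matrix_inv A *v u)))"
proof (rule pushes_toI[OF assms(1,2)])
  fix B B' and x :: "complex ^ 'a" assume B: "B \<in> charts \<Delta>" "B' \<in> charts \<Delta>" and x: "x \<in> ctorus"
  have "(\<Sum>u\<in>weights \<Delta> k. (of_int (det A) ^ k * chi (- u) t * c (matrix_inv A *v u)) * chi u (torus_act A t x))
     = (\<Sum>u\<in>weights \<Delta> k. (of_int (det A) ^ k * c (matrix_inv A *v u)) * chi (matrix_inv A *v u) x)"
    using chi_nonzero[OF assms(2)] by (intro sum.cong refl) (simp add: chi_torus_act[OF x] chi_minus)
  also have "\<dots> = (\<Sum>u\<in>weights \<Delta> k. of_int (det A) ^ k * (c u * chi u x))"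
    by (subst sum.reindex_bij_betw[OF assms(4), symmetric])
       (simp add: matrix_inv_cancel_vector[OF assms(1)] mult_ac)
  finally show "torus_function k (combination \<Delta> k (\<lambda>u. of_int (det A) ^ k * chi (- u) t * c (matrix_inv
      A *v u))) B' (torus_act A t x)
    = of_int (det A) ^ k * torus_function k (combination \<Delta> k c) B x"
    by (simp add: torus_function_combination B x torus_act_ctorus assms(2) sum_distrib_left)
qed (rule isCont_combination)+

section \<open>Cones of a smooth complete fan\<close>

definition dual_basis :: "int ^ 'n ^ 'n \<Rightarrow> 'n \<Rightarrow> real ^ 'n"
  where "dual_basis B i = real_vec (matrix_inv B *v axis i 1)"

definition chart_cone :: "int ^ 'n ^ 'n \<Rightarrow> (real ^ 'n) set"
  where "chart_cone B = convex_cone hull (range (\<lambda>i. real_vec (B $ i)))"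

lemma inner_real_vec: "real_vec u \<bullet> real_vec v = of_int (pairing u v)"
  by (simp add: inner_vec_def real_vec_def pairing_def)

lemma inner_dual_basis:
  assumes "invertible B"
  shows "real_vec (B $ l) \<bullet> dual_basis B i = (if l = i then 1 else 0)"
proof -
  have "pairing (B $ l) (matrix_inv B *v axis i 1) = (B *v (matrix_inv B *v axis i 1)) $ l"
    by (simp add: pairing_def matrix_vector_mult_def)
  thus ?thesis
    by (simp add: dual_basis_def inner_real_vec matrix_inv_cancel_vector[OF assms] axis_component)
qed

lemma dual_basis_expansion:
  assumes "invertible B"
  shows "v = (\<Sum>i\<in>UNIV. (v \<bullet> dual_basis B i) *\<^sub>R real_vec (B $ i))"
proof -
  have "(\<Sum>i\<in>UNIV. (v \<bullet> dual_basis B i) *\<^sub>R real_vec (B $ i)) $ l = v $ l" for l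
  proof -
    have "(\<Sum>i\<in>UNIV. (v \<bullet> dual_basis B i) *\<^sub>R real_vec (B $ i)) $ l =
      (\<Sum>i\<in>UNIV. \<Sum>j\<in>UNIV. v $ j * of_int (matrix_inv B $ j $ i) * of_int (B $ i $ l))"
      by (simp add: inner_vec_def dual_basis_def real_vec_def matrix_vector_mult_axis column_def
          sum_distrib_right)
    also have "\<dots> = (\<Sum>j\<in>UNIV. v $ j * of_int ((matrix_inv B ** B) $ j $ l))"
      by (subst sum.swap) (simp add: matrix_matrix_mult_def sum_distrib_left mult.assoc)
    also have "\<dots> = (\<Sum>j\<in>UNIV. if j = l then v $ l else 0)"
      by (intro sum.cong refl) (simp add: matrix_inv_unimodular(2)[OF assms] mat_def)
    finally show ?thesis by simp
  qed
  thus ?thesis by (simp add: vec_eq_iff)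
qed

lemma inner_real_vec_expansion:
  assumes "invertible B"
  shows "v \<bullet> real_vec u = (\<Sum>i\<in>UNIV. (v \<bullet> dual_basis B i) * of_int ((B *v u) $ i))"
proof -
  have "v \<bullet> real_vec u = (\<Sum>i\<in>UNIV. (v \<bullet> dual_basis B i) *\<^sub>R real_vec (B $ i)) \<bullet> real_vec u"
    using dual_basis_expansion[OF assms, of v] by simp
  also have "\<dots> = (\<Sum>i\<in>UNIV. (v \<bullet> dual_basis B i) * of_int (pairing (B $ i) u))"
    by (simp add: inner_sum_left inner_real_vec)
  finally show ?thesis
    by (simp add: pairing_def matrix_vector_mult_def)
qed

text \<open>
  A simplicial cone is described by inequalities in the coordinates dual to its generators.
\<close>

lemma unimodular_cone:
  assumes "invertible B"
  shows "convex_cone hull ((\<lambda>i. real_vec (B $ i)) ` I) =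
    {v. \<forall>i. 0 \<le> v \<bullet> dual_basis B i \<and> (i \<notin> I \<longrightarrow> v \<bullet> dual_basis B i = 0)}"
proof
  show "convex_cone hull ((\<lambda>i. real_vec (B $ i)) ` I) \<subseteq>
    {v. \<forall>i. 0 \<le> v \<bullet> dual_basis B i \<and> (i \<notin> I \<longrightarrow> v \<bullet> dual_basis B i = 0)}"
  proof (rule hull_minimal)
    show "(\<lambda>i. real_vec (B $ i)) ` I \<subseteq> {v. \<forall>i. 0 \<le> v \<bullet> dual_basis B i \<and> (i \<notin> I \<longrightarrow> v \<bullet> dual_basis B i = 0)}"
      by (auto simp: inner_dual_basis[OF assms])
    show "convex_cone {v. \<forall>i. 0 \<le> v \<bullet> dual_basis B i \<and> (i \<notin> I \<longrightarrow> v \<bullet> dual_basis B i = 0)}"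
      by (auto simp: convex_cone_iff inner_add_left)
  qed
next
  show "{v. \<forall>i. 0 \<le> v \<bullet> dual_basis B i \<and> (i \<notin> I \<longrightarrow> v \<bullet> dual_basis B i = 0)} \<subseteq>
    convex_cone hull ((\<lambda>i. real_vec (B $ i)) ` I)"
  proof
    fix v assume v: "v \<in> {v. \<forall>i. 0 \<le> v \<bullet> dual_basis B i \<and> (i \<notin> I \<longrightarrow> v \<bullet> dual_basis B i = 0)}"
    have tm: "(v \<bullet> dual_basis B i) *\<^sub>R real_vec (B $ i) \<in> convex_cone hull ((\<lambda>i. real_vec (B $ i)) ` I)" for i
    proof (cases "i \<in> I")
      case True
      thus ?thesis using v by (intro convex_cone_hull_mul) (auto intro: hull_inc)
    qed (use v convex_cone_hull_contains_0 in auto)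
    have "(\<Sum>i\<in>S. (v \<bullet> dual_basis B i) *\<^sub>R real_vec (B $ i)) \<in> convex_cone hull ((\<lambda>i. real_vec (B $ i)) ` I)"
      if "finite S" for S
      using that
      by (induction S rule: finite_induct) (auto intro: convex_cone_hull_add tm simp:
          convex_cone_hull_contains_0)
    from this[of UNIV] show "v \<in> convex_cone hull ((\<lambda>i. real_vec (B $ i)) ` I)"
      by (simp flip: dual_basis_expansion[OF assms])
  qed
qed

lemma chart_cone_eq:
  "invertible B \<Longrightarrow> chart_cone B = {v. \<forall>i. 0 \<le> v \<bullet> dual_basis B i}"
  using unimodular_cone[of B UNIV] by (simp add: chart_cone_def)

lemma charts_iff: "B \<in> charts \<Delta> \<longleftrightarrow> invertible B \<and> chart_cone B \<in> \<Delta>"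
  by (simp add: charts_def chart_cone_def)

lemma unimodular_ray:
  assumes "invertible B"
  shows "convex_cone hull {real_vec (B $ j)} = {v. \<forall>i. 0 \<le> v \<bullet> dual_basis B i \<and> (i \<noteq> j \<longrightarrow> v \<bullet> dual_basis
      B i = 0)}"
  using unimodular_cone[OF assms, of "{j}"] by simp

lemma dual_basis_nonzero:
  assumes "invertible B"
  shows "dual_basis B i \<noteq> 0"
  using inner_dual_basis[OF assms, of i i] by auto

lemma chart_cone_interior_point:
  assumes "invertible B"
  shows "(\<Sum>i\<in>UNIV. real_vec (B $ i)) \<bullet> dual_basis B j = 1"
  by (simp add: inner_sum_left inner_dual_basis[OF assms])

text \<open>
  A cone spanned by a proper part of a basis of \<open>N\<close>, and the boundary of a cone spanned by a
  basis, lie in finitely many coordinate hyperplanes; no nonempty open set is contained in their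
  union.
\<close>

lemma generic_chart:
  fixes \<Delta> :: "(real ^ 'n) set set"
  assumes "smooth_fan \<Delta>" "complete_fan \<Delta>" "open U" "U \<noteq> {}"
  obtains B v where "B \<in> charts \<Delta>" "v \<in> U" "\<And>i. 0 < v \<bullet> dual_basis B i"
proof -
  have fin: "finite \<Delta>" and un: "\<Union>\<Delta> = UNIV" using assms by (auto simp: complete_fan_def fan_def)
  have "\<forall>\<sigma>\<in>\<Delta>. \<exists>(B :: int ^ 'n ^ 'n) I. invertible B \<and> \<sigma> = convex_cone hull ((\<lambda>i. real_vec (B $ i)) ` I)"
    using assms(1) by (simp add: smooth_fan_def smooth_cone_def)
  then obtain b :: "(real ^ 'n) set \<Rightarrow> int ^ 'n ^ 'n" and I where
    b: "\<And>\<sigma>. \<sigma> \<in> \<Delta> \<Longrightarrow> invertible (b \<sigma>)"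
       "\<And>\<sigma>. \<sigma> \<in> \<Delta> \<Longrightarrow> \<sigma> = convex_cone hull ((\<lambda>i. real_vec (b \<sigma> $ i)) ` I \<sigma>)"
    by metis
  define N where "N = (\<Union>\<sigma>\<in>\<Delta>. \<Union>i\<in>UNIV. {v. dual_basis (b \<sigma>) i \<bullet> v = 0})"
  have "negligible N"
    unfolding N_def using fin dual_basis_nonzero[OF b(1)]
    by (intro negligible_Union finite_imageI) (auto intro!: negligible_Union negligible_hyperplane)
  moreover have "\<not> negligible U" using assms(3,4) by (rule open_not_negligible)
  ultimately have "\<not> U \<subseteq> N" using negligible_subset by blast
  then obtain v where v: "v \<in> U" "v \<notin> N" by blast
  obtain \<sigma> where \<sigma>: "\<sigma> \<in> \<Delta>" "v \<in> \<sigma>" using un by blast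
  have nz: "v \<bullet> dual_basis (b \<sigma>) i \<noteq> 0" for i using v(2) \<sigma>(1) by (auto simp: N_def inner_commute)
  have mem: "0 \<le> v \<bullet> dual_basis (b \<sigma>) i \<and> (i \<notin> I \<sigma> \<longrightarrow> v \<bullet> dual_basis (b \<sigma>) i = 0)" for i
    using \<sigma>(2) b(2)[OF \<sigma>(1)] unimodular_cone[OF b(1)[OF \<sigma>(1)], of "I \<sigma>"] by blast
  hence "I \<sigma> = UNIV" using nz by blast
  hence "b \<sigma> \<in> charts \<Delta>" using b[OF \<sigma>(1)] \<sigma>(1) by (simp add: charts_def)
  moreover have "0 < v \<bullet> dual_basis (b \<sigma>) i" for i using mem[of i] nz[of i] by simp
  ultimately show ?thesis using v(1) that by blast
qed

lemma charts_nonempty: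
  assumes "smooth_fan \<Delta>" "complete_fan \<Delta>"
  shows "charts \<Delta> \<noteq> {}"
  using generic_chart[OF assms, of UNIV] by blast

lemma closed_chart_cone:
  assumes "invertible B"
  shows "closed (chart_cone B)"
proof -
  have "chart_cone B = (\<Inter>i\<in>UNIV. {v. dual_basis B i \<bullet> v \<ge> 0})"
    by (auto simp: chart_cone_eq[OF assms] inner_commute)
  thus ?thesis by (simp add: closed_INT closed_halfspace_ge)
qed

lemma finite_chart_cones:
  assumes "complete_fan \<Delta>"
  shows "finite (chart_cone ` charts \<Delta>)"
  by (rule finite_subset[of _ \<Delta>]) (use assms in \<open>auto simp: charts_iff complete_fan_def fan_def\<close>)

lemma chart_cover:
  assumes "smooth_fan \<Delta>" "complete_fan \<Delta>"
  obtains B where "B \<in> charts \<Delta>" "v \<in> chart_cone B"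
proof -
  have "closed (\<Union>(chart_cone ` charts \<Delta>))"
    using finite_chart_cones[OF assms(2)] by (intro closed_Union) (auto simp: closed_chart_cone charts_iff)
  hence op: "open (- \<Union>(chart_cone ` charts \<Delta>))" by (rule open_Compl)
  have "- \<Union>(chart_cone ` charts \<Delta>) = {}"
  proof (rule ccontr)
    assume "- \<Union>(chart_cone ` charts \<Delta>) \<noteq> {}"
    from generic_chart[OF assms op this] obtain B v where
      B: "B \<in> charts \<Delta>" "v \<in> - \<Union>(chart_cone ` charts \<Delta>)" "\<And>i. 0 < v \<bullet> dual_basis B i" by blast
    hence "v \<in> chart_cone B" by (simp add: chart_cone_eq charts_iff less_imp_le)
    with B show False by blast
  qed
  thus ?thesis using that by blast
qed

text \<open>
  By completeness every linear functional \<open>v\<close> lies in the cone of some chart, whose inequalities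
  bound \<open>v\<close> from below on the weights; apply this to the coordinates and their negatives.
\<close>

lemma finite_weights:
  fixes \<Delta> :: "(real ^ 'n) set set"
  assumes "smooth_fan \<Delta>" "complete_fan \<Delta>"
  shows "finite (weights \<Delta> k)"
proof -
  have bound: "\<exists>m. \<forall>u\<in>weights \<Delta> k. m \<le> v \<bullet> real_vec u" for v
  proof -
    obtain B where B: "B \<in> charts \<Delta>" "v \<in> chart_cone B" using chart_cover[OF assms] by blast
    hence inv: "invertible B" and v: "\<And>i. 0 \<le> v \<bullet> dual_basis B i" by (auto simp: charts_iff chart_cone_eq)
    show ?thesis
    proof (intro exI ballI)
      fix u assume u: "u \<in> weights \<Delta> k"
      show "(\<Sum>i\<in>UNIV. (v \<bullet> dual_basis B i) * (- real k)) \<le> v \<bullet> real_vec u"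
        unfolding inner_real_vec_expansion[OF inv]
      proof (intro sum_mono mult_left_mono v)
        fix i
        have "0 \<le> (B *v u) $ i + int k" using u B by (auto simp: weights_def)
        thus "- real k \<le> of_int ((B *v u) $ i)" by linarith
      qed
    qed
  qed
  have ax: "axis i 1 \<bullet> real_vec u = of_int (u $ i)" "- axis i 1 \<bullet> real_vec u = - of_int (u $ i)" for i
      and u :: "int ^ 'n"
    by (simp_all add: inner_axis' real_vec_def)
  from bound have "\<forall>i. \<exists>m. \<forall>u\<in>weights \<Delta> k. m \<le> axis i 1 \<bullet> real_vec u" by blast
  then obtain l :: "'n \<Rightarrow> real" where l: "\<And>i u. u \<in> weights \<Delta> k \<Longrightarrow> l i \<le> of_int (u $ i)" unfolding ax by metis
  from bound have "\<forall>i. \<exists>m. \<forall>u\<in>weights \<Delta> k. m \<le> - axis i 1 \<bullet> real_vec u" by blast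
  then obtain r :: "'n \<Rightarrow> real" where r: "\<And>i u. u \<in> weights \<Delta> k \<Longrightarrow> r i \<le> - of_int (u $ i)" unfolding ax by metis
  define N :: int where "N = \<lceil>\<Sum>i\<in>UNIV. \<bar>l i\<bar> + \<bar>r i\<bar>\<rceil>"
  have "weights \<Delta> k \<subseteq> {u. \<forall>i. u $ i \<in> {- N..N}}"
  proof (intro subsetI CollectI allI)
    fix u i assume u: "u \<in> weights \<Delta> k"
    have "\<bar>l i\<bar> + \<bar>r i\<bar> \<le> (\<Sum>i\<in>UNIV. \<bar>l i\<bar> + \<bar>r i\<bar>)" by (rule member_le_sum) auto
    also have "\<dots> \<le> of_int N" by (simp add: N_def)
    finally have "\<bar>l i\<bar> + \<bar>r i\<bar> \<le> of_int N" .
    with l[OF u, of i] r[OF u, of i] have "of_int (u $ i) \<le> (of_int N :: real)" "- of_int N \<le> (of_int (u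
        $ i) :: real)" by linarith+
    thus "u $ i \<in> {- N..N}" by (metis atLeastAtMost_iff of_int_le_iff of_int_minus)
  qed
  thus ?thesis by (rule finite_subset) (rule finite_vec_set, simp)
qed

text \<open>
  A row of a chart spans a face, and is primitive since it is part of a basis of \<open>N\<close>. Conversely a
  ray of the fan meets the cone of a chart containing it in a face, hence is one of the edges.
\<close>

lemma ray_generators_eq:
  assumes "smooth_fan \<Delta>" "complete_fan \<Delta>"
  shows "ray_generators \<Delta> = {B $ i | B i. B \<in> charts \<Delta>}"
proof (intro equalityI subsetI)
  fix v assume "v \<in> {B $ i | B i. B \<in> charts \<Delta>}"
  then obtain B i where v: "v = B $ i" and B: "B \<in> charts \<Delta>" by blast
  have inv: "invertible B" using B charts_iff by blast
  have "Gcd (range (($) v)) dvd (\<Sum>j\<in>UNIV. v $ j * matrix_inv B $ j $ i)"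
    by (intro dvd_sum dvd_mult2 Gcd_dvd) simp
  also have "(\<Sum>j\<in>UNIV. v $ j * matrix_inv B $ j $ i) = (B ** matrix_inv B) $ i $ i"
    by (simp add: v matrix_matrix_mult_def)
  also have "\<dots> = 1" by (simp add: matrix_inv_unimodular[OF inv] mat_def)
  finally have prim: "primitive v" by (simp add: primitive_def)
  have "convex_cone hull {real_vec v} face_of chart_cone B"
    unfolding face_of_def
  proof (intro conjI ballI impI)
    show "convex_cone hull {real_vec v} \<subseteq> chart_cone B"
      unfolding chart_cone_def by (rule hull_mono) (auto simp: v)
    show "convex (convex_cone hull {real_vec v})" by (rule convex_convex_cone_hull)
    fix a b x assume a: "a \<in> chart_cone B" and b: "b \<in> chart_cone B"
      and x: "x \<in> convex_cone hull {real_vec v}" and seg: "x \<in> open_segment a b"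
    from seg obtain s where s: "0 < s" "s < 1" "x = (1 - s) *\<^sub>R a + s *\<^sub>R b"
      by (auto simp: in_segment)
    have nn: "0 \<le> a \<bullet> dual_basis B l" "0 \<le> b \<bullet> dual_basis B l" for l
      using a b by (auto simp: chart_cone_eq[OF inv])
    have "a \<bullet> dual_basis B l = 0 \<and> b \<bullet> dual_basis B l = 0" if "l \<noteq> i" for l
    proof -
      have "x \<bullet> dual_basis B l = 0" using x that unfolding v unimodular_ray[OF inv] by blast
      hence "(1 - s) * (a \<bullet> dual_basis B l) + s * (b \<bullet> dual_basis B l) = 0"
        by (simp add: s(3) inner_add_left)
      moreover have "0 \<le> (1 - s) * (a \<bullet> dual_basis B l)" "0 \<le> s * (b \<bullet> dual_basis B l)"
        using s nn by simp_all
      ultimately show ?thesis using s by (simp add: add_nonneg_eq_0_iff)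
    qed
    thus "a \<in> convex_cone hull {real_vec v}" "b \<in> convex_cone hull {real_vec v}"
      using nn unfolding v unimodular_ray[OF inv] by auto
  qed
  hence "convex_cone hull {real_vec v} \<in> \<Delta>"
    using B assms convex_cone_hull_nonempty by (fastforce simp: charts_iff complete_fan_def fan_def)
  with prim show "v \<in> ray_generators \<Delta>" by (simp add: ray_generators_def)
next
  fix v assume v: "v \<in> ray_generators \<Delta>"
  let ?\<rho> = "convex_cone hull {real_vec v}"
  obtain B where B: "B \<in> charts \<Delta>" "real_vec v \<in> chart_cone B" using chart_cover[OF assms] by blast
  have inv: "invertible B" using B charts_iff by blast
  define c where "c i = real_vec v \<bullet> dual_basis B i" for i
  have c: "0 \<le> c i" for i using B by (simp add: chart_cone_eq[OF inv] c_def)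
  have "?\<rho> \<inter> chart_cone B face_of chart_cone B"
    using v B assms by (auto simp: charts_iff ray_generators_def complete_fan_def fan_def)
  moreover have sub: "real_vec v \<in> ?\<rho> \<inter> chart_cone B" using B by (simp add: hull_inc)
  ultimately have face: "a \<in> ?\<rho>" if "a \<in> chart_cone B" "b \<in> chart_cone B" "real_vec v \<in> open_segment a
      b" for a b
    using face_ofD that by blast
  have "\<exists>i. c i \<noteq> 0"
  proof (rule ccontr)
    assume "\<not> (\<exists>i. c i \<noteq> 0)"
    hence "real_vec v = 0" using dual_basis_expansion[OF inv, of "real_vec v"] by (simp add: c_def)
    hence "v = 0" by (simp add: real_vec_def vec_eq_iff)
    moreover have "primitive v" using v by (simp add: ray_generators_def)
    moreover have "Gcd (range (($) (0 :: int ^ 'a))) = 0" by (subst Gcd_0_iff) auto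
    ultimately show False by (simp add: primitive_def)
  qed
  then obtain i where i: "c i > 0" using c by (metis order_le_less)
  \<comment> \<open>the midpoint of \<open>a\<close> and \<open>b\<close> is \<open>v\<close>, and \<open>a\<close> is a multiple of one generator of the cone\<close>
  define a where "a = (2 * c i) *\<^sub>R real_vec (B $ i)"
  define b where "b = 2 *\<^sub>R real_vec v - a"
  have aj: "a \<bullet> dual_basis B j = (if j = i then 2 * c i else 0)" for j
    by (simp add: a_def inner_dual_basis[OF inv])
  have bj: "b \<bullet> dual_basis B j = (if j = i then 0 else 2 * c j)" for j
    by (simp add: b_def inner_diff_left aj) (simp add: c_def)
  have "a \<noteq> b" using aj[of i] bj[of i] i by auto
  hence seg: "real_vec v \<in> open_segment a b"
    unfolding in_segment by (intro conjI exI[of _ "1/2"]) (auto simp: b_def scaleR_right_diff_distrib)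
  have "a \<in> chart_cone B" "b \<in> chart_cone B" using aj bj c by (auto simp: chart_cone_eq[OF inv])
  from face[OF this seg] have "a \<in> ?\<rho>" .
  moreover have "?\<rho> \<subseteq> {y. \<exists>m. y = m *\<^sub>R real_vec v}"
    by (rule hull_minimal) (auto simp: convex_cone_iff intro: exI[of _ 1] exI[of _ 0] exI simp flip:
        scaleR_left.add)
  ultimately obtain m where m: "a = m *\<^sub>R real_vec v" by blast
  have mc: "m * c j = (if j = i then 2 * c i else 0)" for j
    using aj[of j] by (simp add: m c_def)
  have c0: "c j = 0" if "j \<noteq> i" for j using mc[of i] mc[of j] that i by auto
  have "real_vec v = (\<Sum>j\<in>UNIV. c j *\<^sub>R real_vec (B $ j))"
    unfolding c_def by (rule dual_basis_expansion[OF inv])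
  also have "\<dots> = (\<Sum>j\<in>UNIV. if j = i then c i *\<^sub>R real_vec (B $ i) else 0)"
    by (rule sum.cong) (simp_all add: c0)
  finally have vc: "real_vec v = c i *\<^sub>R real_vec (B $ i)" by simp
  define d where "d = pairing v (matrix_inv B *v axis i 1)"
  have cd: "c i = of_int d" by (simp add: c_def dual_basis_def inner_real_vec d_def)
  have vd: "v $ l = d * B $ i $ l" for l
  proof -
    have "real_of_int (v $ l) = of_int (d * B $ i $ l)"
      using arg_cong[OF vc, of "\<lambda>x. x $ l"] by (simp add: real_vec_def cd)
    thus ?thesis by linarith
  qed
  have "d dvd Gcd (range (($) v))" by (rule Gcd_greatest) (auto simp: vd)
  hence "d dvd 1" using v by (simp add: ray_generators_def primitive_def)
  moreover have "d > 0" using i cd by simp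
  ultimately have "d = 1" by (simp add: zdvd1_eq)
  hence "v = B $ i" by (simp add: vec_eq_iff vd)
  thus "v \<in> {B $ i | B i. B \<in> charts \<Delta>}" using B by blast
qed

text \<open>
  The inequalities defining the polytope are those given by the rows of the charts.
\<close>

lemma weights_iff_polytope:
  fixes u :: "int ^ 'n"
  assumes "smooth_fan \<Delta>" "complete_fan \<Delta>" "k \<ge> 1"
  shows "u \<in> weights \<Delta> k \<longleftrightarrow> (1 / real k) *\<^sub>R real_vec u \<in> anticanonical_polytope \<Delta>"
proof -
  have "(1 / real k) *\<^sub>R real_vec u \<in> anticanonical_polytope \<Delta> \<longleftrightarrow>
    (\<forall>B\<in>charts \<Delta>. \<forall>i. (1 / real k) *\<^sub>R real_vec u \<bullet> (- real_vec (B $ i)) \<le> 1)"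
    unfolding anticanonical_polytope_def ray_generators_eq[OF assms(1,2)] by blast
  also have "\<dots> \<longleftrightarrow> (\<forall>B\<in>charts \<Delta>. \<forall>i. 0 \<le> (B *v u) $ i + int k)"
  proof -
    have "(1 / real k) *\<^sub>R real_vec u \<bullet> (- real_vec (B $ i)) \<le> 1 \<longleftrightarrow> 0 \<le> (B *v u) $ i + int k" for B ::
        "int ^ 'n ^ 'n" and i
    proof -
      have "(1 / real k) *\<^sub>R real_vec u \<bullet> (- real_vec (B $ i)) \<le> 1 \<longleftrightarrow> - real k \<le> of_int ((B *v u) $ i)"
        using assms(3) by (simp add: inner_real_vec pairing_mult field_simps)
      thus ?thesis by linarith
    qed
    thus ?thesis by (simp only:)
  qed
  finally show ?thesis by (simp add: weights_def)
qed

lemma real_vec_mult: "real_vec (A *v u) = real_mat A *v real_vec u"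
  by (simp add: real_vec_def real_mat_def matrix_vector_mult_def vec_eq_iff)

lemma Aut_polytope_inv:
  assumes "A \<in> carrier (Aut_polytope P)"
  shows "matrix_inv A \<in> carrier (Aut_polytope P)"
proof -
  have inv: "invertible A" and im: "(*v) (real_mat A) ` P = P" using assms by (auto simp: Aut_polytope_def)
  have "real_mat (matrix_inv A) ** real_mat A = mat 1"
  proof -
    have "real_mat (matrix_inv A) ** real_mat A = real_mat (matrix_inv A ** A)"
      by (simp add: real_mat_def matrix_matrix_mult_def vec_eq_iff)
    also have "\<dots> = mat 1" by (simp add: matrix_inv_unimodular[OF inv] real_mat_def mat_def vec_eq_iff)
    finally show ?thesis .
  qed
  hence "(*v) (real_mat (matrix_inv A)) ` ((*v) (real_mat A) ` P) = P"
    by (simp add: image_image matrix_vector_mul_assoc)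
  thus ?thesis using inv im by (simp add: Aut_polytope_def invertible_matrix_inv)
qed

lemma weights_Aut:
  assumes "smooth_fan \<Delta>" "complete_fan \<Delta>" "k \<ge> 1"
    "A \<in> carrier (Aut_polytope (anticanonical_polytope \<Delta>))" "u \<in> weights \<Delta> k"
  shows "A *v u \<in> weights \<Delta> k"
proof -
  have "(*v) (real_mat A) ` anticanonical_polytope \<Delta> = anticanonical_polytope \<Delta>"
    using assms by (simp add: Aut_polytope_def)
  hence "real_mat A *v ((1 / real k) *\<^sub>R real_vec u) \<in> anticanonical_polytope \<Delta>"
    using assms(5) weights_iff_polytope[OF assms(1-3)] by blast
  thus ?thesis by (simp add: weights_iff_polytope[OF assms(1-3)] real_vec_mult matrix_vector_mult_scaleR)
qed

lemma bij_weights_Aut: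
  assumes "smooth_fan \<Delta>" "complete_fan \<Delta>" "k \<ge> 1"
    "A \<in> carrier (Aut_polytope (anticanonical_polytope \<Delta>))"
  shows "bij_betw ((*v) A) (weights \<Delta> k) (weights \<Delta> k)"
proof -
  have inv: "invertible A" using assms by (simp add: Aut_polytope_def)
  show ?thesis
    by (rule bij_betwI[of _ _ _ "(*v) (matrix_inv A)"])
      (use weights_Aut[OF assms(1-3)] assms(4) Aut_polytope_inv matrix_inv_cancel_vector[OF inv] in auto)
qed

section \<open>Vertices of the anticanonical polytope\<close>

text \<open>
  The point at which the facet inequalities of \<open>P\<close> belonging to the rows of \<open>B\<close> are equalities. It
  is a lattice point because \<open>B\<close> is unimodular.
\<close>

definition chart_vertex :: "int ^ 'n ^ 'n \<Rightarrow> int ^ 'n"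
  where "chart_vertex B = matrix_inv B *v (\<chi> i. - 1)"

lemma chart_vertex_mult: "invertible B \<Longrightarrow> B *v chart_vertex B = (\<chi> i. - 1)"
  by (simp add: chart_vertex_def matrix_inv_cancel_vector)

lemma scale_vec_mult:
  fixes A :: "int ^ 'n ^ 'm"
  shows "A *v (m *s u) = m *s (A *v u)"
  by (simp add: matrix_vector_mult_def vec_eq_iff sum_distrib_left mult_ac)

lemma monomial_section_at_origin:
  assumes "B \<in> charts \<Delta>" "u \<in> weights \<Delta> m"
  shows "monomial_section \<Delta> m u B 0 = (if u = int m *s chart_vertex B then of_int (det B) ^ m else 0)"
proof -
  have inv: "invertible B" using assms charts_invertible by blast
  have "u = int m *s chart_vertex B \<longleftrightarrow> (\<forall>i. (B *v u) $ i + int m = 0)"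
  proof
    assume "u = int m *s chart_vertex B"
    hence "B *v u = int m *s (B *v chart_vertex B)" by (simp only: scale_vec_mult)
    thus "\<forall>i. (B *v u) $ i + int m = 0" by (simp add: chart_vertex_mult[OF inv])
  next
    assume "\<forall>i. (B *v u) $ i + int m = 0"
    hence "B *v u = int m *s (\<chi> i. - 1)" by (simp add: vec_eq_iff add_eq_0_iff2)
    hence "matrix_inv B *v (B *v u) = int m *s (matrix_inv B *v (\<chi> i. - 1))" by (simp add: scale_vec_mult)
    thus "u = int m *s chart_vertex B" by (simp add: matrix_inv_cancel_vector[OF inv] chart_vertex_def)
  qed
  moreover have "(\<forall>i. (B *v u) $ i + int m = 0) \<longleftrightarrow> (\<forall>i. nat ((B *v u) $ i + int m) = 0)"
  proof -
    have "nat ((B *v u) $ i + int m) = 0 \<longleftrightarrow> (B *v u) $ i + int m = 0" for i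
    proof -
      have "0 \<le> (B *v u) $ i + int m" using assms by (auto simp: weights_def)
      thus ?thesis by linarith
    qed
    thus ?thesis by simp
  qed
  ultimately have eq: "u = int m *s chart_vertex B \<longleftrightarrow> (\<forall>i. nat ((B *v u) $ i + int m) = 0)" by (rule trans)
  have "(\<Prod>i\<in>UNIV. (0 :: complex) ^ nat ((B *v u) $ i + int m)) =
      (if u = int m *s chart_vertex B then 1 else 0)"
  proof (cases "\<forall>i. nat ((B *v u) $ i + int m) = 0")
    case True
    thus ?thesis unfolding eq by simp
  next
    case False
    then obtain i where "nat ((B *v u) $ i + int m) \<noteq> 0" by blast
    hence "(0 :: complex) ^ nat ((B *v u) $ i + int m) = 0" by (simp only: power_0_left if_False)
    hence "(\<Prod>i\<in>UNIV. (0 :: complex) ^ nat ((B *v u) $ i + int m)) = 0" by (intro prod_zero) auto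
    thus ?thesis using False unfolding eq by simp
  qed
  thus ?thesis using assms(1) by (simp add: monomial_section_def)
qed

lemma combination_at_origin:
  assumes "B \<in> charts \<Delta>" "finite (weights \<Delta> m)"
  shows "combination \<Delta> m c B 0 =
    (if int m *s chart_vertex B \<in> weights \<Delta> m then c (int m *s chart_vertex B) * of_int (det B) ^ m else 0)"
proof -
  have "combination \<Delta> m c B 0 = (\<Sum>u\<in>weights \<Delta> m. if u = int m *s chart_vertex B
      then c (int m *s chart_vertex B) * of_int (det B) ^ m else 0)"
    unfolding combination_def using assms by (intro sum.cong refl) (auto simp: monomial_section_at_origin)
  thus ?thesis using assms(2) by simp
qed

text \<open>
  Only the monomial with weight \<open>m\<close> times the vertex is nonzero at the origin of the chart \<open>B\<close>. As
  some section of a multiple \<open>-mK\<^sub>X\<close> does not vanish there, this monomial is a section, so that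
  the vertex does lie in \<open>P\<close>.
\<close>

lemma vertex_weight:
  assumes "toric_fano \<Delta>" "B \<in> charts \<Delta>"
  shows "int k *s chart_vertex B \<in> weights \<Delta> k"
proof -
  have sc: "smooth_fan \<Delta>" "complete_fan \<Delta>" using assms by (auto simp: toric_fano_def)
  obtain m where m: "m \<ge> 1" "very_ample_anticanonical \<Delta> m"
    using assms by (auto simp: toric_fano_def ample_anticanonical_def)
  then obtain s where s: "s \<in> H0 \<Delta> m" "s B 0 \<noteq> 0"
    using assms(2) unfolding very_ample_anticanonical_def by blast
  from H0_combination[OF finite_weights[OF sc] charts_nonempty[OF sc] s(1)]
  obtain c where "s = combination \<Delta> m c" .
  with s(2) have w: "int m *s chart_vertex B \<in> weights \<Delta> m"
    using combination_at_origin[OF assms(2) finite_weights[OF sc, of m], of c] by (auto split: if_splits)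
  show ?thesis
    unfolding weights_def
  proof (intro CollectI ballI allI)
    fix B' i assume "B' \<in> charts \<Delta>"
    with w have "0 \<le> int m * ((B' *v chart_vertex B) $ i) + int m" 
      unfolding weights_def by (simp add: scale_vec_mult)
    hence "0 \<le> int m * ((B' *v chart_vertex B) $ i + 1)" by (simp add: distrib_left)
    hence "0 \<le> (B' *v chart_vertex B) $ i + 1" using m(1) by (simp add: zero_le_mult_iff)
    hence "0 \<le> int k * ((B' *v chart_vertex B) $ i + 1)" by simp
    thus "0 \<le> (B' *v (int k *s chart_vertex B)) $ i + int k" by (simp add: scale_vec_mult distrib_left)
  qed
qed

text \<open>
  If the vertices agree, no section of the very ample bundle separates the origins of the two
  charts, so these are the same torus fixed point, which determines the cone.
\<close>

lemma chart_cone_eq_of_vertex_eq: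
  assumes "toric_fano \<Delta>" "B \<in> charts \<Delta>" "B' \<in> charts \<Delta>" "chart_vertex B = chart_vertex B'"
  shows "chart_cone B' \<subseteq> chart_cone B"
proof -
  have sc: "smooth_fan \<Delta>" "complete_fan \<Delta>" using assms by (auto simp: toric_fano_def)
  have inv: "invertible B" "invertible B'" using assms charts_invertible by blast+
  obtain m where m: "m \<ge> 1" "very_ample_anticanonical \<Delta> m"
    using assms by (auto simp: toric_fano_def ample_anticanonical_def)
  have "s B' 0 = (of_int (det B') ^ m * of_int (det B) ^ m) * s B 0" if s: "s \<in> H0 \<Delta> m" for s
  proof -
    from H0_combination[OF finite_weights[OF sc] charts_nonempty[OF sc] s]
    obtain c where "s = combination \<Delta> m c" .
    thus ?thesis using det_power_squared[OF inv(1), of m, where 'b = complex]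
      by (simp add: combination_at_origin assms finite_weights[OF sc] vertex_weight)
  qed
  hence "chart_point B' 0 = chart_point B 0"
    using m(2) assms(2,3) unfolding very_ample_anticanonical_def by blast
  hence dom: "(\<forall>i. 0 \<le> (B' *v u) $ i) \<longleftrightarrow> (\<forall>i. 0 \<le> (B *v u) $ i)" for u
  proof -
    have "chart_point B' 0 u = None \<longleftrightarrow> chart_point B 0 u = None"
      using \<open>chart_point B' 0 = chart_point B 0\<close> by simp
    thus ?thesis unfolding chart_point_eq_chi by (auto split: if_splits)
  qed
  show ?thesis
  proof
    fix v assume v: "v \<in> chart_cone B'"
    have "0 \<le> v \<bullet> dual_basis B i" for i
    proof -
      have "\<forall>l. 0 \<le> (B *v (matrix_inv B *v axis i 1)) $ l"
        by (simp add: matrix_inv_cancel_vector[OF inv(1)] axis_component)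
      hence "\<forall>l. 0 \<le> (B' *v (matrix_inv B *v axis i 1)) $ l" using dom by blast
      thus ?thesis using v
        unfolding dual_basis_def[of B] inner_real_vec_expansion[OF inv(2)] chart_cone_eq[OF inv(2)]
        by (intro sum_nonneg mult_nonneg_nonneg) auto
    qed
    thus "v \<in> chart_cone B" by (simp add: chart_cone_eq[OF inv(1)])
  qed
qed

lemma matrix_inv_mult:
  fixes A B :: "int ^ 'n ^ 'n"
  assumes "invertible A" "invertible B"
  shows "matrix_inv (B ** matrix_inv A) = A ** matrix_inv B"
proof (rule matrix_inv_unique)
  have "B ** matrix_inv A ** (A ** matrix_inv B) = B ** (matrix_inv A ** A) ** matrix_inv B"
    by (simp only: matrix_mul_assoc)
  thus "B ** matrix_inv A ** (A ** matrix_inv B) = mat 1" by (simp add: matrix_inv_unimodular assms)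
  have "A ** matrix_inv B ** (B ** matrix_inv A) = A ** (matrix_inv B ** B) ** matrix_inv A"
    by (simp only: matrix_mul_assoc)
  thus "A ** matrix_inv B ** (B ** matrix_inv A) = mat 1" by (simp add: matrix_inv_unimodular assms)
qed

text \<open>
  The functional \<open>v\<close>, being interior to the cone of \<open>B'\<close>, attains its minimum on \<open>P\<close> at the vertex
  of \<open>B'\<close> only. Being interior to the cone transported by \<open>A\<close>, it attains it at the image of the
  vertex of \<open>B\<close>.
\<close>

lemma vertex_of_generic_chart:
  assumes "smooth_fan \<Delta>" "complete_fan \<Delta>" "toric_fano \<Delta>" and A: "A \<in> carrier (Aut_polytope
      (anticanonical_polytope \<Delta>))"
    and B: "B \<in> charts \<Delta>" "B' \<in> charts \<Delta>"
    and v: "\<And>i. 0 < v \<bullet> dual_basis (B ** matrix_inv A) i" "\<And>i. 0 < v \<bullet> dual_basis B' i"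
  shows "chart_vertex B' = A *v chart_vertex B"
proof -
  have inv: "invertible B" "invertible B'" "invertible A" using B A charts_invertible by (auto simp:
      Aut_polytope_def)
  define C where "C = B ** matrix_inv A"
  have invC: "invertible C" using inv by (simp add: C_def invertible_mult invertible_matrix_inv)
  have w: "chart_vertex B \<in> weights \<Delta> 1" "chart_vertex B' \<in> weights \<Delta> 1"
    using vertex_weight[OF assms(3), of _ 1] B by auto
  have 1: "C *v (A *v chart_vertex B) = (\<chi> i. - 1)"
    by (simp add: C_def matrix_inv_cancel_vector[OF inv(3)] chart_vertex_mult[OF inv(1)] flip:
        matrix_vector_mul_assoc)
  have 2: "0 \<le> (C *v chart_vertex B') $ i + 1" for i
  proof -
    have "matrix_inv A *v chart_vertex B' \<in> weights \<Delta> 1"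
      using weights_Aut[OF assms(1,2) _ Aut_polytope_inv[OF A]] w(2) by simp
    thus ?thesis using B(1) by (auto simp: weights_def C_def simp flip: matrix_vector_mul_assoc)
  qed
  have 3: "B' *v chart_vertex B' = (\<chi> i. - 1)" by (rule chart_vertex_mult[OF inv(2)])
  have 4: "0 \<le> (B' *v (A *v chart_vertex B)) $ i + 1" for i
    using weights_Aut[OF assms(1,2) _ A w(1)] B(2) by (auto simp: weights_def)
  have "v \<bullet> real_vec (A *v chart_vertex B) \<le> v \<bullet> real_vec (chart_vertex B')"
    unfolding inner_real_vec_expansion[OF invC] 1
  proof (intro sum_mono mult_left_mono)
    fix i show "real_of_int ((\<chi> i. - 1) $ i) \<le> of_int ((C *v chart_vertex B') $ i)" using 2[of i] by simp
    show "0 \<le> v \<bullet> dual_basis C i" using v(1)[of i] by (simp add: C_def)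
  qed
  hence le: "(\<Sum>i\<in>UNIV. (v \<bullet> dual_basis B' i) * of_int ((B' *v (A *v chart_vertex B)) $ i)) \<le>
     (\<Sum>i\<in>UNIV. (v \<bullet> dual_basis B' i) * - 1)"
    unfolding inner_real_vec_expansion[OF inv(2)] 3 by simp
  have "(\<Sum>i\<in>UNIV. (v \<bullet> dual_basis B' i) * of_int ((B' *v (A *v chart_vertex B)) $ i + 1)) \<le> 0"
    using le by (simp add: distrib_left sum.distrib sum_negf)
  moreover have nn: "0 \<le> (v \<bullet> dual_basis B' i) * of_int ((B' *v (A *v chart_vertex B)) $ i + 1)" for i
    using v(2)[of i] 4[of i] by (intro mult_nonneg_nonneg) (simp_all only: of_int_0_le_iff less_imp_le)
  ultimately have "(\<Sum>i\<in>UNIV. (v \<bullet> dual_basis B' i) * of_int ((B' *v (A *v chart_vertex B)) $ i + 1)) = 0"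
    by (intro antisym sum_nonneg) auto
  hence "(v \<bullet> dual_basis B' i) * of_int ((B' *v (A *v chart_vertex B)) $ i + 1) = 0" for i
    using nn by (subst (asm) sum_nonneg_eq_0_iff) auto
  hence "of_int ((B' *v (A *v chart_vertex B)) $ i + 1) = (0 :: real)" for i
    using v(2)[of i] by (metis less_irrefl mult_eq_0_iff)
  hence "(B' *v (A *v chart_vertex B)) $ i + 1 = 0" for i by (simp only: of_int_eq_0_iff)
  hence "B' *v (A *v chart_vertex B) = (\<chi> i. - 1)" by (simp add: vec_eq_iff add_eq_0_iff2)
  thus ?thesis using matrix_inv_cancel_vector(2)[OF inv(2)] by (metis chart_vertex_def)
qed

text \<open>
  At generic points of the transported cone all charts of the fan have the same vertex, hence the
  same cone. Generic points are dense, and cones are closed.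
\<close>

lemma transported_cone_subset:
  assumes fano: "toric_fano \<Delta>" and A: "A \<in> carrier (Aut_polytope (anticanonical_polytope \<Delta>))"
    and B: "B \<in> charts \<Delta>"
  obtains B1 where "B1 \<in> charts \<Delta>" "chart_vertex B1 = A *v chart_vertex B"
    "chart_cone (B ** matrix_inv A) \<subseteq> chart_cone B1"
proof -
  have sc: "smooth_fan \<Delta>" "complete_fan \<Delta>" using fano by (auto simp: toric_fano_def)
  have inv: "invertible B" "invertible A" using B A charts_invertible by (auto simp: Aut_polytope_def)
  define C where "C = B ** matrix_inv A"
  have invC: "invertible C" using inv by (simp add: C_def invertible_mult invertible_matrix_inv)
  define V where "V = {v. \<forall>i. 0 < v \<bullet> dual_basis C i}"
  have "V = (\<Inter>i\<in>UNIV. {v. dual_basis C i \<bullet> v > 0})" by (auto simp: V_def inner_commute)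
  hence op: "open V" by (simp add: open_INT open_halfspace_gt)
  \<comment> \<open>an interior point of the transported cone, used both for nonemptiness and to approach boundary points\<close>
  define w where "w = (\<Sum>i\<in>UNIV. real_vec (C $ i))"
  have w1: "w \<bullet> dual_basis C i = 1" for i unfolding w_def by (rule chart_cone_interior_point[OF invC])
  have ne: "V \<noteq> {}" using w1 unfolding V_def by (auto intro!: exI[of _ w])
  from generic_chart[OF sc op ne] obtain B1 v where
    B1: "B1 \<in> charts \<Delta>" "v \<in> V" "\<And>i. 0 < v \<bullet> dual_basis B1 i" by blast
  have vert: "chart_vertex B' = A *v chart_vertex B" if "B' \<in> charts \<Delta>" "v \<in> V" "\<And>i. 0 < v \<bullet> dual_basis
      B' i" for B' v
    by (rule vertex_of_generic_chart[OF sc fano A B that(1)]) (use that in \<open>auto simp: V_def C_def\<close>)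
  have inv1: "invertible B1" using B1 charts_invertible by blast
  have VB1: "V \<subseteq> chart_cone B1"
  proof (rule ccontr)
    assume "\<not> V \<subseteq> chart_cone B1"
    hence "V \<inter> - chart_cone B1 \<noteq> {}" by blast
    moreover have "open (V \<inter> - chart_cone B1)" by (intro open_Int op open_Compl closed_chart_cone inv1)
    ultimately obtain B' v' where
      B': "B' \<in> charts \<Delta>" "v' \<in> V \<inter> - chart_cone B1" "\<And>i. 0 < v' \<bullet> dual_basis B' i"
      using generic_chart[OF sc] by blast
    have "chart_vertex B1 = chart_vertex B'" using vert[OF B1] vert[of B' v'] B' by simp
    hence "chart_cone B' \<subseteq> chart_cone B1" using chart_cone_eq_of_vertex_eq[OF fano B1(1) B'(1)] by simp
    moreover have "v' \<in> chart_cone B'" using B' by (simp add: chart_cone_eq charts_iff less_imp_le)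
    ultimately show False using B'(2) by blast
  qed
  have "chart_cone C \<subseteq> chart_cone B1"
  proof
    fix x assume x: "x \<in> chart_cone C"
    have "x + e *\<^sub>R w \<in> V" if "e > 0" for e
      using x that by (auto simp: V_def chart_cone_eq[OF invC] inner_add_left w1 add_nonneg_pos)
    hence ev: "\<forall>\<^sub>F e in at_right 0. x + e *\<^sub>R w \<in> chart_cone B1"
      using VB1 by (intro eventually_mono[OF eventually_at_right_less[of 0]]) blast
    have "((\<lambda>e. x + e *\<^sub>R w) \<longlongrightarrow> x + 0 *\<^sub>R w) (at_right 0)"
      by (intro tendsto_intros)
    hence "x + 0 *\<^sub>R w \<in> chart_cone B1"
      by (rule Lim_in_closed_set[OF closed_chart_cone[OF inv1] ev trivial_limit_at_right_real])
    thus "x \<in> chart_cone B1" by simp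
  qed
  thus ?thesis using that[OF B1(1)] vert[OF B1] by (simp add: C_def)
qed

text \<open>
  The transported cone is contained in a cone of the fan; applying the same to \<open>A\<^sup>-\<^sup>1\<close> gives
  equality.
\<close>

lemma Aut_maps_charts:
  assumes fano: "toric_fano \<Delta>" and A: "A \<in> carrier (Aut_polytope (anticanonical_polytope \<Delta>))"
    and B: "B \<in> charts \<Delta>"
  shows "B ** matrix_inv A \<in> charts \<Delta>"
proof -
  have inv: "invertible B" "invertible A" using B A charts_invertible by (auto simp: Aut_polytope_def)
  have invC: "invertible (B ** matrix_inv A)" using inv by (simp add: invertible_mult invertible_matrix_inv)
  obtain B1 where B1: "B1 \<in> charts \<Delta>" "chart_vertex B1 = A *v chart_vertex B"
    "chart_cone (B ** matrix_inv A) \<subseteq> chart_cone B1"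
    using transported_cone_subset[OF fano A B] by blast
  have inv1: "invertible B1" using B1 charts_invertible by blast
  obtain B2 where B2: "B2 \<in> charts \<Delta>" "chart_vertex B2 = matrix_inv A *v chart_vertex B1"
    "chart_cone (B1 ** matrix_inv (matrix_inv A)) \<subseteq> chart_cone B2"
    using transported_cone_subset[OF fano Aut_polytope_inv[OF A] B1(1)] by blast
  have "chart_vertex B = chart_vertex B2"
    using B1(2) B2(2) by (simp add: matrix_inv_cancel_vector[OF inv(2)])
  hence B2B: "chart_cone (B1 ** matrix_inv (matrix_inv A)) \<subseteq> chart_cone B"
    using chart_cone_eq_of_vertex_eq[OF fano B B2(1)] B2(3) by simp
  have "chart_cone B1 \<subseteq> chart_cone (B ** matrix_inv A)"
  proof
    fix v assume v: "v \<in> chart_cone B1"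
    define x where "x = transpose (real_mat A) *v v"
    have x: "x \<bullet> y = v \<bullet> (real_mat A *v y)" for y
      by (simp add: x_def dot_lmul_matrix[symmetric] vector_transpose_matrix inner_commute)
    have "x \<bullet> dual_basis (B1 ** matrix_inv (matrix_inv A)) i = v \<bullet> dual_basis B1 i" for i
      by (simp add: x dual_basis_def matrix_inv_mult inv1 invertible_matrix_inv inv(2) matrix_inv_cancel_vector
          flip: real_vec_mult matrix_vector_mul_assoc)
    hence "x \<in> chart_cone (B1 ** matrix_inv (matrix_inv A))"
      using v by (simp add: chart_cone_eq inv1 invertible_mult invertible_matrix_inv inv(2))
    hence "0 \<le> x \<bullet> dual_basis B i" for i using B2B chart_cone_eq[OF inv(1)] by blast
    hence "0 \<le> v \<bullet> dual_basis (B ** matrix_inv A) i" for i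
      by (simp add: x dual_basis_def matrix_inv_mult inv flip: real_vec_mult matrix_vector_mul_assoc)
    thus "v \<in> chart_cone (B ** matrix_inv A)" by (simp add: chart_cone_eq[OF invC])
  qed
  with B1 have "chart_cone (B ** matrix_inv A) = chart_cone B1" by blast
  thus ?thesis using B1(1) invC by (simp add: charts_iff)
qed

lemma toric_act_chart:
  assumes "invertible A" "invertible B" "t \<in> ctorus"
  shows "toric_act A t (chart_point B z) =
    chart_point (B ** matrix_inv A) (\<chi> j. torus_coords (B ** matrix_inv A) t $ j * z $ j)"
proof -
  have invC: "invertible (B ** matrix_inv A)" using assms by (simp add: invertible_mult invertible_matrix_inv)
  have "torus_coords (B ** matrix_inv A) t $ j \<noteq> 0" for j
    using torus_coords_ctorus[OF assms(3)] by (simp add: ctorus_def)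
  thus ?thesis
    unfolding toric_act_chart_point unfolding chart_point_eq_chi
    by (simp add: chi_mult chi_torus_coords[OF invC assms(3)] matrix_vector_mul_assoc cong: if_cong)
qed

lemma toric_act_variety:
  assumes fano: "toric_fano \<Delta>" and A: "A \<in> carrier (Aut_polytope (anticanonical_polytope \<Delta>))"
    and t: "t \<in> ctorus" and x: "x \<in> toric_variety \<Delta>"
  shows "toric_act A t x \<in> toric_variety \<Delta>"
proof -
  obtain B z where B: "B \<in> charts \<Delta>" "x = chart_point B z" using x by (auto simp: toric_variety_def)
  have "invertible A" using A by (simp add: Aut_polytope_def)
  thus ?thesis
    using Aut_maps_charts[OF fano A B(1)] toric_act_chart[OF _ charts_invertible[OF B(1)] t] B(2)
    by (auto simp: toric_variety_def)
qed

section \<open>Spans of monomial sections\<close>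

lemma combination_add: "combination \<Delta> k c + combination \<Delta> k d = combination \<Delta> k (\<lambda>u. c u + d u)"
  by (simp add: combination_def fun_eq_iff sum.distrib distrib_right)

lemma combination_scale: "scale_coeffs a (combination \<Delta> k c) = combination \<Delta> k (\<lambda>u. a * c u)"
  by (simp add: combination_def scale_coeffs_def sum_distrib_left mult.assoc)

lemma combination_zero: "combination \<Delta> k (\<lambda>u. 0) = 0"
  by (simp add: combination_def fun_eq_iff)

lemma combination_sum:
  "(\<Sum>i\<in>I. combination \<Delta> k (c i)) = combination \<Delta> k (\<lambda>u. \<Sum>i\<in>I. c i u)"
  by (induction I rule: infinite_finite_induct) (simp_all add: combination_zero combination_add)

lemma scale_monomial_section:
  assumes "finite (weights \<Delta> k)" "u \<in> weights \<Delta> k"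
  shows "scale_coeffs a (monomial_section \<Delta> k u) = combination \<Delta> k (\<lambda>v. if v = u then a else 0)"
  using assms by (simp add: scale_coeffs_def combination_def fun_eq_iff if_distrib[of "\<lambda>x. x * _"] cong:
      if_cong)

definition supported_sections :: "(real ^ 'n) set set \<Rightarrow> nat \<Rightarrow> (int ^ 'n) set \<Rightarrow> 'n local_coeffs set"
  where "supported_sections \<Delta> k S = {combination \<Delta> k c | c. \<forall>u. u \<notin> S \<longrightarrow> c u = 0}"

lemma combination_supported: "(\<And>u. u \<notin> S \<Longrightarrow> c u = 0) \<Longrightarrow> combination \<Delta> k c \<in> supported_sections \<Delta> k S"
  unfolding supported_sections_def by blast

lemma combination_as_sum:
  assumes "finite (weights \<Delta> k)" "S \<subseteq> weights \<Delta> k" "\<And>u. u \<notin> S \<Longrightarrow> c u = 0"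
  shows "combination \<Delta> k c = (\<Sum>u\<in>S. scale_coeffs (c u) (monomial_section \<Delta> k u))"
proof -
  have finS: "finite S" using assms finite_subset by blast
  have "(\<Sum>u\<in>S. scale_coeffs (c u) (monomial_section \<Delta> k u)) =
    (\<Sum>u\<in>S. combination \<Delta> k (\<lambda>v. if v = u then c u else 0))"
    using assms by (intro sum.cong refl scale_monomial_section) auto
  also have "\<dots> = combination \<Delta> k (\<lambda>v. \<Sum>u\<in>S. if v = u then c u else 0)" by (rule combination_sum)
  also have "(\<lambda>v. \<Sum>u\<in>S. if v = u then c u else 0) = c"
    using finS assms(3) by (auto simp: fun_eq_iff)
  finally show ?thesis by simp
qed

lemma subspace_supported_sections: "coeffs.subspace (supported_sections \<Delta> k S)"
proof (rule coeffs.subspaceI)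
  show "0 \<in> supported_sections \<Delta> k S"
    unfolding combination_zero[symmetric, of \<Delta> k] by (rule combination_supported) simp
next
  fix x y assume "x \<in> supported_sections \<Delta> k S" "y \<in> supported_sections \<Delta> k S"
  then obtain c d where "x = combination \<Delta> k c" "y = combination \<Delta> k d" "\<forall>u. u \<notin> S \<longrightarrow> c u = 0" "\<forall>u. u \<notin> S
      \<longrightarrow> d u = 0"
    unfolding supported_sections_def by blast
  thus "x + y \<in> supported_sections \<Delta> k S"
    by (simp only: combination_add) (rule combination_supported, simp)
next
  fix a x assume "x \<in> supported_sections \<Delta> k S"
  then obtain c where "x = combination \<Delta> k c" "\<forall>u. u \<notin> S \<longrightarrow> c u = 0"
    unfolding supported_sections_def by blast
  thus "scale_coeffs a x \<in> supported_sections \<Delta> k S"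
    by (simp only: combination_scale) (rule combination_supported, simp)
qed

lemma inj_scaled_monomials:
  assumes "finite (weights \<Delta> k)" "charts \<Delta> \<noteq> {}" "\<And>u. u \<in> weights \<Delta> k \<Longrightarrow> d u \<noteq> 0"
  shows "inj_on (\<lambda>u. scale_coeffs (d u) (monomial_section \<Delta> k u)) (weights \<Delta> k)"
proof (rule inj_onI)
  fix u v assume uv: "u \<in> weights \<Delta> k" "v \<in> weights \<Delta> k"
    "scale_coeffs (d u) (monomial_section \<Delta> k u) = scale_coeffs (d v) (monomial_section \<Delta> k v)"
  hence "combination \<Delta> k (\<lambda>w. if w = u then d u else 0) = combination \<Delta> k (\<lambda>w. if w = v then d v else 0)"
    using assms(1) by (simp add: scale_monomial_section)
  from combination_eq_iff[OF assms(1,2), THEN iffD1, OF this, THEN bspec, OF uv(1)]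
  have "(if u = u then d u else 0) = (if u = v then d v else 0)" .
  thus "u = v" using assms(3)[OF uv(1)] by (auto split: if_splits)
qed

lemma basis_of_scaled_monomials:
  assumes fin: "finite (weights \<Delta> k)" and ne: "charts \<Delta> \<noteq> {}" and S: "S \<subseteq> weights \<Delta> k"
    and d: "\<And>u. u \<in> weights \<Delta> k \<Longrightarrow> d u \<noteq> 0"
  shows "basis_of ((\<lambda>u. scale_coeffs (d u) (monomial_section \<Delta> k u)) ` S) (supported_sections \<Delta> k S)"
proof -
  let ?f = "\<lambda>u. scale_coeffs (d u) (monomial_section \<Delta> k u)"
  have finS: "finite S" using fin S finite_subset by blast
  have inj: "inj_on ?f S" by (rule inj_on_subset[OF inj_scaled_monomials[OF fin ne d] S])
  have sum_f: "(\<Sum>v\<in>?f ` S. scale_coeffs (a v) v) = combination \<Delta> k (\<lambda>u. if u \<in> S then a (?f u) * d u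
      else 0)" for a
  proof -
    have "(\<Sum>v\<in>?f ` S. scale_coeffs (a v) v) = (\<Sum>u\<in>S. scale_coeffs (a (?f u)) (?f u))"
      by (simp add: sum.reindex[OF inj])
    also have "\<dots> = (\<Sum>u\<in>S. scale_coeffs (if u \<in> S then a (?f u) * d u else 0) (monomial_section \<Delta> k u))"
      by (intro sum.cong refl) simp
    finally show ?thesis
      by (subst combination_as_sum[OF fin S]) auto
  qed
  have "coeffs.independent (?f ` S)"
  proof
    assume "coeffs.dependent (?f ` S)"
    then obtain a v where a: "v \<in> ?f ` S" "a v \<noteq> 0" "(\<Sum>v\<in>?f ` S. scale_coeffs (a v) v) = 0"
      using coeffs.dependent_finite[of "?f ` S"] finS by auto
    from a(1) obtain u where u: "u \<in> S" "v = ?f u" by blast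
    have "combination \<Delta> k (\<lambda>u. if u \<in> S then a (?f u) * d u else 0) = combination \<Delta> k (\<lambda>u. 0)"
      using a(3) unfolding sum_f combination_zero .
    from combination_eq_iff[OF fin ne, THEN iffD1, OF this, THEN bspec, of u]
    have "(if u \<in> S then a (?f u) * d u else 0) = 0" using u(1) S by (simp add: subset_iff)
    thus False using u a(2) d S by auto
  qed
  moreover have "coeffs.span (?f ` S) = supported_sections \<Delta> k S"
  proof
    have "?f u \<in> supported_sections \<Delta> k S" if "u \<in> S" for u
      using that S fin by (auto simp: scale_monomial_section subset_iff intro!: combination_supported)
    thus "coeffs.span (?f ` S) \<subseteq> supported_sections \<Delta> k S"
      by (intro coeffs.span_minimal subspace_supported_sections) blast
    show "supported_sections \<Delta> k S \<subseteq> coeffs.span (?f ` S)"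
    proof
      fix x assume "x \<in> supported_sections \<Delta> k S"
      then obtain c where c: "x = combination \<Delta> k c" "\<And>u. u \<notin> S \<Longrightarrow> c u = 0"
        unfolding supported_sections_def by blast
      have "scale_coeffs (c u) (monomial_section \<Delta> k u) \<in> coeffs.span (?f ` S)" if "u \<in> S" for u
      proof -
        have eq: "scale_coeffs (c u) (monomial_section \<Delta> k u) = scale_coeffs (c u / d u) (?f u)"
          using d that S by auto
        show ?thesis unfolding eq by (intro coeffs.span_scale coeffs.span_base imageI that)
      qed
      thus "x \<in> coeffs.span (?f ` S)"
        unfolding c(1) by (subst combination_as_sum[OF fin S]) (auto intro: c(2) coeffs.span_sum)
    qed
  qed
  ultimately show ?thesis using finS by (simp add: basis_of_def)
qed

lemma H0_eq_supported:
  assumes "finite (weights \<Delta> k)" "charts \<Delta> \<noteq> {}"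
  shows "H0 \<Delta> k = supported_sections \<Delta> k (weights \<Delta> k)"
proof
  show "H0 \<Delta> k \<subseteq> supported_sections \<Delta> k (weights \<Delta> k)"
  proof
    fix s assume "s \<in> H0 \<Delta> k"
    then obtain c where "s = combination \<Delta> k c" using H0_combination[OF assms] by blast
    also have "\<dots> = combination \<Delta> k (\<lambda>u. if u \<in> weights \<Delta> k then c u else 0)"
      by (simp add: combination_def)
    also have "\<dots> \<in> supported_sections \<Delta> k (weights \<Delta> k)" by (rule combination_supported) simp
    finally show "s \<in> supported_sections \<Delta> k (weights \<Delta> k)" .
  qed
qed (auto simp: supported_sections_def combination_H0[OF assms(1)])

text \<open>
  The image section is determined on the torus, on which \<open>g\<close> acts bijectively.
\<close>

lemma pushes_to_unique:
  assumes "invertible A" "t \<in> ctorus" "charts \<Delta> \<noteq> {}" "s1 \<in> H0 \<Delta> k" "s2 \<in> H0 \<Delta> k"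
    "pushes_to \<Delta> k (toric_act A t) s s1" "pushes_to \<Delta> k (toric_act A t) s s2"
  shows "s1 = s2"
proof (rule section_eqI)
  fix B and y :: "complex ^ 'a" assume B: "B \<in> charts \<Delta>" and y: "y \<in> ctorus"
  obtain x where x: "x \<in> ctorus" "torus_act A t x = y" using torus_act_surj[OF assms(1,2) y] by blast
  show "torus_function k s1 B y = torus_function k s2 B y"
    using torus_function_pushforward[OF assms(6,1,2) x(1) B B] torus_function_pushforward[OF
        assms(7,1,2) x(1) B B]
    by (simp add: x(2))
qed (use assms(4,5) isCont_H0[OF assms(4)] isCont_H0[OF assms(5)] in \<open>auto simp: H0_def\<close>)

section \<open>Pointwise norms of sections\<close>

lemma norm_sq_chart_point:
  assumes h: "continuous_hermitian_metric \<Delta> k h" and s: "s \<in> H0 \<Delta> k" and B: "B \<in> charts \<Delta>"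
  shows "norm_sq \<Delta> h s (chart_point B z) = (cmod (s B z))\<^sup>2 * h B z"
proof -
  define x where "x = chart_point B z"
  define B0 where "B0 = (SOME B. B \<in> charts \<Delta> \<and> x \<in> range (chart_point B))"
  define z0 where "z0 = chart_coords B0 x"
  have B0: "B0 \<in> charts \<Delta> \<and> x \<in> range (chart_point B0)"
    unfolding B0_def by (rule someI[of _ B]) (simp add: x_def B)
  hence "chart_point B0 z0 = x" by (simp add: z0_def chart_coords_def f_inv_into_f)
  hence eq: "id (chart_point B z) = chart_point B0 z0" by (simp add: x_def)
  have "s B0 z0 = local_jacobian B B0 id z ^ k * s B z"
    using s B B0 eq unfolding H0_def pushes_to_def by blast
  moreover have "h B z = (cmod (local_jacobian B B0 id z ^ k))\<^sup>2 * h B0 z0"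
    using h B B0 eq unfolding continuous_hermitian_metric_def isometry_coeffs_def by blast
  moreover have "norm_sq \<Delta> h s x = (cmod (s B0 z0))\<^sup>2 * h B0 z0"
    by (simp add: norm_sq_def B0_def[symmetric] z0_def Let_def)
  ultimately show ?thesis
    by (simp add: x_def[symmetric] norm_mult power_mult_distrib)
qed

lemma norm_sq_equivariant:
  assumes h: "continuous_hermitian_metric \<Delta> k h" and s: "s \<in> H0 \<Delta> k" "s' \<in> H0 \<Delta> k"
    and g: "isometry_coeffs \<Delta> k g h" "pushes_to \<Delta> k g s s'"
    and x: "x \<in> toric_variety \<Delta>" "g x \<in> toric_variety \<Delta>"
  shows "norm_sq \<Delta> h s' (g x) = norm_sq \<Delta> h s x"
proof -
  obtain B z where B: "B \<in> charts \<Delta>" "x = chart_point B z" using x by (auto simp: toric_variety_def)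
  obtain B' w where B': "B' \<in> charts \<Delta>" "g x = chart_point B' w" using x by (auto simp: toric_variety_def)
  have eq: "g (chart_point B z) = chart_point B' w" using B B' by simp
  have "s' B' w = local_jacobian B B' g z ^ k * s B z"
    using g(2) B(1) B'(1) eq unfolding pushes_to_def by blast
  moreover have "h B z = (cmod (local_jacobian B B' g z ^ k))\<^sup>2 * h B' w"
    using g(1) B(1) B'(1) eq unfolding isometry_coeffs_def by blast
  ultimately show ?thesis
    using norm_sq_chart_point[OF h s(1) B(1), of z] norm_sq_chart_point[OF h s(2) B'(1), of w]
    by (simp add: B(2)[symmetric] B'(2)[symmetric] norm_mult power_mult_distrib)
qed

lemma norm_sq_scale: "norm_sq \<Delta> h (scale_coeffs a s) x = (cmod a)\<^sup>2 * norm_sq \<Delta> h s x"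
  by (simp add: norm_sq_def scale_coeffs_def Let_def norm_mult power_mult_distrib)

lemma monomial_section_H0:
  assumes "finite (weights \<Delta> k)" "u \<in> weights \<Delta> k"
  shows "monomial_section \<Delta> k u \<in> H0 \<Delta> k"
  using scale_monomial_section[OF assms, of 1] combination_H0[OF assms(1)] by simp

lemma norm_sq_monomial_equivariant:
  assumes fano: "toric_fano \<Delta>" and k: "k \<ge> 1" and A: "A \<in> carrier (Aut_polytope (anticanonical_polytope \<Delta>))"
    and t: "t \<in> compact_torus" and h: "continuous_hermitian_metric \<Delta> k h" "isometry_coeffs \<Delta> k
        (toric_act A t) h"
    and u: "u \<in> weights \<Delta> k" and x: "x \<in> toric_variety \<Delta>"
  shows "norm_sq \<Delta> h (monomial_section \<Delta> k (A *v u)) (toric_act A t x) = norm_sq \<Delta> h (monomial_section \<Delta> k u) x"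
proof -
  have sc: "smooth_fan \<Delta>" "complete_fan \<Delta>" using fano by (auto simp: toric_fano_def)
  have inv: "invertible A" using A by (simp add: Aut_polytope_def)
  note fin = finite_weights[OF sc, of k]
  have t': "t \<in> ctorus" using t compact_torus_subset by blast
  have Au: "A *v u \<in> weights \<Delta> k" by (rule weights_Aut[OF sc k A u])
  define a where "a = of_int (det A) ^ k * chi (- (A *v u)) t"
  have na: "cmod a = 1" using det_unimodular[OF inv] norm_chi[OF t] by (auto simp: a_def norm_mult norm_power)
  have iff: "matrix_inv A *v v = u \<longleftrightarrow> v = A *v u" for v
    using matrix_inv_cancel_vector[OF inv] by metis
  have "pushes_to \<Delta> k (toric_act A t) (combination \<Delta> k (\<lambda>v. if v = u then 1 else 0))
    (combination \<Delta> k (\<lambda>v. of_int (det A) ^ k * chi (- v) t * (if matrix_inv A *v v = u then 1 else 0)))"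
    by (rule pushes_to_combination[OF inv t' fin bij_weights_Aut[OF sc k A]])
  also have "(\<lambda>v. of_int (det A) ^ k * chi (- v) t * (if matrix_inv A *v v = u then 1 else 0)) =
    (\<lambda>v. if v = A *v u then a else 0)" by (auto simp: iff a_def)
  finally have "pushes_to \<Delta> k (toric_act A t) (monomial_section \<Delta> k u) (scale_coeffs a (monomial_section
      \<Delta> k (A *v u)))"
    using scale_monomial_section[OF fin u, of 1] scale_monomial_section[OF fin Au, of a] by simp
  hence "norm_sq \<Delta> h (scale_coeffs a (monomial_section \<Delta> k (A *v u))) (toric_act A t x) =
    norm_sq \<Delta> h (monomial_section \<Delta> k u) x"
    using norm_sq_equivariant[OF h(1) _ _ h(2) _ x toric_act_variety[OF fano A t' x]]
      monomial_section_H0[OF fin u] combination_H0[OF fin] scale_monomial_section[OF fin Au, of a] by metis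
  thus ?thesis by (simp add: norm_sq_scale na)
qed

lemma Aut_polytope_one: "mat 1 \<in> carrier (Aut_polytope P)"
proof -
  have "real_mat (mat 1 :: int ^ 'a ^ 'a) = mat 1" by (simp add: real_mat_def mat_def vec_eq_iff)
  thus ?thesis by (auto simp: Aut_polytope_def invertible_def intro: exI[of _ "mat 1"])
qed

lemma norm_sq_torus_translate:
  assumes fano: "toric_fano \<Delta>" and k: "k \<ge> 1" and t: "t \<in> compact_torus"
    and h: "continuous_hermitian_metric \<Delta> k h" "isometry_coeffs \<Delta> k (toric_act (mat 1) t) h"
    and x: "x \<in> toric_variety \<Delta>"
  shows "norm_sq \<Delta> h (combination \<Delta> k c) (toric_act (mat 1) t x) =
    norm_sq \<Delta> h (combination \<Delta> k (\<lambda>u. chi u t * c u)) x"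
proof -
  have sc: "smooth_fan \<Delta>" "complete_fan \<Delta>" using fano by (auto simp: toric_fano_def)
  note fin = finite_weights[OF sc, of k]
  have t': "t \<in> ctorus" using t compact_torus_subset by blast
  have inv: "invertible (mat 1 :: int ^ 'a ^ 'a)" by (auto simp: invertible_def intro: exI[of _ "mat 1"])
  have "pushes_to \<Delta> k (toric_act (mat 1) t) (combination \<Delta> k (\<lambda>u. chi u t * c u))
    (combination \<Delta> k (\<lambda>u. of_int (det (mat 1 :: int ^ 'a ^ 'a)) ^ k * chi (- u) t * (chi (matrix_inv
        (mat 1) *v u) t * c (matrix_inv (mat 1) *v u))))"
    by (rule pushes_to_combination[OF inv t' fin bij_weights_Aut[OF sc k Aut_polytope_one]])
  also have "(\<lambda>u. of_int (det (mat 1 :: int ^ 'a ^ 'a)) ^ k * chi (- u) t * (chi (matrix_inv (mat 1) *v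
      u) t * c (matrix_inv (mat 1) *v u))) = c"
    using chi_nonzero[OF t'] by (simp add: fun_eq_iff chi_minus)
  finally show ?thesis
    using norm_sq_equivariant[OF h(1) combination_H0[OF fin] combination_H0[OF fin] h(2) _ x
        toric_act_variety[OF fano Aut_polytope_one t' x]]
    by blast
qed

text \<open>
  Replacing an invariant function by its average over torsion points leaves it unchanged, and by
  Parseval's identity the average has no mixed terms.
\<close>

lemma invariant_form_diagonal:
  assumes fano: "toric_fano \<Delta>" and k: "k \<ge> 1" and h: "continuous_hermitian_metric \<Delta> k h"
    "\<And>t. t \<in> compact_torus \<Longrightarrow> isometry_coeffs \<Delta> k (toric_act (mat 1) t) h"
    and inv: "\<And>t x. t \<in> compact_torus \<Longrightarrow> x \<in> toric_variety \<Delta> \<Longrightarrow>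
      (\<Sum>s\<in>S. norm_sq \<Delta> h (combination \<Delta> k (c s)) (toric_act (mat 1) t x)) =
      (\<Sum>s\<in>S. norm_sq \<Delta> h (combination \<Delta> k (c s)) x)"
    and x: "x \<in> toric_variety \<Delta>"
  shows "(\<Sum>s\<in>S. norm_sq \<Delta> h (combination \<Delta> k (c s)) x) =
    (\<Sum>u\<in>weights \<Delta> k. (\<Sum>s\<in>S. (cmod (c s u))\<^sup>2) * norm_sq \<Delta> h (monomial_section \<Delta> k u) x)"
proof -
  have sc: "smooth_fan \<Delta>" "complete_fan \<Delta>" using fano by (auto simp: toric_fano_def)
  note fin = finite_weights[OF sc, of k]
  obtain B z where B: "B \<in> charts \<Delta>" "x = chart_point B z" using x by (auto simp: toric_variety_def)
  obtain G where G: "finite G" "G \<noteq> {}" "G \<subseteq> compact_torus"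
    "\<And>b. (\<Sum>t\<in>G. (cmod (\<Sum>l\<in>weights \<Delta> k. b l * chi l t))\<^sup>2) = real (card G) * (\<Sum>l\<in>weights \<Delta> k. (cmod (b l))\<^sup>2)"
    by (rule laurent_coefficient_average[OF fin]) blast
  have cG: "real (card G) \<noteq> 0" using G by simp
  have val: "norm_sq \<Delta> h (combination \<Delta> k d) x = (cmod (\<Sum>u\<in>weights \<Delta> k. d u * monomial_section \<Delta> k u B
      z))\<^sup>2 * h B z" for d
    unfolding B(2) norm_sq_chart_point[OF h(1) combination_H0[OF fin] B(1)] by (simp add: combination_def)
  have avg: "(\<Sum>t\<in>G. norm_sq \<Delta> h (combination \<Delta> k (c s)) (toric_act (mat 1) t x)) =
    real (card G) * (\<Sum>u\<in>weights \<Delta> k. (cmod (c s u))\<^sup>2 * norm_sq \<Delta> h (monomial_section \<Delta> k u) x)" for s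
  proof -
    have "(\<Sum>t\<in>G. norm_sq \<Delta> h (combination \<Delta> k (c s)) (toric_act (mat 1) t x)) =
      (\<Sum>t\<in>G. (cmod (\<Sum>u\<in>weights \<Delta> k. (c s u * monomial_section \<Delta> k u B z) * chi u t))\<^sup>2 * h B z)"
    proof (rule sum.cong)
      fix t assume "t \<in> G"
      hence t: "t \<in> compact_torus" using G by blast
      have eq: "norm_sq \<Delta> h (combination \<Delta> k (c s)) (toric_act (mat 1) t x) =
        norm_sq \<Delta> h (combination \<Delta> k (\<lambda>u. chi u t * c s u)) x"
        by (rule norm_sq_torus_translate[OF fano k t h(1) h(2)[OF t] x])
      show "norm_sq \<Delta> h (combination \<Delta> k (c s)) (toric_act (mat 1) t x) =
        (cmod (\<Sum>u\<in>weights \<Delta> k. (c s u * monomial_section \<Delta> k u B z) * chi u t))\<^sup>2 * h B z"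
        unfolding eq val by (simp add: mult_ac)
    qed simp
    also have "\<dots> = real (card G) * (\<Sum>u\<in>weights \<Delta> k. (cmod (c s u * monomial_section \<Delta> k u B z))\<^sup>2) * h B z"
      by (simp only: sum_distrib_right[symmetric] G(4))
    also have "\<dots> = real (card G) * (\<Sum>u\<in>weights \<Delta> k. (cmod (c s u))\<^sup>2 * norm_sq \<Delta> h (monomial_section \<Delta> k u) x)"
      by (simp add: B(2) norm_sq_chart_point[OF h(1) monomial_section_H0[OF fin] B(1)] norm_mult
          power_mult_distrib
          sum_distrib_left sum_distrib_right mult_ac)
    finally show ?thesis .
  qed
  have "real (card G) * (\<Sum>s\<in>S. norm_sq \<Delta> h (combination \<Delta> k (c s)) x) =
    (\<Sum>t\<in>G. \<Sum>s\<in>S. norm_sq \<Delta> h (combination \<Delta> k (c s)) (toric_act (mat 1) t x))"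
  proof -
    have "(\<Sum>t\<in>G. \<Sum>s\<in>S. norm_sq \<Delta> h (combination \<Delta> k (c s)) (toric_act (mat 1) t x)) =
      (\<Sum>t\<in>G. \<Sum>s\<in>S. norm_sq \<Delta> h (combination \<Delta> k (c s)) x)"
      by (rule sum.cong[OF refl]) (use G(3) inv[OF _ x] in blast)
    thus ?thesis by simp
  qed
  also have "\<dots> = real (card G) * (\<Sum>s\<in>S. \<Sum>u\<in>weights \<Delta> k. (cmod (c s u))\<^sup>2 * norm_sq \<Delta> h (monomial_section
      \<Delta> k u) x)"
    by (subst sum.swap) (simp add: avg sum_distrib_left)
  finally have "(\<Sum>s\<in>S. norm_sq \<Delta> h (combination \<Delta> k (c s)) x) =
    (\<Sum>s\<in>S. \<Sum>u\<in>weights \<Delta> k. (cmod (c s u))\<^sup>2 * norm_sq \<Delta> h (monomial_section \<Delta> k u) x)"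
    using cG by simp
  also have "\<dots> = (\<Sum>u\<in>weights \<Delta> k. (\<Sum>s\<in>S. (cmod (c s u))\<^sup>2) * norm_sq \<Delta> h (monomial_section \<Delta> k u) x)"
    by (subst sum.swap) (simp add: sum_distrib_right)
  finally show ?thesis .
qed

section \<open>Compactness of the toric manifold\<close>

lemma torus_point_variety: "charts \<Delta> \<noteq> {} \<Longrightarrow> x \<in> ctorus \<Longrightarrow> torus_point x \<in> toric_variety \<Delta>"
  by (auto simp: toric_variety_def chart_point_torus_coords[OF charts_invertible, symmetric])

text \<open>
  The function and its maximum with \<open>C\<close> are continuous and the torus is dense.
\<close>

lemma bounded_by_torus:
  fixes F :: "('n :: finite) toric_point \<Rightarrow> real"
  assumes "\<And>B z. B \<in> charts \<Delta> \<Longrightarrow> isCont (\<lambda>z. F (chart_point B z)) z"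
    and "\<And>x. x \<in> ctorus \<Longrightarrow> F (torus_point x) \<le> C" and "x \<in> toric_variety \<Delta>"
  shows "F x \<le> C"
proof -
  obtain B z where B: "B \<in> charts \<Delta>" "x = chart_point B z" using assms(3) by (auto simp: toric_variety_def)
  have inv: "invertible B" using B charts_invertible by blast
  have "max (F (chart_point B z)) C = C"
  proof (rule eq_on_ctorus_isCont[where f = "\<lambda>z. max (F (chart_point B z)) C"])
    show "isCont (\<lambda>z. max (F (chart_point B z)) C) z" by (intro continuous_max assms(1) B(1) continuous_const)
    fix z' :: "complex ^ 'n" assume "z' \<in> ctorus"
    then obtain y where "y \<in> ctorus" "z' = torus_coords B y" using torus_coords_surj[OF inv] by blast
    thus "max (F (chart_point B z')) C = C" using assms(2) inv by (simp add: chart_point_torus_coords)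
  qed simp
  thus ?thesis using B by simp
qed

definition polydisc :: "(complex ^ 'n) set"
  where "polydisc = {z. \<forall>i. cmod (z $ i) \<le> 1}"

lemma compact_polydisc: "compact (polydisc :: (complex ^ 'n) set)"
proof -
  have "polydisc = (\<Inter>i. {z :: complex ^ 'n. cmod (z $ i) \<le> 1})" by (auto simp: polydisc_def)
  moreover have "closed {z :: complex ^ 'n. cmod (z $ i) \<le> 1}" for i
    by (intro closed_Collect_le continuous_intros)
  ultimately have "closed (polydisc :: (complex ^ 'n) set)" by (metis (no_types, lifting) closed_INT)
  moreover have "bounded (polydisc :: (complex ^ 'n) set)"
  proof (rule boundedI)
    fix z :: "complex ^ 'n" assume z: "z \<in> polydisc"
    have "norm z \<le> (\<Sum>i\<in>UNIV. cmod (z $ i))" unfolding norm_vec_def by (intro L2_set_le_sum) auto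
    also have "\<dots> \<le> (\<Sum>i\<in>(UNIV :: 'n set). 1)" using z by (intro sum_mono) (auto simp: polydisc_def)
    finally show "norm z \<le> real CARD('n)" by simp
  qed
  ultimately show ?thesis by (simp add: compact_eq_bounded_closed)
qed

lemma norm_chi_exp:
  assumes "x \<in> ctorus"
  shows "cmod (chi u x) = exp ((\<chi> i. ln (cmod (x $ i))) \<bullet> real_vec u)"
proof -
  have "cmod (chi u x) = (\<Prod>i\<in>UNIV. exp (ln (cmod (x $ i)) * of_int (u $ i)))"
    unfolding chi_def prod_norm[symmetric]
  proof (rule prod.cong)
    fix i
    have "x $ i \<noteq> 0" using assms by (simp add: ctorus_def)
    hence "cmod (x $ i) = exp (ln (cmod (x $ i)))" by simp
    thus "cmod (x $ i powi u $ i) = exp (ln (cmod (x $ i)) * of_int (u $ i))"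
      unfolding norm_power_int by (metis exp_power_int mult.commute)
  qed simp
  thus ?thesis by (simp add: exp_sum inner_vec_def real_vec_def)
qed

text \<open>
  The vector \<open>-log |x|\<close> lies in the cone of some chart, and its coordinates with respect to the
  rows of that chart are minus the logarithms of the absolute values of the chart coordinates of
  \<open>x\<close>. Charts which differ by the order of the rows have the same cone, so finitely many suffice.
\<close>

lemma torus_polydisc_cover:
  fixes \<Delta> :: "(real ^ 'n) set set"
  assumes "smooth_fan \<Delta>" "complete_fan \<Delta>"
  obtains R where "finite R" "R \<subseteq> charts \<Delta>"
    "\<And>x. x \<in> ctorus \<Longrightarrow> \<exists>B\<in>R. torus_coords B x \<in> polydisc"
proof -
  obtain R where R: "finite R" "R \<subseteq> charts \<Delta>" "chart_cone ` charts \<Delta> = chart_cone ` R"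
    using finite_subset_image[OF finite_chart_cones[OF assms(2)] subset_refl] by metis
  have "\<exists>B\<in>R. torus_coords B x \<in> polydisc" if x: "x \<in> ctorus" for x
  proof -
    define v where "v = - (\<chi> i. ln (cmod (x $ i)))"
    obtain B0 where "B0 \<in> charts \<Delta>" "v \<in> chart_cone B0" using chart_cover[OF assms] by blast
    then obtain B where B: "B \<in> R" "v \<in> chart_cone B" using R(3) by (metis imageE imageI)
    have inv: "invertible B" using B R charts_invertible by blast
    have "cmod (torus_coords B x $ j) \<le> 1" for j
    proof -
      have "torus_coords B x $ j = chi (matrix_inv B *v axis j 1) x"
        by (simp add: torus_coords_def monomial_map_def matrix_vector_mult_axis)
      hence "cmod (torus_coords B x $ j) = exp (- (v \<bullet> dual_basis B j))"
        by (simp add: norm_chi_exp[OF x] v_def dual_basis_def)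
      thus ?thesis using B(2) by (simp add: chart_cone_eq[OF inv])
    qed
    thus ?thesis using B(1) by (auto simp: polydisc_def)
  qed
  thus ?thesis using R that by blast
qed

lemma continuous_function_bounded:
  fixes F :: "('n :: finite) toric_point \<Rightarrow> real"
  assumes sc: "smooth_fan \<Delta>" "complete_fan \<Delta>"
    and cont: "\<And>B z. B \<in> charts \<Delta> \<Longrightarrow> isCont (\<lambda>z. F (chart_point B z)) z"
  obtains C where "\<And>x. x \<in> toric_variety \<Delta> \<Longrightarrow> F x \<le> C"
proof -
  obtain R where R: "finite R" "R \<subseteq> charts \<Delta>"
    "\<And>x. x \<in> ctorus \<Longrightarrow> \<exists>B\<in>R. torus_coords B x \<in> polydisc"
    using torus_polydisc_cover[OF sc] by blast
  have "\<exists>C. \<forall>z\<in>polydisc. F (chart_point B z) \<le> C" if "B \<in> R" for B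
  proof -
    have "continuous_on polydisc (\<lambda>z. F (chart_point B z))"
      using cont that R(2) by (intro continuous_at_imp_continuous_on) blast
    hence "bounded ((\<lambda>z. F (chart_point B z)) ` polydisc)"
      by (intro compact_imp_bounded compact_continuous_image compact_polydisc)
    thus ?thesis unfolding bounded_iff by (metis abs_le_D1 imageI real_norm_def)
  qed
  then obtain C where C: "\<And>B z. B \<in> R \<Longrightarrow> z \<in> polydisc \<Longrightarrow> F (chart_point B z) \<le> C B" by metis
  have "F (torus_point x) \<le> (\<Sum>B\<in>R. \<bar>C B\<bar>)" if x: "x \<in> ctorus" for x
  proof -
    obtain B where B: "B \<in> R" "torus_coords B x \<in> polydisc" using R(3)[OF x] by blast
    have "F (torus_point x) \<le> C B"
      using C[OF B] chart_point_torus_coords[OF charts_invertible x] B R(2) by (metis subsetD)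
    also have "\<dots> \<le> \<bar>C B\<bar>" by simp
    also have "\<dots> \<le> (\<Sum>B\<in>R. \<bar>C B\<bar>)" using B(1) R(1) by (intro member_le_sum) auto
    finally show ?thesis .
  qed
  from bounded_by_torus[OF cont this] show ?thesis using that by blast
qed

section \<open>Integration on the toric manifold\<close>

definition open_orbit :: "'n::finite toric_point set"
  where "open_orbit = torus_point ` ctorus"

lemma open_ctorus: "open (ctorus :: (complex ^ 'n) set)"
proof -
  have "ctorus = (\<Inter>i. {z :: complex ^ 'n. z $ i \<noteq> 0})" by (auto simp: ctorus_def)
  moreover have "open {z :: complex ^ 'n. z $ i \<noteq> 0}" for i
    by (intro open_Collect_neq continuous_intros)
  ultimately show ?thesis by (metis (no_types, lifting) open_INT finite UNIV_I)
qed

lemma ctorus_borel: "(ctorus :: (complex ^ 'n) set) \<in> sets borel"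
  by (rule borel_open[OF open_ctorus])

lemma ctorus_complement_null: "- ctorus \<in> null_sets (lborel :: (complex ^ 'n) measure)"
proof -
  have sub: "- ctorus \<subseteq> (\<Union>i\<in>UNIV. {z :: complex ^ 'n. axis i 1 \<bullet> z = 0})"
    by (auto simp: ctorus_def inner_axis' inner_complex_def) (metis zero_complex.sel(1))
  have "negligible (\<Union>i\<in>UNIV. {z :: complex ^ 'n. axis i 1 \<bullet> z = 0})"
    by (intro negligible_Union finite_imageI) (auto intro!: negligible_hyperplane simp: axis_eq_0_iff)
  hence "negligible (- ctorus :: (complex ^ 'n) set)" using sub negligible_subset by blast
  moreover have "- ctorus \<in> sets (lborel :: (complex ^ 'n) measure)"
    using borel_comp[OF ctorus_borel] by simp
  ultimately show ?thesis
    by (metis negligible_iff_null_sets null_sets_completion_iff)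
qed

lemma chart_point_mem_open_orbit:
  assumes "invertible B"
  shows "chart_point B z \<in> open_orbit \<longleftrightarrow> z \<in> ctorus"
proof
  assume "chart_point B z \<in> open_orbit"
  then obtain x where "x \<in> ctorus" "chart_point B z = torus_point x" by (auto simp: open_orbit_def)
  hence "chart_point B z = chart_point B (torus_coords B x)" using assms by (simp add: chart_point_torus_coords)
  hence "z = torus_coords B x" using inj_chart_point[OF assms] by (simp add: inj_def)
  thus "z \<in> ctorus" using \<open>x \<in> ctorus\<close> by (simp add: torus_coords_ctorus)
next
  assume "z \<in> ctorus"
  then obtain x where "x \<in> ctorus" "z = torus_coords B x" using torus_coords_surj[OF assms] by blast
  thus "chart_point B z \<in> open_orbit" using assms by (simp add: chart_point_torus_coords open_orbit_def)
qed

lemma open_orbit_chart: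
  fixes B :: "int ^ 'n ^ 'n"
  assumes inv: "invertible B"
  shows "open_orbit = chart_point B ` ctorus"
proof (intro equalityI subsetI)
  fix y :: "'n toric_point" assume "y \<in> open_orbit"
  then obtain x where "x \<in> ctorus" "y = torus_point x" by (auto simp: open_orbit_def)
  hence "y = chart_point B (torus_coords B x)" "torus_coords B x \<in> ctorus"
    using inv by (simp_all add: chart_point_torus_coords torus_coords_ctorus)
  thus "y \<in> chart_point B ` ctorus" by blast
qed (use chart_point_mem_open_orbit[OF inv] in blast)

lemma chart_point_variety: "B \<in> charts \<Delta> \<Longrightarrow> chart_point B z \<in> toric_variety \<Delta>"
  by (auto simp: toric_variety_def)

text \<open>
  By \<open>glued_charts\<close> the overlap of two charts is stable under making vanishing coordinates
  nonzero.
\<close>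

lemma open_chart_overlap:
  assumes "B \<in> charts \<Delta>" "B' \<in> charts \<Delta>"
  shows "open (chart_point B' -` range (chart_point B))"
proof -
  have inv: "invertible B" "invertible B'" using assms charts_invertible by auto
  have inv1: "invertible (mat 1 :: int ^ 'a ^ 'a)" by (auto simp: invertible_def intro: exI[of _ "mat 1"])
  have "\<exists>T. open T \<and> z \<in> T \<and> T \<subseteq> chart_point B' -` range (chart_point B)"
    if z: "z \<in> chart_point B' -` range (chart_point B)" for z
  proof (intro exI conjI)
    obtain w where "chart_point B' z = chart_point B w" using z by auto
    hence glue: "toric_act (mat 1) (\<chi> i. 1) (chart_point B' z) = chart_point B w"
      by (simp add: toric_act_id)
    let ?T = "\<Inter>i\<in>{i. z $ i \<noteq> 0}. {z' :: complex ^ 'a. z' $ i \<noteq> 0}"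
    show "open ?T" by (intro open_INT ballI open_Collect_neq continuous_intros) simp
    show "z \<in> ?T" by simp
    show "?T \<subseteq> chart_point B' -` range (chart_point B)"
    proof
      fix z' assume "z' \<in> ?T"
      hence "z' $ i = 0 \<Longrightarrow> z $ i = 0" for i by auto
      from glued_charts(3)[OF inv1 inv(2,1) ones_ctorus glue this]
      show "z' \<in> chart_point B' -` range (chart_point B)" by (simp add: toric_act_id)
    qed
  qed
  thus ?thesis by (subst open_subopen) blast
qed

text \<open>
  The chart densities appear only existentially in a volume form; naming them lets the constants
  below refer to them.
\<close>

definition has_densities ::
    "(real ^ 'n) set set \<Rightarrow> 'n toric_point measure \<Rightarrow> (int ^ 'n ^ 'n \<Rightarrow> complex ^ 'n \<Rightarrow> real) \<Rightarrow> bool"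
  where "has_densities \<Delta> \<mu> \<rho> \<longleftrightarrow> space \<mu> = toric_variety \<Delta> \<and> sets \<mu> = borel_sets \<Delta> \<and>
    (\<forall>B\<in>charts \<Delta>. continuous_on UNIV (\<rho> B) \<and> (\<forall>z. \<rho> B z > 0) \<and>
       (\<forall>E\<in>sets borel. emeasure \<mu> (chart_point B ` E) = (\<integral>\<^sup>+z\<in>E. ennreal (\<rho> B z) \<partial>lborel)))"

lemma continuous_volume_form_densities:
  "continuous_volume_form \<Delta> \<mu> \<Longrightarrow> \<exists>\<rho>. has_densities \<Delta> \<mu> \<rho>"
  by (auto simp: continuous_volume_form_def has_densities_def)

lemma measurable_toric:
  assumes "has_densities \<Delta> \<mu> \<rho>"
    and "\<And>B. B \<in> charts \<Delta> \<Longrightarrow> (\<lambda>z. F (chart_point B z)) \<in> borel_measurable borel"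
  shows "F \<in> borel_measurable \<mu>"
proof (rule measurableI)
  fix S assume S: "S \<in> sets (borel :: 'b measure)"
  have "chart_point B -` (F -` S \<inter> space \<mu>) \<in> sets borel" if B: "B \<in> charts \<Delta>" for B
  proof -
    have "chart_point B -` (F -` S \<inter> space \<mu>) = (\<lambda>z. F (chart_point B z)) -` S \<inter> space borel"
      using assms(1) chart_point_variety[OF B] by (auto simp: has_densities_def)
    also have "\<dots> \<in> sets borel" by (rule measurable_sets[OF assms(2)[OF B] S])
    finally show ?thesis .
  qed
  thus "F -` S \<inter> space \<mu> \<in> sets \<mu>" using assms(1) by (auto simp: has_densities_def borel_sets_def)
qed simp

lemma chart_point_measurable:
  assumes "has_densities \<Delta> \<mu> \<rho>" "B \<in> charts \<Delta>"
  shows "chart_point B \<in> measurable borel \<mu>"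
  by (rule measurableI) (use assms chart_point_variety in \<open>auto simp: has_densities_def borel_sets_def\<close>)

lemma open_orbit_sets:
  assumes "has_densities \<Delta> \<mu> \<rho>" "charts \<Delta> \<noteq> {}"
  shows "open_orbit \<in> sets \<mu>"
proof -
  have "chart_point B -` open_orbit = ctorus" if "B \<in> charts \<Delta>" for B
    using chart_point_mem_open_orbit[OF charts_invertible[OF that]] by auto
  moreover have "open_orbit \<subseteq> toric_variety \<Delta>"
    using torus_point_variety[OF assms(2)] by (auto simp: open_orbit_def)
  ultimately show ?thesis using assms(1) ctorus_borel by (auto simp: has_densities_def borel_sets_def)
qed

lemma density_measurable:
  assumes "has_densities \<Delta> \<mu> \<rho>" "B \<in> charts \<Delta>"
  shows "\<rho> B \<in> borel_measurable borel"
  using assms by (intro borel_measurable_continuous_onI) (auto simp: has_densities_def)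

text \<open>
  The open orbit lies in every chart and has full measure, so a single chart computes integrals
  over \<open>X\<close>.
\<close>

lemma density_open_orbit:
  assumes hd: "has_densities \<Delta> \<mu> \<rho>" and B: "B \<in> charts \<Delta>"
  shows "density \<mu> (indicator open_orbit) =
    distr (density lborel (\<lambda>z. ennreal (\<rho> B z) * indicator ctorus z)) \<mu> (chart_point B)"
proof (rule measure_eqI)
  fix A assume "A \<in> sets (density \<mu> (indicator open_orbit))"
  hence A: "A \<in> sets \<mu>" by simp
  have inv: "invertible B" using B charts_invertible by blast
  note [measurable] = density_measurable[OF hd B] chart_point_measurable[OF hd B]
  have T[measurable]: "open_orbit \<in> sets \<mu>" using open_orbit_sets[OF hd] B by blast
  have ct[measurable]: "(ctorus :: (complex ^ 'a) set) \<in> sets borel" using ctorus_borel by simp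
  have cp: "chart_point B \<in> measurable lborel \<mu>" using chart_point_measurable[OF hd B] by simp
  have pre: "chart_point B -` A \<in> sets borel" using A hd B by (auto simp: has_densities_def borel_sets_def)
  have "emeasure (density \<mu> (indicator open_orbit)) A = (\<integral>\<^sup>+x\<in>A. indicator open_orbit x \<partial>\<mu>)"
    using A by (subst emeasure_density) auto
  also have "\<dots> = (\<integral>\<^sup>+x. indicator (open_orbit \<inter> A) x \<partial>\<mu>)"
    by (intro nn_integral_cong) (auto simp: indicator_def)
  also have "\<dots> = emeasure \<mu> (open_orbit \<inter> A)" using A by (intro nn_integral_indicator) auto
  also have "open_orbit \<inter> A = chart_point B ` (ctorus \<inter> chart_point B -` A)"
    by (auto simp: open_orbit_chart[OF inv])
  also have "emeasure \<mu> \<dots> = (\<integral>\<^sup>+z\<in>ctorus \<inter> chart_point B -` A. ennreal (\<rho> B z) \<partial>lborel)"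
  proof -
    have "ctorus \<inter> chart_point B -` A \<in> sets borel" using pre ct by blast
    thus ?thesis using hd B unfolding has_densities_def by blast
  qed
  also have "\<dots> = (\<integral>\<^sup>+z. ennreal (\<rho> B z) * indicator ctorus z * indicator (chart_point B -` A) z \<partial>lborel)"
    by (intro nn_integral_cong) (auto simp: indicator_def)
  also have "\<dots> = emeasure (density lborel (\<lambda>z. ennreal (\<rho> B z) * indicator ctorus z)) (chart_point B -` A)"
    using pre by (subst emeasure_density) auto
  also have "\<dots> = emeasure (distr (density lborel (\<lambda>z. ennreal (\<rho> B z) * indicator ctorus z)) \<mu>
      (chart_point B)) A"
    using A cp by (subst emeasure_distr) auto
  finally show "emeasure (density \<mu> (indicator open_orbit)) A =
    emeasure (distr (density lborel (\<lambda>z. ennreal (\<rho> B z) * indicator ctorus z)) \<mu> (chart_point B)) A" .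
qed simp

lemma nn_integral_open_orbit:
  assumes hd: "has_densities \<Delta> \<mu> \<rho>" and B: "B \<in> charts \<Delta>"
    and F: "\<And>B. B \<in> charts \<Delta> \<Longrightarrow> (\<lambda>z. F (chart_point B z)) \<in> borel_measurable borel"
  shows "(\<integral>\<^sup>+x\<in>open_orbit. F x \<partial>\<mu>) = (\<integral>\<^sup>+z\<in>ctorus. F (chart_point B z) * ennreal (\<rho> B z) \<partial>lborel)"
proof -
  note [measurable] = density_measurable[OF hd B] F[OF B] open_orbit_sets[OF hd]
  have T[measurable]: "open_orbit \<in> sets \<mu>" using open_orbit_sets[OF hd] B by blast
  have ct[measurable]: "(ctorus :: (complex ^ 'a) set) \<in> sets borel" using ctorus_borel by simp
  have Fm: "F \<in> borel_measurable \<mu>" by (rule measurable_toric[OF hd F])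
  have cp: "chart_point B \<in> measurable (density lborel (\<lambda>z. ennreal (\<rho> B z) * indicator ctorus z)) \<mu>"
    using chart_point_measurable[OF hd B] by simp
  have "(\<integral>\<^sup>+x\<in>open_orbit. F x \<partial>\<mu>) = (\<integral>\<^sup>+x. F x \<partial>density \<mu> (indicator open_orbit))"
    using Fm by (subst nn_integral_density) (auto simp: mult.commute)
  also have "\<dots> = (\<integral>\<^sup>+z. F (chart_point B z) \<partial>density lborel (\<lambda>z. ennreal (\<rho> B z) * indicator ctorus z))"
    unfolding density_open_orbit[OF hd B] by (rule nn_integral_distr[OF cp]) (simp add: Fm)
  also have "\<dots> = (\<integral>\<^sup>+z. ennreal (\<rho> B z) * indicator ctorus z * F (chart_point B z) \<partial>lborel)"
    by (subst nn_integral_density) auto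
  finally show ?thesis by (simp add: mult_ac)
qed

text \<open>
  In each of the countably many charts the complement of the torus consists of coordinate
  hyperplanes.
\<close>

lemma open_orbit_full_measure:
  assumes hd: "has_densities \<Delta> \<mu> \<rho>" and ne: "charts \<Delta> \<noteq> {}"
  shows "AE x in \<mu>. x \<in> open_orbit"
proof -
  have T: "open_orbit \<in> sets \<mu>" by (rule open_orbit_sets[OF hd ne])
  have null: "chart_point B ` (- ctorus) \<in> null_sets \<mu>" if B: "B \<in> charts \<Delta>" for B
  proof -
    have inv: "invertible B" using B charts_invertible by blast
    have "range (chart_point B) \<in> sets \<mu>"
      using hd B open_chart_overlap[OF B] chart_point_variety[OF B] by (auto simp: has_densities_def
          borel_sets_def)
    moreover have "chart_point B ` (- ctorus) = range (chart_point B) - open_orbit"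
      by (auto simp: chart_point_mem_open_orbit[OF inv])
    ultimately have S: "chart_point B ` (- ctorus) \<in> sets \<mu>" using T by simp
    have "- ctorus \<in> sets (borel :: (complex ^ 'a) measure)" by (rule borel_comp[OF ctorus_borel])
    hence "emeasure \<mu> (chart_point B ` (- ctorus)) = (\<integral>\<^sup>+z\<in>- ctorus. ennreal (\<rho> B z) \<partial>lborel)"
      using hd B unfolding has_densities_def by blast
    also have "\<dots> = 0"
      by (rule nn_integral_null_set[OF ctorus_complement_null])
    finally show ?thesis using S by blast
  qed
  have "countable (charts \<Delta>)" by (rule countableI_type)
  hence "(\<Union>B\<in>charts \<Delta>. chart_point B ` (- ctorus)) \<in> null_sets \<mu>"
    using null by (rule null_sets_UN')
  moreover have "{x \<in> space \<mu>. x \<notin> open_orbit} \<subseteq> (\<Union>B\<in>charts \<Delta>. chart_point B ` (- ctorus))"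
  proof
    fix x assume x: "x \<in> {x \<in> space \<mu>. x \<notin> open_orbit}"
    then obtain B z where B: "B \<in> charts \<Delta>" "x = chart_point B z"
      using hd by (auto simp: has_densities_def toric_variety_def)
    hence "z \<notin> ctorus" using x chart_point_mem_open_orbit[OF charts_invertible[OF B(1)]] by auto
    thus "x \<in> (\<Union>B\<in>charts \<Delta>. chart_point B ` (- ctorus))" using B by blast
  qed
  ultimately show ?thesis by (rule AE_I')
qed

lemma nn_integral_polydiscs:
  fixes \<Delta> :: "(real ^ 'n) set set"
  assumes hd: "has_densities \<Delta> \<mu> \<rho>" and R: "finite R" "R \<subseteq> charts \<Delta>"
    "\<And>x. x \<in> ctorus \<Longrightarrow> \<exists>B\<in>R. torus_coords B x \<in> polydisc"
    and F: "\<And>B. B \<in> charts \<Delta> \<Longrightarrow> (\<lambda>z. F (chart_point B z)) \<in> borel_measurable borel"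
  shows "(\<integral>\<^sup>+x\<in>open_orbit. F x \<partial>\<mu>) \<le>
    (\<Sum>B\<in>R. \<integral>\<^sup>+z\<in>ctorus \<inter> polydisc. F (chart_point B z) * ennreal (\<rho> B z) \<partial>lborel)"
proof -
  have ct: "(ctorus :: (complex ^ 'n) set) \<in> sets borel" using ctorus_borel by simp
  have pd: "(polydisc :: (complex ^ 'n) set) \<in> sets borel" by (rule borel_closed[OF
      compact_imp_closed[OF compact_polydisc]])
  define P where "P B = chart_point B ` (ctorus \<inter> polydisc)" for B :: "int ^ 'n ^ 'n"
  have mono: "(\<lambda>z :: complex ^ 'n. z $ i powi m) \<in> borel_measurable borel" for i m
  proof -
    have "(\<lambda>z :: complex ^ 'n. z $ i) \<in> borel_measurable borel"
      by (intro borel_measurable_continuous_onI continuous_intros)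
    thus ?thesis unfolding power_int_def by measurable
  qed
  have meas_chi: "(\<lambda>z. cmod (chi u z)) \<in> borel_measurable (borel :: (complex ^ 'n) measure)" for u
    unfolding chi_def using mono by measurable
  have pre: "chart_point B' -` P B \<in> sets borel" if B: "B \<in> charts \<Delta>" "B' \<in> charts \<Delta>" for B B'
  proof -
    have inv: "invertible B" "invertible B'" using B charts_invertible by auto
    have "chart_point B' -` P B = ctorus \<inter> (\<Inter>j\<in>UNIV. {z. cmod (chi (B' *v (matrix_inv B *v axis j 1)) z) \<le> 1})"
    proof -
      have "chart_point B' z \<in> P B \<longleftrightarrow> (\<forall>j. cmod (chi (B' *v (matrix_inv B *v axis j 1)) z) \<le> 1)" if z: "z
          \<in> ctorus" for z
      proof -
        obtain x where x: "x \<in> ctorus" "z = torus_coords B' x" using torus_coords_surj[OF inv(2) z] by blast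
        have eq: "chart_point B' z = chart_point B (torus_coords B x)"
          using inv x by (simp add: chart_point_torus_coords)
        have "chart_point B' z \<in> P B \<longleftrightarrow> torus_coords B x \<in> polydisc"
          unfolding eq P_def inj_image_mem_iff[OF inj_chart_point[OF inv(1)]] using x by (simp add:
              torus_coords_ctorus)
        also have "\<dots> \<longleftrightarrow> (\<forall>j. cmod (chi (matrix_inv B *v axis j 1) x) \<le> 1)"
          by (simp add: polydisc_def torus_coords_def monomial_map_def matrix_vector_mult_axis)
        finally show ?thesis using chi_torus_coords[OF inv(2) x(1)] by (simp add: x(2))
      qed
      moreover have "z \<in> ctorus" if "chart_point B' z \<in> P B" for z
      proof -
        have "P B \<subseteq> open_orbit" by (auto simp: P_def chart_point_mem_open_orbit[OF inv(1)])
        thus ?thesis using that chart_point_mem_open_orbit[OF inv(2)] by blast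
      qed
      ultimately show ?thesis by blast
    qed
    also have "\<dots> \<in> sets borel"
    proof -
      have "{z. cmod (chi u z) \<le> 1} \<in> sets (borel :: (complex ^ 'n) measure)" for u
        using borel_measurable_le[OF meas_chi[of u], of "\<lambda>_. 1"] by simp
      thus ?thesis using ct by (intro sets.Int sets.countable_INT'') auto
    qed
    finally show ?thesis .
  qed
  have G: "(\<lambda>z. F (chart_point B' z) * indicator (P B) (chart_point B' z)) \<in> borel_measurable borel"
    if "B \<in> charts \<Delta>" "B' \<in> charts \<Delta>" for B B'
  proof -
    have "(\<lambda>z. indicator (P B) (chart_point B' z) :: ennreal) = indicator (chart_point B' -` P B)"
      by (auto simp: indicator_def)
    thus ?thesis using pre[OF that] F[OF that(2)] by (intro borel_measurable_times_ennreal) auto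
  qed
  have "(\<integral>\<^sup>+x\<in>open_orbit. F x \<partial>\<mu>) \<le> (\<integral>\<^sup>+x. (\<Sum>B\<in>R. F x * indicator (P B) x * indicator open_orbit x) \<partial>\<mu>)"
  proof (rule nn_integral_mono)
    fix y
    show "F y * indicator open_orbit y \<le> (\<Sum>B\<in>R. F y * indicator (P B) y * indicator open_orbit y)"
    proof (cases "y \<in> open_orbit")
      case True
      then obtain x where x: "x \<in> ctorus" "y = torus_point x" by (auto simp: open_orbit_def)
      then obtain B where B: "B \<in> R" "torus_coords B x \<in> polydisc" using R(3) by blast
      have "invertible B" using B R(2) charts_invertible by blast
      hence "y \<in> P B" unfolding P_def using x B
        by (intro image_eqI[of _ _ "torus_coords B x"]) (auto simp: chart_point_torus_coords
            torus_coords_ctorus)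
      hence "F y * indicator open_orbit y = F y * indicator (P B) y * indicator open_orbit y" by simp
      also have "\<dots> \<le> (\<Sum>B\<in>R. F y * indicator (P B) y * indicator open_orbit y)"
        using R(1) B(1) by (intro member_le_sum) auto
      finally show ?thesis .
    qed simp
  qed
  also have "\<dots> = (\<Sum>B\<in>R. \<integral>\<^sup>+x\<in>open_orbit. F x * indicator (P B) x \<partial>\<mu>)"
  proof (rule nn_integral_sum)
    fix B assume "B \<in> R"
    hence B: "B \<in> charts \<Delta>" using R by blast
    have "(\<lambda>x. F x * indicator (P B) x) \<in> borel_measurable \<mu>"
      by (rule measurable_toric[OF hd]) (rule G[OF B])
    moreover have "open_orbit \<in> sets \<mu>" using open_orbit_sets[OF hd] B by blast
    ultimately show "(\<lambda>x. F x * indicator (P B) x * indicator open_orbit x) \<in> borel_measurable \<mu>" by simp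
  qed
  also have "\<dots> = (\<Sum>B\<in>R. \<integral>\<^sup>+z\<in>ctorus \<inter> polydisc. F (chart_point B z) * ennreal (\<rho> B z) \<partial>lborel)"
  proof (rule sum.cong)
    fix B assume "B \<in> R"
    hence B: "B \<in> charts \<Delta>" using R by blast
    have "(\<integral>\<^sup>+x\<in>open_orbit. F x * indicator (P B) x \<partial>\<mu>) =
      (\<integral>\<^sup>+z\<in>ctorus. F (chart_point B z) * indicator (P B) (chart_point B z) * ennreal (\<rho> B z) \<partial>lborel)"
      by (rule nn_integral_open_orbit[OF hd B]) (rule G[OF B])
    also have "\<dots> = (\<integral>\<^sup>+z\<in>ctorus \<inter> polydisc. F (chart_point B z) * ennreal (\<rho> B z) \<partial>lborel)"
      by (intro nn_integral_cong)
        (auto simp: P_def inj_image_mem_iff[OF inj_chart_point[OF charts_invertible[OF B]]] indicator_def)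
    finally show "(\<integral>\<^sup>+x\<in>open_orbit. F x * indicator (P B) x \<partial>\<mu>) =
      (\<integral>\<^sup>+z\<in>ctorus \<inter> polydisc. F (chart_point B z) * ennreal (\<rho> B z) \<partial>lborel)" .
  qed simp
  finally show ?thesis .
qed

section \<open>Invariant potentials and subspaces\<close>

locale toric_data =
  fixes \<Delta> :: "(real ^ 'n) set set" and H :: "(int ^ 'n ^ 'n) set" and k :: nat
    and h :: "'n local_metric" and \<mu> :: "'n toric_point measure"
    and \<rho> :: "int ^ 'n ^ 'n \<Rightarrow> complex ^ 'n \<Rightarrow> real"
  assumes fano: "toric_fano \<Delta>"
    and subgr: "subgroup H (Aut_polytope (anticanonical_polytope \<Delta>))"
    and k: "k \<ge> 1"
    and h: "continuous_hermitian_metric \<Delta> k h"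
    and h_inv: "invariant_metric \<Delta> k (toric_group H) h"
    and hd: "has_densities \<Delta> \<mu> \<rho>"
begin

lemma sc: "smooth_fan \<Delta>" "complete_fan \<Delta>"
  using fano by (auto simp: toric_fano_def)

lemmas fin = finite_weights[OF sc, of k]

lemmas ne = charts_nonempty[OF sc]

abbreviation "W \<equiv> weights \<Delta> k"

abbreviation "X \<equiv> toric_variety \<Delta>"

abbreviation "msec \<equiv> monomial_section \<Delta> k"

abbreviation "comb \<equiv> combination \<Delta> k"

abbreviation "sections_on \<equiv> supported_sections \<Delta> k"

abbreviation "invariant \<equiv> invariant_subspace \<Delta> k (toric_group H)"

abbreviation "potentials \<equiv> bergman_potentials \<Delta> k (toric_group H) h"

definition weight_norm :: "int ^ 'n \<Rightarrow> 'n toric_point \<Rightarrow> real"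
  where "weight_norm u = norm_sq \<Delta> h (msec u)"

definition local_norm :: "(int ^ 'n) set \<Rightarrow> int ^ 'n ^ 'n \<Rightarrow> complex ^ 'n \<Rightarrow> real"
  where "local_norm S B z = (\<Sum>u\<in>S. (cmod (msec u B z))\<^sup>2)"

lemma H_Aut: "A \<in> H \<Longrightarrow> A \<in> carrier (Aut_polytope (anticanonical_polytope \<Delta>))"
  using subgroup.subset[OF subgr] by blast

lemma H_invertible: "A \<in> H \<Longrightarrow> invertible A"
  using H_Aut by (auto simp: Aut_polytope_def)

lemma H_one: "mat 1 \<in> H"
  using subgroup.one_closed[OF subgr] by (simp add: Aut_polytope_def)

lemma H_mult: "A \<in> H \<Longrightarrow> A' \<in> H \<Longrightarrow> A ** A' \<in> H"
  using subgroup.m_closed[OF subgr, of A A'] by (simp add: Aut_polytope_def)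

lemma H_weights: "A \<in> H \<Longrightarrow> u \<in> W \<Longrightarrow> A *v u \<in> W"
  using weights_Aut[OF sc k H_Aut] .

lemma H_bij_weights: "A \<in> H \<Longrightarrow> bij_betw ((*v) A) W W"
  using bij_weights_Aut[OF sc k H_Aut] .

lemma H_isometry: "A \<in> H \<Longrightarrow> t \<in> compact_torus \<Longrightarrow> isometry_coeffs \<Delta> k (toric_act A t) h"
  using h_inv by (auto simp: invariant_metric_def toric_group_def)

lemma metric_pos: "B \<in> charts \<Delta> \<Longrightarrow> h B z > 0"
  using h by (auto simp: continuous_hermitian_metric_def)

lemma metric_continuous: "B \<in> charts \<Delta> \<Longrightarrow> continuous_on S (h B)"
  using h continuous_on_subset[of UNIV "h B" S] by (auto simp: continuous_hermitian_metric_def)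

lemma density_pos: "B \<in> charts \<Delta> \<Longrightarrow> \<rho> B z > 0"
  using hd by (auto simp: has_densities_def)

lemma density_continuous: "B \<in> charts \<Delta> \<Longrightarrow> continuous_on S (\<rho> B)"
  using hd continuous_on_subset[of UNIV "\<rho> B" S] by (auto simp: has_densities_def)

lemma weight_norm_chart_point:
  "u \<in> W \<Longrightarrow> B \<in> charts \<Delta> \<Longrightarrow>
    weight_norm u (chart_point B z) = (cmod (msec u B z))\<^sup>2 * h B z"
  unfolding weight_norm_def by (rule norm_sq_chart_point[OF h monomial_section_H0[OF fin]])

lemma sum_weight_norm_chart_point:
  "S \<subseteq> W \<Longrightarrow> B \<in> charts \<Delta> \<Longrightarrow> (\<Sum>u\<in>S. weight_norm u (chart_point B z)) = local_norm S B z * h B z"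
  by (simp add: weight_norm_chart_point subset_iff local_norm_def sum_distrib_right)

lemma continuous_monomial_section: "continuous_on S (msec u B)"
  by (intro continuous_at_imp_continuous_on ballI isCont_monomial_section)

lemma continuous_local_norm: "continuous_on U (local_norm S B)"
  unfolding local_norm_def by (intro continuous_intros continuous_monomial_section)

lemma weight_norm_continuous:
  assumes "u \<in> W" "B \<in> charts \<Delta>"
  shows "continuous_on S (\<lambda>z. weight_norm u (chart_point B z))"
  unfolding weight_norm_chart_point[OF assms]
  by (intro continuous_intros continuous_monomial_section metric_continuous assms(2))

lemma sum_weight_norm_measurable:
  assumes "S \<subseteq> W" "B \<in> charts \<Delta>"
  shows "(\<lambda>z. \<Sum>u\<in>S. weight_norm u (chart_point B z)) \<in> borel_measurable borel"
  using assms by (intro borel_measurable_continuous_onI continuous_intros weight_norm_continuous) auto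

lemma weight_norm_nonneg: "u \<in> W \<Longrightarrow> x \<in> X \<Longrightarrow> 0 \<le> weight_norm u x"
proof -
  assume u: "u \<in> W" and "x \<in> X"
  then obtain B z where B: "B \<in> charts \<Delta>" "x = chart_point B z" by (auto simp: toric_variety_def)
  show ?thesis
    unfolding B(2) weight_norm_chart_point[OF u B(1)] using less_imp_le[OF metric_pos[OF B(1)]] by simp
qed

lemma monomial_section_nonzero:
  assumes "B \<in> charts \<Delta>" "z \<in> ctorus"
  shows "msec u B z \<noteq> 0"
  using assms det_unimodular[OF charts_invertible[OF assms(1)]] by (auto simp: monomial_section_def ctorus_def)

lemma local_norm_pos:
  assumes "S \<subseteq> W" "S \<noteq> {}" "B \<in> charts \<Delta>" "z \<in> ctorus"
  shows "local_norm S B z > 0"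
  unfolding local_norm_def using assms finite_subset[OF assms(1) fin]
  by (intro sum_pos) (auto simp: monomial_section_nonzero)

lemma sum_weight_norm_pos:
  assumes "S \<subseteq> W" "S \<noteq> {}" "x \<in> open_orbit"
  shows "(\<Sum>u\<in>S. weight_norm u x) > 0"
proof -
  obtain B where B: "B \<in> charts \<Delta>" using ne by blast
  then obtain z where "z \<in> ctorus" "x = chart_point B z"
    using assms(3) open_orbit_chart[OF charts_invertible] by blast
  thus ?thesis using local_norm_pos[OF assms(1,2) B] metric_pos[OF B]
    by (simp add: sum_weight_norm_chart_point[OF assms(1) B])
qed

lemma open_orbit_subset: "open_orbit \<subseteq> X"
  using torus_point_variety[OF ne] by (auto simp: open_orbit_def)

text \<open>
  The monomial section belonging to the vertex of a chart has all exponents \<open>0\<close> in this chart,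
  hence no zeros there. So \<open>-kK\<^sub>X\<close> is globally generated, and potentials are logarithms of
  positive functions.
\<close>

lemma vertex_section_nonzero:
  assumes "B \<in> charts \<Delta>"
  shows "\<exists>u\<in>W. msec u B z \<noteq> 0"
proof
  show "int k *s chart_vertex B \<in> W" by (rule vertex_weight[OF fano assms])
  have inv: "invertible B" using assms charts_invertible by blast
  show "msec (int k *s chart_vertex B) B z \<noteq> 0"
    using assms det_unimodular[OF inv] by (auto simp: monomial_section_def scale_vec_mult
        chart_vertex_mult[OF inv])
qed

lemma weighted_sum_pos:
  assumes "\<And>u. u \<in> W \<Longrightarrow> a u > 0" "x \<in> X"
  shows "(\<Sum>u\<in>W. a u * weight_norm u x) > 0"
proof -
  obtain B z where B: "B \<in> charts \<Delta>" "x = chart_point B z" using assms(2) by (auto simp: toric_variety_def)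
  obtain u where u: "u \<in> W" "msec u B z \<noteq> 0" using vertex_section_nonzero[OF B(1)] by blast
  have "weight_norm u x > 0" using u metric_pos[OF B(1)] by (simp add: B(2) weight_norm_chart_point[OF
      u(1) B(1)])
  show ?thesis
  proof (rule sum_pos2[OF fin u(1)])
    show "0 < a u * weight_norm u x" using assms(1)[OF u(1)] \<open>weight_norm u x > 0\<close> by simp
    show "0 \<le> a i * weight_norm i x" if "i \<in> W" for i
      using assms(1)[OF that] weight_norm_nonneg[OF that assms(2)] by simp
  qed
qed

lemma weight_norm_equivariant:
  assumes "A \<in> H" "t \<in> compact_torus" "u \<in> W" "x \<in> X"
  shows "weight_norm (A *v u) (toric_act A t x) = weight_norm u x"
  unfolding weight_norm_def
  by (rule norm_sq_monomial_equivariant[OF fano k H_Aut[OF assms(1)] assms(2) h H_isometry[OF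
      assms(1,2)] assms(3,4)])

lemma toric_act_variety': "A \<in> H \<Longrightarrow> t \<in> compact_torus \<Longrightarrow> x \<in> X \<Longrightarrow> toric_act A t x \<in> X"
  using toric_act_variety[OF fano H_Aut] compact_torus_subset by blast

text \<open>
  The basis consists of the monomial sections rescaled by \<open>sqrt (a u)\<close>.
\<close>

lemma diagonal_potential:
  assumes pos: "\<And>u. u \<in> W \<Longrightarrow> a u > 0" and inv: "\<And>A u. A \<in> H \<Longrightarrow> u \<in> W \<Longrightarrow> a (A *v u) = a u"
  shows "(\<lambda>x. 1 / real k * ln (\<Sum>u\<in>W. a u * weight_norm u x)) \<in> potentials"
proof -
  define d where "d u = complex_of_real (sqrt (a u))" for u
  have d: "d u \<noteq> 0" "(cmod (d u))\<^sup>2 = a u" if "u \<in> W" for u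
    using pos[OF that] by (auto simp: d_def)
  let ?S = "(\<lambda>u. scale_coeffs (d u) (msec u)) ` W"
  have "basis_of ?S (H0 \<Delta> k)"
    unfolding H0_eq_supported[OF fin ne] by (rule basis_of_scaled_monomials[OF fin ne subset_refl d(1)])
  moreover have "(\<Sum>s\<in>?S. norm_sq \<Delta> h s x) = (\<Sum>u\<in>W. a u * weight_norm u x)" for x
    using d by (subst sum.reindex[OF inj_scaled_monomials[OF fin ne d(1)]])
      (auto simp: norm_sq_scale weight_norm_def)
  moreover have "(\<Sum>u\<in>W. a u * weight_norm u (g x)) = (\<Sum>u\<in>W. a u * weight_norm u x)"
    if G: "g \<in> toric_group H" and x: "x \<in> X" for g x
  proof -
    obtain A t where g: "g = toric_act A t" "A \<in> H" "t \<in> compact_torus"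
      using G by (auto simp: toric_group_def)
    have "(\<Sum>u\<in>W. a u * weight_norm u (g x)) = (\<Sum>u\<in>W. a (A *v u) * weight_norm (A *v u) (g x))"
      by (rule sum.reindex_bij_betw[OF H_bij_weights[OF g(2)], symmetric])
    also have "\<dots> = (\<Sum>u\<in>W. a u * weight_norm u x)"
      unfolding g(1) by (intro sum.cong refl) (simp add: inv g weight_norm_equivariant x)
    finally show ?thesis .
  qed
  ultimately show ?thesis unfolding bergman_potentials_def by (auto intro!: exI[of _ ?S])
qed

lemma total_weight_norm_bounded:
  obtains C where "C > 0" "\<And>x. x \<in> X \<Longrightarrow> (\<Sum>u\<in>W. weight_norm u x) \<le> C"
proof -
  have "isCont (\<lambda>z. \<Sum>u\<in>W. weight_norm u (chart_point B z)) z" if "B \<in> charts \<Delta>" for B z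
  proof -
    have "continuous_on UNIV (\<lambda>z. \<Sum>u\<in>W. weight_norm u (chart_point B z))"
      using that by (intro continuous_intros weight_norm_continuous)
    thus ?thesis by (simp add: continuous_on_eq_continuous_at)
  qed
  from continuous_function_bounded[where F = "\<lambda>x. \<Sum>u\<in>W. weight_norm u x", OF sc this]
  obtain C where C: "\<And>x. x \<in> X \<Longrightarrow> (\<Sum>u\<in>W. weight_norm u x) \<le> C" by blast
  show ?thesis by (rule that[of "max C 1"]) (use C in \<open>auto intro: max.coboundedI1\<close>)
qed

lemma toric_groupI: "A \<in> H \<Longrightarrow> t \<in> compact_torus \<Longrightarrow> toric_act A t \<in> toric_group H"
  by (auto simp: toric_group_def)

lemma ones_compact_torus: "(\<chi> i. 1) \<in> compact_torus"
  by (simp add: compact_torus_def)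

lemma invariant_pushforward:
  assumes V: "invariant V" and "A \<in> H" "t \<in> compact_torus" "comb c \<in> V"
  shows "comb (\<lambda>u. of_int (det A) ^ k * chi (- u) t * c (matrix_inv A *v u)) \<in> V"
proof -
  obtain s' where s': "s' \<in> V" "pushes_to \<Delta> k (toric_act A t) (comb c) s'"
    using V assms(4) toric_groupI[OF assms(2,3)] unfolding invariant_subspace_def by blast
  have t: "t \<in> ctorus" using assms(3) compact_torus_subset by blast
  have "s' \<in> H0 \<Delta> k" using V s'(1) by (auto simp: invariant_subspace_def)
  with pushes_to_unique[OF H_invertible[OF assms(2)] t ne this combination_H0[OF fin] s'(2)
      pushes_to_combination[OF H_invertible[OF assms(2)] t fin H_bij_weights[OF assms(2)]]]
  show ?thesis using s'(1) by simp
qed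

text \<open>
  If a section with a nonzero coefficient at \<open>u\<close> lies in \<open>V\<close>, then the average of its translates
  by torsion points against the character \<open>u\<close> isolates the monomial section of weight \<open>u\<close>, which
  therefore lies in \<open>V\<close> as well.
\<close>

lemma invariant_subspace_monomials:
  assumes V: "invariant V" "V \<noteq> {0}"
  defines "S \<equiv> {u \<in> W. msec u \<in> V}"
  shows "V = sections_on S" "S \<noteq> {}" "\<And>A u. A \<in> H \<Longrightarrow> u \<in> S \<Longrightarrow> A *v u \<in> S"
proof -
  have sub: "coeffs.subspace V" and VH: "V \<subseteq> H0 \<Delta> k" using V by (auto simp: invariant_subspace_def)
  have SW: "S \<subseteq> W" by (auto simp: S_def)
  have key: "msec u0 \<in> V" if c: "comb c \<in> V" "u0 \<in> W" "c u0 \<noteq> 0" for c u0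
  proof -
    obtain G where G: "finite G" "G \<noteq> {}" "G \<subseteq> compact_torus"
      "\<And>m m'. m \<in> W \<Longrightarrow> m' \<in> W \<Longrightarrow> (\<Sum>t\<in>G. chi (m - m') t) = (if m = m' then of_nat (card G) else 0)"
      by (rule character_orthogonality[OF fin]) blast
    have "comb (\<lambda>u. chi (- u) t * c u) \<in> V" if "t \<in> G" for t
      using invariant_pushforward[OF V(1) H_one _ c(1), of t] that G(3) by (auto simp: subset_iff)
    hence "(\<Sum>t\<in>G. scale_coeffs (chi u0 t) (comb (\<lambda>u. chi (- u) t * c u))) \<in> V"
      by (intro coeffs.subspace_sum[OF sub] coeffs.subspace_scale[OF sub])
    also have "(\<Sum>t\<in>G. scale_coeffs (chi u0 t) (comb (\<lambda>u. chi (- u) t * c u))) =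
      comb (\<lambda>u. \<Sum>t\<in>G. chi u0 t * (chi (- u) t * c u))"
      by (simp add: combination_scale combination_sum)
    also have "\<dots> = comb (\<lambda>v. if v = u0 then of_nat (card G) * c u0 else 0)"
      unfolding combination_eq_iff[OF fin ne]
    proof
      fix u assume u: "u \<in> W"
      have "(\<Sum>t\<in>G. chi u0 t * (chi (- u) t * c u)) = (\<Sum>t\<in>G. chi (u0 - u) t) * c u"
        unfolding sum_distrib_right
      proof (rule sum.cong)
        fix t assume "t \<in> G"
        hence "t \<in> ctorus" using G(3) compact_torus_subset by blast
        thus "chi u0 t * (chi (- u) t * c u) = chi (u0 - u) t * c u"
          by (simp add: chi_diff chi_minus divide_inverse)
      qed simp
      thus "(\<Sum>t\<in>G. chi u0 t * (chi (- u) t * c u)) = (if u = u0 then of_nat (card G) * c u0 else 0)"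
        using G(4)[OF that(2) u] by auto
    qed
    also have "\<dots> = scale_coeffs (of_nat (card G) * c u0) (msec u0)"
      by (rule scale_monomial_section[OF fin that(2), symmetric])
    finally have "scale_coeffs (of_nat (card G) * c u0) (msec u0) \<in> V" .
    hence "scale_coeffs (inverse (of_nat (card G) * c u0)) (scale_coeffs (of_nat (card G) * c u0) (msec
        u0)) \<in> V"
      by (rule coeffs.subspace_scale[OF sub])
    moreover have "inverse (of_nat (card G) * c u0) * (of_nat (card G) * c u0) = 1"
      using c(3) G(1,2) by (intro left_inverse) simp
    ultimately have "scale_coeffs 1 (msec u0) \<in> V"
      by (simp only: coeffs.scale_scale)
    thus ?thesis by simp
  qed
  show VS: "V = sections_on S"
  proof
    show "V \<subseteq> sections_on S"
    proof
      fix s assume s: "s \<in> V"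
      hence "s \<in> sections_on W" using VH H0_eq_supported[OF fin ne] by blast
      then obtain c where c: "s = comb c" "\<And>u. u \<notin> W \<Longrightarrow> c u = 0"
        unfolding supported_sections_def by blast
      have "c u = 0" if "u \<notin> S" for u
        using key[of c u] s c that by (cases "u \<in> W") (auto simp: S_def)
      thus "s \<in> sections_on S" unfolding c(1) by (rule combination_supported)
    qed
    show "sections_on S \<subseteq> V"
    proof
      fix s assume "s \<in> sections_on S"
      then obtain c where c: "s = comb c" "\<And>u. u \<notin> S \<Longrightarrow> c u = 0"
        unfolding supported_sections_def by blast
      have "comb c = (\<Sum>u\<in>S. scale_coeffs (c u) (msec u))"
        by (rule combination_as_sum[OF fin SW c(2)])
      also have "\<dots> \<in> V"
        by (intro coeffs.subspace_sum[OF sub] coeffs.subspace_scale[OF sub]) (simp add: S_def)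
      finally show "s \<in> V" using c(1) by simp
    qed
  qed
  show "S \<noteq> {}"
  proof
    assume "S = {}"
    hence "s = 0" if "s \<in> V" for s
    proof -
      from that obtain c where "s = comb c" "\<And>u. c u = 0"
        unfolding VS supported_sections_def \<open>S = {}\<close> by blast
      thus ?thesis using combination_zero[of \<Delta> k] by (metis ext)
    qed
    moreover have "0 \<in> V" by (rule coeffs.subspace_0[OF sub])
    ultimately show False using V(2) by blast
  qed
  fix A u assume A: "A \<in> H" and u: "u \<in> S"
  have uW: "u \<in> W" using u SW by blast
  define c :: "int ^ 'n \<Rightarrow> complex" where "c v = (if v = u then 1 else 0)" for v
  have "comb c \<in> V"
    using u scale_monomial_section[OF fin uW, of 1] by (simp add: S_def c_def[abs_def])
  from invariant_pushforward[OF V(1) A ones_compact_torus this]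
  have 1: "comb (\<lambda>v. of_int (det A) ^ k * chi (- v) (\<chi> i. 1) * c (matrix_inv A *v v)) \<in> V" .
  have "of_int (det A) ^ k * chi (- (A *v u)) (\<chi> i. 1) * c (matrix_inv A *v (A *v u)) \<noteq> 0"
    using det_unimodular[OF H_invertible[OF A]] by (auto simp: c_def matrix_inv_cancel_vector[OF
        H_invertible[OF A]])
  from key[OF 1 H_weights[OF A uW] this] show "A *v u \<in> S"
    using H_weights[OF A uW] by (simp add: S_def)
qed

definition orbit :: "int ^ 'n \<Rightarrow> (int ^ 'n) set"
  where "orbit u = (\<lambda>A. A *v u) ` H"

lemma orbit_mem: "u \<in> orbit u"
  unfolding orbit_def using H_one by (intro image_eqI[of _ _ "mat 1"]) auto

lemma orbit_weights: "u \<in> W \<Longrightarrow> orbit u \<subseteq> W"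
  using H_weights by (auto simp: orbit_def)

lemma orbit_closed: "A \<in> H \<Longrightarrow> v \<in> orbit u \<Longrightarrow> A *v v \<in> orbit u"
  using H_mult by (auto simp: orbit_def matrix_vector_mul_assoc)

lemma orbit_subspace:
  assumes "u \<in> W"
  shows "invariant (sections_on (orbit u))"
    and "sections_on (orbit u) \<noteq> {0}"
proof -
  let ?V = "sections_on (orbit u)"
  have "\<exists>s'\<in>?V. pushes_to \<Delta> k g s s'" if g: "g \<in> toric_group H" and s: "s \<in> ?V" for g s
  proof -
    obtain A t where g: "g = toric_act A t" "A \<in> H" "t \<in> compact_torus"
      using g by (auto simp: toric_group_def)
    obtain c where c: "s = comb c" "\<And>v. v \<notin> orbit u \<Longrightarrow> c v = 0"
      using s unfolding supported_sections_def by blast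
    have t: "t \<in> ctorus" using g compact_torus_subset by blast
    let ?c = "\<lambda>v. of_int (det A) ^ k * chi (- v) t * c (matrix_inv A *v v)"
    have "?c v = 0" if "v \<notin> orbit u" for v
    proof -
      have "matrix_inv A *v v \<notin> orbit u"
        using orbit_closed[OF g(2), of "matrix_inv A *v v" u] that
        by (auto simp: matrix_inv_cancel_vector[OF H_invertible[OF g(2)]])
      thus ?thesis using c(2) by simp
    qed
    hence "comb ?c \<in> ?V" by (rule combination_supported)
    moreover have "pushes_to \<Delta> k g s (comb ?c)"
      unfolding g(1) c(1) by (rule pushes_to_combination[OF H_invertible[OF g(2)] t fin H_bij_weights[OF g(2)]])
    ultimately show ?thesis by blast
  qed
  moreover have "?V \<subseteq> H0 \<Delta> k" by (auto simp: supported_sections_def combination_H0[OF fin])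
  ultimately show "invariant ?V"
    by (simp add: invariant_subspace_def subspace_supported_sections)
  have "comb (\<lambda>v. if v = u then 1 else 0) \<in> ?V"
    using orbit_mem by (intro combination_supported) auto
  moreover have "comb (\<lambda>v. if v = u then 1 else 0) \<noteq> comb (\<lambda>v. 0)"
    unfolding combination_eq_iff[OF fin ne] using assms by (auto intro!: bexI[of _ u])
  ultimately show "?V \<noteq> {0}" by (auto simp: combination_zero)
qed

end

section \<open>Comparison of the thresholds\<close>

lemma nn_integral_compact_finite:
  fixes f :: "'a :: euclidean_space \<Rightarrow> ennreal"
  assumes f: "f \<in> borel_measurable borel" and K: "compact K"
    and loc: "\<And>z. z \<in> K \<Longrightarrow> \<exists>U. open U \<and> z \<in> U \<and> (\<integral>\<^sup>+w\<in>U. f w \<partial>lborel) < \<infinity>"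
  shows "(\<integral>\<^sup>+w\<in>K. f w \<partial>lborel) < \<infinity>"
proof -
  from loc obtain U where U: "\<And>z. z \<in> K \<Longrightarrow> open (U z)" "\<And>z. z \<in> K \<Longrightarrow> z \<in> U z"
    "\<And>z. z \<in> K \<Longrightarrow> (\<integral>\<^sup>+w\<in>U z. f w \<partial>lborel) < \<infinity>" by metis
  have "K \<subseteq> (\<Union>z\<in>K. U z)" using U(2) by blast
  from compactE_image[OF K U(1) this] obtain Z where Z: "Z \<subseteq> K" "finite Z" "K \<subseteq> (\<Union>z\<in>Z. U z)" by blast
  have "(\<integral>\<^sup>+w\<in>K. f w \<partial>lborel) \<le> (\<integral>\<^sup>+w. (\<Sum>z\<in>Z. f w * indicator (U z) w) \<partial>lborel)"
  proof (rule nn_integral_mono)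
    fix w
    show "f w * indicator K w \<le> (\<Sum>z\<in>Z. f w * indicator (U z) w)"
    proof (cases "w \<in> K")
      case True
      then obtain z where z: "z \<in> Z" "w \<in> U z" using Z(3) by blast
      hence "f w * indicator K w = f w * indicator (U z) w" using True by simp
      also have "\<dots> \<le> (\<Sum>z\<in>Z. f w * indicator (U z) w)" using z(1) Z(2) by (intro member_le_sum) auto
      finally show ?thesis .
    qed simp
  qed
  also have "\<dots> = (\<Sum>z\<in>Z. \<integral>\<^sup>+w\<in>U z. f w \<partial>lborel)"
  proof (rule nn_integral_sum)
    fix z assume "z \<in> Z"
    hence "U z \<in> sets borel" using U(1) Z(1) by auto
    thus "(\<lambda>w. f w * indicator (U z) w) \<in> borel_measurable lborel" using f by simp
  qed
  also have "\<dots> < \<infinity>" using U(3) Z(1,2) by (auto simp: ennreal_sum_less_top less_top subset_iff)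
  finally show ?thesis .
qed

lemma inverse_ennreal_powr: "0 < y \<Longrightarrow> inverse (ennreal (y powr p)) = ennreal (y powr - p)"
  by (simp add: inverse_ennreal powr_minus)

context toric_data
begin

definition twisted_sum :: "(int ^ 'n \<Rightarrow> real) \<Rightarrow> 'n toric_point \<Rightarrow> real"
  where "twisted_sum a x = (\<Sum>u\<in>W. a u * weight_norm u x)"

lemma continuous_twisted_sum:
  "B \<in> charts \<Delta> \<Longrightarrow> continuous_on S (\<lambda>z. twisted_sum a (chart_point B z))"
  unfolding twisted_sum_def by (intro continuous_intros weight_norm_continuous)

lemma twisted_sum_measurable:
  "B \<in> charts \<Delta> \<Longrightarrow> (\<lambda>z. twisted_sum a (chart_point B z)) \<in> borel_measurable borel"
  by (rule borel_measurable_continuous_onI[OF continuous_twisted_sum])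

lemma twisted_sum_bdd_above:
  assumes "\<And>u. u \<in> W \<Longrightarrow> 0 < a u"
  shows "bdd_above ((\<lambda>x. 1 / real k * ln (twisted_sum a x)) ` X)"
proof -
  have "isCont (\<lambda>z. twisted_sum a (chart_point B z)) z" if "B \<in> charts \<Delta>" for B z
    using continuous_twisted_sum[OF that, of UNIV a] by (simp add: continuous_on_eq_continuous_at)
  from continuous_function_bounded[where F = "twisted_sum a", OF sc this]
  obtain C where C: "\<And>x. x \<in> X \<Longrightarrow> twisted_sum a x \<le> C" by blast
  have "1 / real k * ln (twisted_sum a x) \<le> 1 / real k * ln C" if "x \<in> X" for x
  proof -
    have "0 < twisted_sum a x" unfolding twisted_sum_def by (rule weighted_sum_pos[OF assms that])
    thus ?thesis using C[OF that] by (intro mult_left_mono) (auto simp: ln_le_cancel_iff)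
  qed
  thus ?thesis by (auto intro!: bdd_aboveI2)
qed

text \<open>
  The test potentials have coefficient 1 on the weights \<open>S\<close> of \<open>V\<close> and \<open>1 / (j + 1)\<close> elsewhere.
  Their suprema are bounded below by the value of the part over \<open>S\<close> at one fixed point, so the
  assumption bounds the integrals of the exponentials uniformly in \<open>j\<close>, and Fatou's lemma gives
  the limit.
\<close>

lemma alpha_le_lct:
  assumes c: "c > 0" and fin_int: "(SUP \<phi>\<in>potentials.
         \<integral>\<^sup>+x. ennreal (exp (- c * (\<phi> x - (SUP y\<in>X. \<phi> y)))) \<partial>\<mu>) < \<infinity>"
    and V: "invariant V" "V \<noteq> {0}"
  shows "ereal (c / real k) \<le> lct \<Delta> V"
proof -
  define K where "K = (SUP \<phi>\<in>potentials.
         \<integral>\<^sup>+x. ennreal (exp (- c * (\<phi> x - (SUP y\<in>X. \<phi> y)))) \<partial>\<mu>)"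
  define p where "p = c / real k"
  have p: "p > 0" using c k by (simp add: p_def)
  define S where "S = {u \<in> W. msec u \<in> V}"
  note VS = invariant_subspace_monomials[OF V, folded S_def]
  have SW: "S \<subseteq> W" by (auto simp: S_def)
  have finS: "finite S" using SW fin finite_subset by blast
  define a :: "nat \<Rightarrow> int ^ 'n \<Rightarrow> real" where "a j u = (if u \<in> S then 1 else 1 / real (Suc j))" for j u
  have a_pos: "a j u > 0" for j u by (simp add: a_def)
  \<comment> \<open>an injective map of the finite set \<open>S\<close> into itself is onto\<close>
  have S_iff: "A *v u \<in> S \<longleftrightarrow> u \<in> S" if "A \<in> H" "u \<in> W" for A u
  proof
    assume Au: "A *v u \<in> S"
    have inj: "inj_on ((*v) A) S" using H_bij_weights[OF that(1)] SW by (meson bij_betw_def inj_on_subset)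
    have "(*v) A ` S = S"
      using inj finS VS(3)[OF that(1)] by (intro card_subset_eq) (auto simp: card_image)
    with Au obtain v where "v \<in> S" "A *v v = A *v u" by (metis imageE)
    hence "v = u" using matrix_inv_cancel_vector(2)[OF H_invertible[OF that(1)]] by metis
    thus "u \<in> S" using \<open>v \<in> S\<close> by simp
  qed (use VS(3) that in blast)
  have pot: "(\<lambda>x. 1 / real k * ln (twisted_sum (a j) x)) \<in> potentials" for j
    unfolding twisted_sum_def
    by (rule diagonal_potential) (use a_pos S_iff in \<open>auto simp: a_def\<close>)
  have f_ge: "(\<Sum>u\<in>S. weight_norm u x) \<le> twisted_sum (a j) x" if "x \<in> X" for j x
  proof -
    have "(\<Sum>u\<in>S. weight_norm u x) = (\<Sum>u\<in>S. a j u * weight_norm u x)" by (simp add: a_def)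
    also have "\<dots> \<le> (\<Sum>u\<in>W. a j u * weight_norm u x)"
      by (intro sum_mono2 fin SW mult_nonneg_nonneg weight_norm_nonneg[OF _ that] less_imp_le[OF a_pos]) auto
    finally show ?thesis by (simp add: twisted_sum_def)
  qed
  define x0 :: "'n toric_point" where "x0 = torus_point (\<chi> i. 1)"
  have x0: "x0 \<in> open_orbit" using ones_ctorus by (auto simp: x0_def open_orbit_def)
  have x0X: "x0 \<in> X" using x0 open_orbit_subset by blast
  define L where "L = (\<Sum>u\<in>S. weight_norm u x0)"
  have L: "L > 0" unfolding L_def by (rule sum_weight_norm_pos[OF SW VS(2) x0])
  have bound: "(\<integral>\<^sup>+x\<in>open_orbit. ennreal (twisted_sum (a j) x powr - p) \<partial>\<mu>) \<le> ennreal (L powr - p) * K" for j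
  proof -
    let ?\<phi> = "\<lambda>x. 1 / real k * ln (twisted_sum (a j) x)"
    let ?s = "SUP y\<in>X. ?\<phi> y"
    have s: "1 / real k * ln L \<le> ?s"
    proof -
      have "1 / real k * ln L \<le> ?\<phi> x0"
        using f_ge[OF x0X] L unfolding L_def[symmetric] 
        by (intro mult_left_mono ln_mono) auto
      also have "\<dots> \<le> ?s" by (rule cSUP_upper[OF x0X twisted_sum_bdd_above[OF a_pos]])
      finally show ?thesis .
    qed
    have "ennreal (twisted_sum (a j) x powr - p) * indicator open_orbit x \<le>
      ennreal (L powr - p) * ennreal (exp (- c * (?\<phi> x - ?s)))" for x
    proof (cases "x \<in> open_orbit")
      case True
      hence "x \<in> X" using open_orbit_subset by blast
      hence pos: "twisted_sum (a j) x > 0" unfolding twisted_sum_def by (rule weighted_sum_pos[OF a_pos])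
      have "c * (1 / real k * ln L) \<le> c * ?s" using s c by (intro mult_left_mono) auto
      hence "- p * ln (twisted_sum (a j) x) \<le> - p * ln L + - c * (?\<phi> x - ?s)"
        by (simp add: p_def algebra_simps)
      hence "exp (- p * ln (twisted_sum (a j) x)) \<le> exp (- p * ln L) * exp (- c * (?\<phi> x - ?s))"
        unfolding exp_add[symmetric] exp_le_cancel_iff .
      hence "twisted_sum (a j) x powr - p \<le> L powr - p * exp (- c * (?\<phi> x - ?s))"
        using pos L by (simp add: powr_def)
      thus ?thesis using True by (simp add: ennreal_leI flip: ennreal_mult')
    qed simp
    hence "(\<integral>\<^sup>+x\<in>open_orbit. ennreal (twisted_sum (a j) x powr - p) \<partial>\<mu>) \<le>
      (\<integral>\<^sup>+x. ennreal (L powr - p) * ennreal (exp (- c * (?\<phi> x - ?s))) \<partial>\<mu>)"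
      by (intro nn_integral_mono)
    also have "\<dots> = ennreal (L powr - p) * (\<integral>\<^sup>+x. ennreal (exp (- c * (?\<phi> x - ?s))) \<partial>\<mu>)"
    proof (rule nn_integral_cmult)
      show "(\<lambda>x. ennreal (exp (- c * (?\<phi> x - ?s)))) \<in> borel_measurable \<mu>"
        by (rule measurable_toric[OF hd]) (use twisted_sum_measurable in measurable)
    qed
    also have "\<dots> \<le> ennreal (L powr - p) * K"
      unfolding K_def by (intro mult_left_mono SUP_upper[OF pot]) simp
    finally show ?thesis .
  qed
  let ?S = "(\<lambda>u. scale_coeffs 1 (msec u)) ` S"
  have basis: "basis_of ?S V"
    unfolding VS(1) by (rule basis_of_scaled_monomials[OF fin ne SW]) simp
  have "locally_integrable_power \<Delta> ?S p"
    unfolding locally_integrable_power_def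
  proof (intro ballI allI)
    fix B and z :: "complex ^ 'n" assume B: "B \<in> charts \<Delta>"
    have sumS: "(\<Sum>s\<in>?S. (cmod (s B w))\<^sup>2) = local_norm S B w" for w
      using inj_on_subset[OF inj_scaled_monomials[OF fin ne, of "\<lambda>_. 1"] SW]
      by (subst sum.reindex) (auto simp: local_norm_def)
    have "continuous_on (cball z 1) (\<lambda>w. h B w powr p / \<rho> B w)"
      using metric_pos[OF B] density_pos[OF B]
      by (intro continuous_intros metric_continuous density_continuous B) (auto simp: less_imp_neq[symmetric])
    hence "bounded ((\<lambda>w. h B w powr p / \<rho> B w) ` cball z 1)"
      by (intro compact_imp_bounded compact_continuous_image) auto
    then obtain C where C: "\<And>w. w \<in> cball z 1 \<Longrightarrow> \<bar>h B w powr p / \<rho> B w\<bar> \<le> C"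
      unfolding bounded_iff real_norm_def by blast
    have C0: "C \<ge> 0" using C[of z] by (smt (verit) centre_in_cball)
    let ?f = "\<lambda>j w. ennreal (twisted_sum (a j) (chart_point B w) powr - p) * ennreal (\<rho> B w) * indicator
        ctorus w"
    have lim: "(\<lambda>j. ?f j w) \<longlonglongrightarrow> ennreal ((local_norm S B w * h B w) powr - p) * ennreal (\<rho> B w) *
        indicator ctorus w" for w
    proof (cases "w \<in> ctorus")
      case True
      have "(\<lambda>j. \<Sum>u\<in>W. a j u * weight_norm u (chart_point B w)) \<longlonglongrightarrow>
        (\<Sum>u\<in>W. (if u \<in> S then 1 else 0) * weight_norm u (chart_point B w))"
      proof (intro tendsto_intros)
        fix u
        have "(\<lambda>j. 1 / real (Suc j)) \<longlonglongrightarrow> 0" using LIMSEQ_inverse_real_of_nat by (simp add: inverse_eq_divide)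
        thus "(\<lambda>j. a j u) \<longlonglongrightarrow> (if u \<in> S then 1 else 0)" by (simp add: a_def)
      qed
      moreover have "(\<Sum>u\<in>W. (if u \<in> S then 1 else 0) * weight_norm u (chart_point B w)) = local_norm S B
          w * h B w"
        unfolding sum_weight_norm_chart_point[OF SW B, symmetric]
        using fin SW by (intro sum.mono_neutral_cong_right) auto
      ultimately have "(\<lambda>j. twisted_sum (a j) (chart_point B w)) \<longlonglongrightarrow> local_norm S B w * h B w"
        by (simp add: twisted_sum_def)
      moreover have "local_norm S B w * h B w \<noteq> 0"
        using local_norm_pos[OF SW VS(2) B True] metric_pos[OF B, of w] by simp
      ultimately have "(\<lambda>j. ennreal (twisted_sum (a j) (chart_point B w) powr - p)) \<longlonglongrightarrow>
          ennreal ((local_norm S B w * h B w) powr - p)"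
        by (intro tendsto_ennrealI tendsto_powr tendsto_const)
      hence "(\<lambda>j. ennreal (\<rho> B w) * ennreal (twisted_sum (a j) (chart_point B w) powr - p)) \<longlonglongrightarrow>
          ennreal (\<rho> B w) * ennreal ((local_norm S B w * h B w) powr - p)"
        by (intro ennreal_tendsto_cmult) auto
      thus ?thesis using True by (simp add: mult.commute)
    qed simp
    have int_f: "integral\<^sup>N lborel (?f j) \<le> ennreal (L powr - p) * K" for j
    proof -
      have "(\<integral>\<^sup>+x\<in>open_orbit. ennreal (twisted_sum (a j) x powr - p) \<partial>\<mu>) =
        (\<integral>\<^sup>+w\<in>ctorus. ennreal (twisted_sum (a j) (chart_point B w) powr - p) * ennreal (\<rho> B w) \<partial>lborel)"
        by (rule nn_integral_open_orbit[OF hd B]) (use twisted_sum_measurable in measurable)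
      with bound[of j] show ?thesis by simp
    qed
    have f_meas: "?f j \<in> borel_measurable lborel" for j
      using twisted_sum_measurable[OF B] density_measurable[OF hd B] ctorus_borel by measurable
    have "(\<integral>\<^sup>+w\<in>ball z 1. inverse (ennreal (local_norm S B w powr p)) \<partial>lborel) \<le>
      (\<integral>\<^sup>+w. ennreal C * liminf (\<lambda>j. ?f j w) \<partial>lborel)"
    proof (rule nn_integral_mono_AE)
      have "AE w in lborel. w \<notin> - ctorus" by (rule AE_not_in[OF ctorus_complement_null])
      thus "AE w in lborel. inverse (ennreal (local_norm S B w powr p)) * indicator (ball z 1) w \<le>
          ennreal C * liminf (\<lambda>j. ?f j w)"
      proof eventually_elim
        fix w :: "complex ^ 'n" assume "w \<notin> - ctorus"
        hence w: "w \<in> ctorus" by simp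
        note m = local_norm_pos[OF SW VS(2) B w] and hp = metric_pos[OF B, of w] and rp = density_pos[OF
            B, of w]
        show "inverse (ennreal (local_norm S B w powr p)) * indicator (ball z 1) w \<le> ennreal C * liminf
            (\<lambda>j. ?f j w)"
        proof (cases "w \<in> ball z 1")
          case True
          have "local_norm S B w powr - p = (h B w powr p / \<rho> B w) * ((local_norm S B w * h B w) powr -
              p * \<rho> B w)"
            using m hp rp by (simp add: powr_mult powr_minus field_simps)
          also have "\<dots> \<le> C * ((local_norm S B w * h B w) powr - p * \<rho> B w)"
            using C[of w] True rp by (intro mult_right_mono) auto
          finally have "ennreal (local_norm S B w powr - p) \<le> ennreal (C * ((local_norm S B w * h B w)
              powr - p * \<rho> B w))"
            by (rule ennreal_leI)
          also have "\<dots> = ennreal C * (ennreal ((local_norm S B w * h B w) powr - p) * ennreal (\<rho> B w))"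
            using C0 rp by (simp add: ennreal_mult)
          also have "ennreal ((local_norm S B w * h B w) powr - p) * ennreal (\<rho> B w) = liminf (\<lambda>j. ?f j w)"
            using lim_imp_Liminf[OF trivial_limit_sequentially lim[of w]] w by simp
          finally show ?thesis using True by (simp add: inverse_ennreal_powr[OF m])
        qed simp
      qed
    qed
    also have "\<dots> = ennreal C * (\<integral>\<^sup>+w. liminf (\<lambda>j. ?f j w) \<partial>lborel)"
      by (rule nn_integral_cmult) (use f_meas in measurable)
    also have "\<dots> \<le> ennreal C * liminf (\<lambda>j. integral\<^sup>N lborel (?f j))"
      by (intro mult_left_mono nn_integral_liminf f_meas) simp
    also have "\<dots> \<le> ennreal C * (ennreal (L powr - p) * K)"
      by (intro mult_left_mono Liminf_le) (auto intro!: always_eventually int_f)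
    also have "\<dots> < \<infinity>"
      using fin_int unfolding K_def[symmetric] by (simp add: ennreal_mult_less_top less_top)
    finally show "\<exists>U. open U \<and> z \<in> U \<and> (\<integral>\<^sup>+w\<in>U. inverse (ennreal ((\<Sum>s\<in>?S. (cmod (s B w))\<^sup>2) powr p))
        \<partial>lborel) < \<infinity>"
      unfolding sumS by (intro exI[of _ "ball z 1"]) simp
  qed
  hence "p \<in> {c. c > 0 \<and> (\<exists>S. basis_of S V \<and> locally_integrable_power \<Delta> S c)}" using basis p by blast
  thus ?thesis unfolding lct_def p_def by (intro Sup_upper) blast
qed

text \<open>
  On the finitely many unit polydiscs covering the open orbit, metric and density are bounded, and
  the sum over an arbitrary basis is dominated by the sum over the monomials, by the
  Cauchy-Schwarz inequality. Compactness turns local integrability into integrability, and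
  lowering the exponent is harmless as the sum is bounded.
\<close>

lemma orbit_integral_finite:
  assumes u: "u \<in> W" and b: "basis_of S (sections_on (orbit u))"
    and int: "locally_integrable_power \<Delta> S p" and p: "0 < p'" "p' \<le> p"
  shows "(\<integral>\<^sup>+x\<in>open_orbit. ennreal ((\<Sum>v\<in>orbit u. weight_norm v x) powr - p') \<partial>\<mu>) < \<infinity>"
proof -
  let ?O = "orbit u"
  have OW: "?O \<subseteq> W" by (rule orbit_weights[OF u])
  have One: "?O \<noteq> {}" using orbit_mem by blast
  have finS: "finite S" and span: "coeffs.span S = sections_on ?O" using b by (auto simp: basis_of_def)
  have "\<exists>c. s = comb c \<and> (\<forall>v. v \<notin> ?O \<longrightarrow> c v = 0)" if "s \<in> S" for s
    using coeffs.span_base[OF that] unfolding span supported_sections_def by blast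
  then obtain c where c: "\<And>s. s \<in> S \<Longrightarrow> s = comb (c s)" "\<And>s v. s \<in> S \<Longrightarrow> v \<notin> ?O \<Longrightarrow> c s v = 0"
    by metis
  define C1 where "C1 = (\<Sum>s\<in>S. \<Sum>v\<in>?O. (cmod (c s v))\<^sup>2) + 1"
  have C1: "C1 > 0" unfolding C1_def by (intro add_nonneg_pos sum_nonneg) auto
  define mS where "mS B z = (\<Sum>s\<in>S. (cmod (s B z))\<^sup>2)" for B and z :: "complex ^ 'n"
  have mS_le: "mS B z \<le> C1 * local_norm ?O B z" for B z
  proof -
    have "(cmod (s B z))\<^sup>2 \<le> (\<Sum>v\<in>?O. (cmod (c s v))\<^sup>2) * local_norm ?O B z" if s: "s \<in> S" for s
    proof -
      have "s B z = (\<Sum>v\<in>W. c s v * msec v B z)"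
        by (subst c(1)[OF s]) (simp add: combination_def)
      also have "\<dots> = (\<Sum>v\<in>?O. c s v * msec v B z)"
        using fin OW c(2)[OF s] by (intro sum.mono_neutral_right) auto
      finally have "cmod (s B z) \<le> (\<Sum>v\<in>?O. cmod (c s v) * cmod (msec v B z))"
        by (simp add: norm_sum[THEN order_trans] norm_mult sum_norm_le)
      hence "(cmod (s B z))\<^sup>2 \<le> (\<Sum>v\<in>?O. cmod (c s v) * cmod (msec v B z))\<^sup>2"
        by (intro power_mono) auto
      also have "\<dots> \<le> (\<Sum>v\<in>?O. (cmod (c s v))\<^sup>2) * (\<Sum>v\<in>?O. (cmod (msec v B z))\<^sup>2)"
        by (rule Cauchy_Schwarz_ineq_sum)
      finally show ?thesis by (simp add: local_norm_def)
    qed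
    hence "mS B z \<le> (\<Sum>s\<in>S. (\<Sum>v\<in>?O. (cmod (c s v))\<^sup>2) * local_norm ?O B z)"
      unfolding mS_def by (rule sum_mono)
    also have "\<dots> \<le> C1 * local_norm ?O B z"
      unfolding sum_distrib_right[symmetric] C1_def
      by (intro mult_right_mono) (auto simp: local_norm_def intro!: sum_nonneg)
    finally show ?thesis .
  qed
  obtain R where R: "finite R" "R \<subseteq> charts \<Delta>" "\<And>x. x \<in> ctorus \<Longrightarrow> \<exists>B\<in>R. torus_coords B x \<in> polydisc"
    using torus_polydisc_cover[OF sc] by blast
  have "(\<integral>\<^sup>+x\<in>open_orbit. ennreal ((\<Sum>v\<in>?O. weight_norm v x) powr - p') \<partial>\<mu>) \<le>
    (\<Sum>B\<in>R. \<integral>\<^sup>+z\<in>ctorus \<inter> polydisc. ennreal ((\<Sum>v\<in>?O. weight_norm v (chart_point B z)) powr - p') *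
        ennreal (\<rho> B z) \<partial>lborel)"
    by (rule nn_integral_polydiscs[OF hd R]) (use sum_weight_norm_measurable[OF OW] in measurable)
  also have "\<dots> < \<infinity>"
  proof -
    have "(\<integral>\<^sup>+z\<in>ctorus \<inter> polydisc. ennreal ((\<Sum>v\<in>?O. weight_norm v (chart_point B z)) powr - p') *
        ennreal (\<rho> B z) \<partial>lborel) < \<infinity>"
      if "B \<in> R" for B
    proof -
      have B: "B \<in> charts \<Delta>" using that R by blast
      \<comment> \<open>the summand 1 keeps the power continuous where the sum vanishes, also for \<open>p = p'\<close>\<close>
      let ?g = "\<lambda>z. C1 powr p * (local_norm ?O B z + 1) powr (p - p') * h B z powr - p' * \<rho> B z"
      have nn: "local_norm ?O B z \<ge> 0" for z by (simp add: local_norm_def sum_nonneg)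
      have "continuous_on polydisc ?g"
      proof (intro continuous_intros continuous_local_norm metric_continuous density_continuous B)
        show "\<forall>z\<in>polydisc. local_norm ?O B z + 1 \<noteq> 0" using nn by (smt (verit))
        show "\<forall>z\<in>polydisc. h B z \<noteq> 0" using metric_pos[OF B] by (simp add: less_imp_neq[symmetric])
      qed
      hence "bounded (?g ` polydisc)"
        by (intro compact_imp_bounded compact_continuous_image compact_polydisc)
      then obtain E0 where E0: "\<And>z. z \<in> polydisc \<Longrightarrow> \<bar>?g z\<bar> \<le> E0" unfolding bounded_iff by auto
      define E where "E = \<bar>E0\<bar> + 1"
      have "?g z \<le> E" if "z \<in> polydisc" for z using E0[OF that] unfolding E_def by linarith
      moreover have "E > 0" by (simp add: E_def)
      ultimately have E: "E > 0" "\<And>z. z \<in> polydisc \<Longrightarrow> ?g z \<le> E" by blast+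
      let ?F = "\<lambda>z. inverse (ennreal (mS B z powr p))"
      have F: "?F \<in> borel_measurable borel"
      proof -
        have "continuous_on UNIV (s B)" if "s \<in> S" for s
          by (subst c(1)[OF that]) (intro continuous_at_imp_continuous_on ballI isCont_combination)
        hence "continuous_on UNIV (mS B)" unfolding mS_def by (intro continuous_intros) auto
        hence "mS B \<in> borel_measurable borel" by (rule borel_measurable_continuous_onI)
        thus ?thesis by measurable
      qed
      have "(\<integral>\<^sup>+z\<in>ctorus \<inter> polydisc. ennreal ((\<Sum>v\<in>?O. weight_norm v (chart_point B z)) powr - p') *
          ennreal (\<rho> B z) \<partial>lborel)
        \<le> (\<integral>\<^sup>+z. ennreal E * (?F z * indicator polydisc z) \<partial>lborel)"
      proof (rule nn_integral_mono)
        fix z :: "complex ^ 'n"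
        show "ennreal ((\<Sum>v\<in>?O. weight_norm v (chart_point B z)) powr - p') * ennreal (\<rho> B z) * indicator
            (ctorus \<inter> polydisc) z
          \<le> ennreal E * (?F z * indicator polydisc z)"
        proof (cases "z \<in> ctorus \<inter> polydisc")
          case True
          define m where "m = local_norm ?O B z"
          have m: "m > 0" unfolding m_def using True by (intro local_norm_pos[OF OW One B]) auto
          note hp = metric_pos[OF B, of z] and rp = density_pos[OF B, of z]
          have sum_eq: "(\<Sum>v\<in>?O. weight_norm v (chart_point B z)) = m * h B z"
            by (simp add: sum_weight_norm_chart_point[OF OW B] m_def)
          show ?thesis
          proof (cases "mS B z = 0")
            case True
            thus ?thesis using E(1) \<open>z \<in> ctorus \<inter> polydisc\<close> by (simp add: ennreal_mult_top)
          next
            case False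
            have mSp: "mS B z > 0" using False by (metis mS_def order_le_less sum_nonneg zero_le_power2)
            have "m powr - p' = m powr (p - p') * m powr - p" by (simp flip: powr_add)
            also have "\<dots> \<le> (m + 1) powr (p - p') * (C1 powr p * mS B z powr - p)"
            proof (intro mult_mono)
              show "m powr (p - p') \<le> (m + 1) powr (p - p')" using p m by (intro powr_mono2) auto
              have "m powr - p = C1 powr p * (C1 * m) powr - p" using C1 m by (simp add: powr_mult powr_minus)
              also have "\<dots> \<le> C1 powr p * mS B z powr - p"
                using mS_le[of B z] mSp p C1 by (intro mult_left_mono powr_mono2') (auto simp: m_def)
              finally show "m powr - p \<le> C1 powr p * mS B z powr - p" .
            qed auto
            finally have "m powr - p' * (h B z powr - p' * \<rho> B z) \<le>
              (m + 1) powr (p - p') * (C1 powr p * mS B z powr - p) * (h B z powr - p' * \<rho> B z)"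
              using rp by (intro mult_right_mono) auto
            also have "\<dots> = ?g z * mS B z powr - p" by (simp add: m_def mult_ac)
            also have "\<dots> \<le> E * mS B z powr - p"
              using E(2)[of z] True by (intro mult_right_mono) auto
            finally have "ennreal ((m * h B z) powr - p' * \<rho> B z) \<le> ennreal (E * mS B z powr - p)"
              by (intro ennreal_leI) (simp add: powr_mult mult_ac)
            thus ?thesis using True E(1) rp
              by (simp add: sum_eq inverse_ennreal_powr[OF mSp] ennreal_mult)
          qed
        qed simp
      qed
      also have "\<dots> = ennreal E * (\<integral>\<^sup>+z\<in>polydisc. ?F z \<partial>lborel)"
      proof (rule nn_integral_cmult)
        have "(polydisc :: (complex ^ 'n) set) \<in> sets borel"
          by (rule borel_closed[OF compact_imp_closed[OF compact_polydisc]])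
        thus "(\<lambda>z. ?F z * indicator polydisc z) \<in> borel_measurable lborel" using F by simp
      qed
      also have "\<dots> < \<infinity>"
      proof -
        have "(\<integral>\<^sup>+z\<in>polydisc. ?F z \<partial>lborel) < \<infinity>"
          by (rule nn_integral_compact_finite[OF F compact_polydisc])
            (use int B in \<open>auto simp: locally_integrable_power_def mS_def\<close>)
        thus ?thesis by (simp add: ennreal_mult_less_top)
      qed
      finally show ?thesis .
    qed
    thus ?thesis using R(1) by (simp add: ennreal_sum_less_top)
  qed
  finally show ?thesis .
qed

text \<open>
  Let \<open>M\<close> be the largest coefficient of the diagonal form \<open>f\<close> underlying \<open>\<phi>\<close>, attained at \<open>u\<close>.
  Then \<open>f \<le> M C\<close>, which bounds the supremum of \<open>\<phi>\<close>; and \<open>f\<close> dominates \<open>M\<close> times the term of weight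
  \<open>u\<close>, hence by invariance each term of the orbit of \<open>u\<close>, so \<open>f\<close> is at least the sum over the
  orbit times \<open>M\<close> divided by the number of weights. The factor \<open>M\<close> cancels.
\<close>

lemma potential_bound:
  assumes \<phi>: "\<phi> \<in> potentials" and p: "p > 0"
    and C: "C > 0" "\<And>x. x \<in> X \<Longrightarrow> (\<Sum>u\<in>W. weight_norm u x) \<le> C"
  shows "\<exists>u\<in>W. \<forall>x\<in>open_orbit. exp (- (real k * p) * (\<phi> x - (SUP y\<in>X. \<phi> y))) \<le>
    (C * real (card W)) powr p * (\<Sum>v\<in>orbit u. weight_norm v x) powr - p"
proof -
  obtain S where S: "basis_of S (H0 \<Delta> k)" "\<phi> = (\<lambda>x. 1 / real k * ln (\<Sum>s\<in>S. norm_sq \<Delta> h s x))"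
    and inv: "\<And>g x. g \<in> toric_group H \<Longrightarrow> x \<in> X \<Longrightarrow> \<phi> (g x) = \<phi> x"
    using \<phi> unfolding bergman_potentials_def by blast
  have finS: "finite S" and span: "coeffs.span S = H0 \<Delta> k" using S(1) by (auto simp: basis_of_def)
  have SH: "s \<in> H0 \<Delta> k" if "s \<in> S" for s using coeffs.span_base[OF that] span by simp
  define f where "f x = (\<Sum>s\<in>S. norm_sq \<Delta> h s x)" for x
  have \<phi>_f: "\<phi> x = 1 / real k * ln (f x)" for x by (simp add: S(2) f_def)
  have f_pos: "f x > 0" if x: "x \<in> X" for x
  proof -
    obtain B z where B: "B \<in> charts \<Delta>" "x = chart_point B z" using x by (auto simp: toric_variety_def)
    obtain u where u: "u \<in> W" "msec u B z \<noteq> 0" using vertex_section_nonzero[OF B(1)] by blast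
    have "\<exists>s\<in>S. s B z \<noteq> 0"
    proof (rule ccontr)
      assume "\<not> (\<exists>s\<in>S. s B z \<noteq> 0)"
      moreover have "coeffs.subspace {s. s B z = 0}"
        by (rule coeffs.subspaceI) (auto simp: scale_coeffs_def)
      ultimately have "coeffs.span S \<subseteq> {s. s B z = 0}" by (intro coeffs.span_minimal) auto
      thus False using span monomial_section_H0[OF fin u(1)] u(2) by blast
    qed
    then obtain s where s: "s \<in> S" "s B z \<noteq> 0" by blast
    have val: "norm_sq \<Delta> h s' x = (cmod (s' B z))\<^sup>2 * h B z" if "s' \<in> S" for s'
      unfolding B(2) by (rule norm_sq_chart_point[OF h SH[OF that] B(1)])
    show ?thesis
      unfolding f_def
    proof (rule sum_pos2[OF finS s(1)])
      show "0 < norm_sq \<Delta> h s x" using s metric_pos[OF B(1)] by (simp add: val)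
      show "0 \<le> norm_sq \<Delta> h s' x" if "s' \<in> S" for s'
        using less_imp_le[OF metric_pos[OF B(1)]] by (simp add: val[OF that])
    qed
  qed
  have gX: "g x \<in> X" if G: "g \<in> toric_group H" and x: "x \<in> X" for g x
    using G toric_act_variety'[OF _ _ x] by (auto simp: toric_group_def)
  have f_inv: "f (g x) = f x" if "g \<in> toric_group H" "x \<in> X" for g x
  proof -
    have "ln (f (g x)) = ln (f x)" using inv[OF that] k by (simp add: \<phi>_f)
    thus ?thesis using f_pos[OF that(2)] f_pos[OF gX[OF that]] by (simp add: ln_inj_iff)
  qed
  have "\<exists>c. s = comb c" if "s \<in> S" for s
    using H0_combination[OF fin ne SH[OF that]] by blast
  then obtain c where c: "\<And>s. s \<in> S \<Longrightarrow> s = comb (c s)" by metis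
  define a where "a u = (\<Sum>s\<in>S. (cmod (c s u))\<^sup>2)" for u
  have a_nonneg: "a u \<ge> 0" for u by (simp add: a_def sum_nonneg)
  have f_c: "f x = (\<Sum>s\<in>S. norm_sq \<Delta> h (comb (c s)) x)" for x
    unfolding f_def by (rule sum.cong) (use c in auto)
  have diag: "f x = (\<Sum>u\<in>W. a u * weight_norm u x)" if x: "x \<in> X" for x
    unfolding f_c a_def weight_norm_def
  proof (rule invariant_form_diagonal[OF fano k h _ _ x])
    show "isometry_coeffs \<Delta> k (toric_act (mat 1) t) h" if "t \<in> compact_torus" for t
      by (rule H_isometry[OF H_one that])
    show "(\<Sum>s\<in>S. norm_sq \<Delta> h (comb (c s)) (toric_act (mat 1) t y)) =
      (\<Sum>s\<in>S. norm_sq \<Delta> h (comb (c s)) y)" if "t \<in> compact_torus" "y \<in> X" for t y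
      using f_inv[OF toric_groupI[OF H_one that(1)] that(2)] unfolding f_c .
  qed
  have Wne: "W \<noteq> {}" using vertex_section_nonzero ne by blast
  obtain u where u: "u \<in> W" "\<And>v. v \<in> W \<Longrightarrow> a v \<le> a u"
  proof -
    have "Max (a ` W) \<in> a ` W" using fin Wne by (intro Max_in) auto
    then obtain u where "u \<in> W" "a u = Max (a ` W)" by auto
    thus ?thesis using that[of u] fin by auto
  qed
  define M where "M = a u"
  have upper: "f x \<le> M * C" if x: "x \<in> X" for x
  proof -
    have "f x \<le> (\<Sum>v\<in>W. M * weight_norm v x)"
      unfolding diag[OF x] M_def by (intro sum_mono mult_right_mono u(2) weight_norm_nonneg x)
    also have "\<dots> \<le> M * C"
      unfolding sum_distrib_left[symmetric] using a_nonneg[of u] by (intro mult_left_mono C(2)[OF x])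
          (simp add: M_def)
    finally show ?thesis .
  qed
  obtain x0 where x0: "x0 \<in> X" using ne chart_point_variety by blast
  have M: "M > 0"
  proof -
    have "0 < M * C" using f_pos[OF x0] upper[OF x0] by linarith
    thus ?thesis using C(1) by (simp add: zero_less_mult_iff)
  qed
  define N where "N = real (card W)"
  have N: "N > 0" using fin Wne by (simp add: N_def card_gt_0_iff)
  have lower: "M * (\<Sum>v\<in>orbit u. weight_norm v x) \<le> N * f x" if x: "x \<in> open_orbit" for x
  proof -
    have xX: "x \<in> X" using x open_orbit_subset by blast
    have "M * weight_norm v x \<le> f x" if "v \<in> orbit u" for v
    proof -
      from that obtain A where A: "A \<in> H" "v = A *v u" by (auto simp: orbit_def)
      from x obtain x' where x': "x' \<in> ctorus" "x = torus_point x'" by (auto simp: open_orbit_def)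
      \<comment> \<open>the preimage of \<open>x\<close> under the action of \<open>A\<close>, where the term of weight \<open>u\<close> has the value of the
          term of weight \<open>v\<close> at \<open>x\<close>\<close>
      obtain y' where y': "y' \<in> ctorus" "torus_act A (\<chi> i. 1) y' = x'"
        using torus_act_surj[OF H_invertible[OF A(1)] ones_ctorus x'(1)] by blast
      define y where "y = torus_point y'"
      have y: "y \<in> X" "toric_act A (\<chi> i. 1) y = x"
        using y' x' torus_point_variety[OF ne y'(1)] by (simp_all add: y_def toric_act_torus_point)
      have "M * weight_norm v x = a u * weight_norm u y"
        using weight_norm_equivariant[OF A(1) ones_compact_torus u(1) y(1)] by (simp add: y(2) A(2) M_def)
      also have "\<dots> \<le> (\<Sum>v\<in>W. a v * weight_norm v y)"
        by (rule member_le_sum[OF u(1) _ fin]) (use a_nonneg weight_norm_nonneg[OF _ y(1)] in auto)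
      also have "\<dots> = f x"
        using f_inv[OF toric_groupI[OF A(1) ones_compact_torus] y(1)] by (simp add: diag[OF y(1)] y(2))
      finally show ?thesis .
    qed
    hence "M * (\<Sum>v\<in>orbit u. weight_norm v x) \<le> (\<Sum>v\<in>orbit u. f x)"
      unfolding sum_distrib_left by (rule sum_mono)
    also have "\<dots> \<le> N * f x"
      using card_mono[OF fin orbit_weights[OF u(1)]] less_imp_le[OF f_pos[OF xX]]
      by (simp add: N_def mult_right_mono)
    finally show ?thesis .
  qed
  define s where "s = (SUP y\<in>X. \<phi> y)"
  have s_le: "s \<le> 1 / real k * ln (M * C)"
    unfolding s_def
  proof (rule cSUP_least)
    fix y assume y: "y \<in> X"
    show "\<phi> y \<le> 1 / real k * ln (M * C)"
      unfolding \<phi>_f using upper[OF y] f_pos[OF y] by (intro mult_left_mono ln_mono) auto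
  qed (use x0 in blast)
  have "exp (- (real k * p) * (\<phi> x - s)) \<le> (C * N) powr p * (\<Sum>v\<in>orbit u. weight_norm v x) powr - p"
    if x: "x \<in> open_orbit" for x
  proof -
    have xX: "x \<in> X" using x open_orbit_subset by blast
    define Q where "Q = (\<Sum>v\<in>orbit u. weight_norm v x)"
    have Q: "Q > 0" unfolding Q_def using sum_weight_norm_pos[OF orbit_weights[OF u(1)] _ x] orbit_mem by blast
    have "real k * p * s \<le> real k * p * (1 / real k * ln (M * C))"
      using p k by (intro mult_left_mono s_le) auto
    hence "- (real k * p) * (\<phi> x - s) \<le> - p * ln (f x) + p * ln (M * C)"
      using k by (simp add: \<phi>_f algebra_simps)
    hence "exp (- (real k * p) * (\<phi> x - s)) \<le> exp (- p * ln (f x) + p * ln (M * C))" by simp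
    also have "\<dots> = f x powr - p * (M * C) powr p"
      using f_pos[OF xX] M C(1) by (simp add: powr_def flip: exp_add)
    also have "\<dots> \<le> (M * Q / N) powr - p * (M * C) powr p"
    proof (intro mult_right_mono powr_mono2')
      show "M * Q / N \<le> f x" using lower[OF x] N by (simp add: Q_def field_simps)
    qed (use p M Q N in auto)
    also have "\<dots> = (C * N) powr p * Q powr - p"
      using M Q N C(1) by (simp add: powr_mult powr_divide powr_minus field_simps)
    finally show ?thesis by (simp add: Q_def)
  qed
  thus ?thesis using u(1) unfolding s_def N_def by blast
qed

text \<open>
  The bound of \<open>potential_bound\<close> depends on the potential only through an orbit, and there are
  finitely many weights; this gives the uniformity in the potential.
\<close>

lemma orbit_thresholds_le_alpha:
  assumes p: "p > 0" and int: "\<And>u. u \<in> W \<Longrightarrow> \<exists>S q. p \<le> q \<and>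
    basis_of S (sections_on (orbit u)) \<and> locally_integrable_power \<Delta> S q"
  shows "ereal (real k * p) \<le> alpha \<Delta> k (toric_group H) h \<mu>"
proof -
  obtain C where C: "C > 0" "\<And>x. x \<in> X \<Longrightarrow> (\<Sum>u\<in>W. weight_norm u x) \<le> C"
    using total_weight_norm_bounded by blast
  let ?Q = "\<lambda>u x. ennreal ((\<Sum>v\<in>orbit u. weight_norm v x) powr - p)"
  define D where "D = (C * real (card W)) powr p"
  define K where "K = (\<Sum>u\<in>W. \<integral>\<^sup>+x\<in>open_orbit. ?Q u x \<partial>\<mu>)"
  have Kfin: "K < \<infinity>"
  proof -
    have "(\<integral>\<^sup>+x\<in>open_orbit. ?Q u x \<partial>\<mu>) < \<infinity>" if u: "u \<in> W" for u
    proof -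
      obtain S q where "p \<le> q" "basis_of S (sections_on (orbit u))" "locally_integrable_power \<Delta> S q"
        using int[OF u] by blast
      thus ?thesis using orbit_integral_finite[OF u _ _ p] by blast
    qed
    thus ?thesis unfolding K_def using fin by (simp add: ennreal_sum_less_top)
  qed
  have "(\<integral>\<^sup>+x. ennreal (exp (- (real k * p) * (\<phi> x - (SUP y\<in>X. \<phi> y)))) \<partial>\<mu>) \<le> ennreal D * K"
    if \<phi>: "\<phi> \<in> potentials" for \<phi>
  proof -
    let ?e = "\<lambda>x. exp (- (real k * p) * (\<phi> x - (SUP y\<in>X. \<phi> y)))"
    obtain u where u: "u \<in> W" "\<And>x. x \<in> open_orbit \<Longrightarrow> ?e x \<le> D * (\<Sum>v\<in>orbit u. weight_norm v x) powr - p"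
      using potential_bound[OF \<phi> p C] unfolding D_def by blast
    have "(\<integral>\<^sup>+x. ennreal (?e x) \<partial>\<mu>) \<le> (\<integral>\<^sup>+x. ennreal D * (?Q u x * indicator open_orbit x) \<partial>\<mu>)"
    proof (rule nn_integral_mono_AE)
      show "AE x in \<mu>. ennreal (?e x) \<le> ennreal D * (?Q u x * indicator open_orbit x)"
        using open_orbit_full_measure[OF hd ne]
      proof eventually_elim
        fix x :: "'n toric_point" assume x: "x \<in> open_orbit"
        have "ennreal (?e x) \<le> ennreal (D * (\<Sum>v\<in>orbit u. weight_norm v x) powr - p)"
          by (rule ennreal_leI[OF u(2)[OF x]])
        thus "ennreal (?e x) \<le> ennreal D * (?Q u x * indicator open_orbit x)"
          using x by (simp add: ennreal_mult D_def)
      qed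
    qed
    also have "\<dots> = ennreal D * (\<integral>\<^sup>+x\<in>open_orbit. ?Q u x \<partial>\<mu>)"
    proof (rule nn_integral_cmult)
      have "?Q u \<in> borel_measurable \<mu>"
        by (rule measurable_toric[OF hd])
          (use sum_weight_norm_measurable[OF orbit_weights[OF u(1)]] in measurable)
      thus "(\<lambda>x. ?Q u x * indicator open_orbit x) \<in> borel_measurable \<mu>"
        using open_orbit_sets[OF hd ne] by simp
    qed
    also have "\<dots> \<le> ennreal D * K"
      unfolding K_def using fin u(1)
      by (intro mult_left_mono member_le_sum[of u W "\<lambda>u. \<integral>\<^sup>+x\<in>open_orbit. ?Q u x \<partial>\<mu>"]) auto
    finally show ?thesis .
  qed
  hence "(SUP \<phi>\<in>potentials.
      \<integral>\<^sup>+x. ennreal (exp (- (real k * p) * (\<phi> x - (SUP y\<in>X. \<phi> y)))) \<partial>\<mu>) \<le> ennreal D * K"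
    by (rule SUP_least)
  also have "\<dots> < \<infinity>" using Kfin by (simp add: ennreal_mult_less_top)
  finally show ?thesis
    unfolding alpha_def using p k by (intro Sup_upper imageI) simp
qed

lemma alpha_le_glct: "alpha \<Delta> k (toric_group H) h \<mu> \<le> glct \<Delta> k (toric_group H)"
  unfolding alpha_def
proof (rule Sup_least)
  fix y assume "y \<in> ereal ` {c. c > 0 \<and>
      (SUP \<phi>\<in>potentials.
         \<integral>\<^sup>+x. ennreal (exp (- c * (\<phi> x - (SUP y\<in>X. \<phi> y)))) \<partial>\<mu>) < \<infinity>}"
  then obtain c where y: "y = ereal c" and c: "c > 0" "(SUP \<phi>\<in>potentials.
         \<integral>\<^sup>+x. ennreal (exp (- c * (\<phi> x - (SUP y\<in>X. \<phi> y)))) \<partial>\<mu>) < \<infinity>" by blast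
  have "ereal (c / real k) \<le> (INF V\<in>{V. invariant V \<and> V \<noteq> {0}}. lct \<Delta> V)"
    by (rule INF_greatest) (use alpha_le_lct[OF c] in blast)
  hence "ereal (real k) * ereal (c / real k) \<le> glct \<Delta> k (toric_group H)"
    unfolding glct_def by (intro ereal_mult_left_mono) auto
  thus "y \<le> glct \<Delta> k (toric_group H)" using k by (simp add: y)
qed

lemma glct_le_alpha: "glct \<Delta> k (toric_group H) \<le> alpha \<Delta> k (toric_group H) h \<mu>"
proof (rule dense_le)
  fix y assume "y < glct \<Delta> k (toric_group H)"
  then obtain c where c: "y < ereal c" "ereal c < glct \<Delta> k (toric_group H)" using ereal_dense2 by blast
  have lt: "ereal (c / real k) < lct \<Delta> (sections_on (orbit u))" if u: "u \<in> W" for u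
  proof -
    let ?I = "INF V\<in>{V. invariant V \<and> V \<noteq> {0}}. lct \<Delta> V"
    have "ereal c < ereal (real k) * ?I" using c(2) by (simp add: glct_def)
    hence "ereal (c / real k) < ?I" using k by (cases ?I) (auto simp: field_simps)
    also have "?I \<le> lct \<Delta> (sections_on (orbit u))"
      by (rule INF_lower) (use orbit_subspace[OF u] in blast)
    finally show ?thesis .
  qed
  have "\<exists>q. q > 0 \<and> c / real k < q \<and>
      (\<exists>S. basis_of S (sections_on (orbit u)) \<and> locally_integrable_power \<Delta> S q)" if u: "u \<in> W" for u
    using lt[OF u] unfolding lct_def less_Sup_iff by auto
  \<comment> \<open>exponents in the definition of \<open>lct\<close> are positive, so \<open>p > 0\<close> below even when \<open>c \<le> 0\<close>\<close>
  then obtain q where q: "\<And>u. u \<in> W \<Longrightarrow> q u > 0" "\<And>u. u \<in> W \<Longrightarrow> c / real k < q u"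
    "\<And>u. u \<in> W \<Longrightarrow> \<exists>S. basis_of S (sections_on (orbit u)) \<and> locally_integrable_power \<Delta> S (q u)"
    by metis
  define p where "p = Min (q ` W)"
  have Wne: "W \<noteq> {}" using vertex_section_nonzero ne by blast
  have "p \<in> q ` W" unfolding p_def using fin Wne by (intro Min_in) auto
  hence p: "p > 0" "c / real k < p" using q by auto
  have "p \<le> q u" if "u \<in> W" for u unfolding p_def using fin that by simp
  hence "ereal (real k * p) \<le> alpha \<Delta> k (toric_group H) h \<mu>"
    using q(3) by (intro orbit_thresholds_le_alpha p(1)) blast
  moreover have "y \<le> ereal (real k * p)"
  proof -
    have "c \<le> real k * p" using p(2) k by (simp add: field_simps)
    thus ?thesis using c(1) by (meson ereal_less_eq(3) less_imp_le order_trans)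
  qed
  ultimately show "y \<le> alpha \<Delta> k (toric_group H) h \<mu>" by (rule order_trans[rotated])
qed

end

theorem proposition1p3:
  fixes \<Delta> :: "(real ^ 'n) set set"
    and H :: "(int ^ 'n ^ 'n) set"
    and k :: nat
    and h :: "'n local_metric"
    and \<mu> :: "'n toric_point measure"
  assumes "toric_fano \<Delta>"
    and "subgroup H (Aut_polytope (anticanonical_polytope \<Delta>))"
    and "k \<ge> 1"
    and "continuous_hermitian_metric \<Delta> k h"
    and "invariant_metric \<Delta> k (toric_group H) h"
    and "continuous_volume_form \<Delta> \<mu>"
  shows "glct \<Delta> k (toric_group H) = alpha \<Delta> k (toric_group H) h \<mu>"
proof -
  obtain \<rho> where "has_densities \<Delta> \<mu> \<rho>" using continuous_volume_form_densities[OF assms(6)] by blast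
  with assms interpret toric_data \<Delta> H k h \<mu> \<rho> by (simp add: toric_data_def)
  show ?thesis by (rule antisym[OF glct_le_alpha alpha_le_glct])
qed

end
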